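(* Let $\mathbf H$ be a smooth periodic Hankel operator and let $\Delta^\#(s;\lambda)$ be its residual secular determinant. Then for all $s\in\mathbb C\setminus\Lambda$ and $\lambda\in\mathbb C\setminus\{0\}$, $$\Delta^\#(s;\lambda)=-\alpha(\lambda)\mathcal P(s)+\beta(\lambda),\qquad \alpha(\lambda)=-i\operatorname{Res}_{s=i/2}\Delta^\#(s;\lambda),\quad \beta(\lambda)=\Delta^\#\big(\tfrac{\omega+i}2;\lambda\big),$$ and: (i) $\alpha$ and $\beta$ are entire functions of $1/\lambda$; (ii) $\overline{\alpha(\lambda)}=\alpha(\bar\lambda)$ and $\overline{\beta(\lambda)}=\beta(\bar\lambda)$; in particular $\alpha,\beta$ are real for real $\lambda\neq0$; (iii) $\alpha(-\lambda)=-\alpha(\lambda)$ and $\beta(-\lambda)=\beta(\lambda)$; (iv) for every non-flat band function $E$ and every $k\in\mathbb R$, $\alpha(E(k))\neq0$.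
   Context: Fix $T>0$, $\omega=2\pi/T$, $\Lambda=\{\omega n+i(m+\frac12):n,m\in\mathbb Z\}$. $p$ is a real-valued $T$-periodic function with Fourier coefficients $\widetilde p_\ell=\frac1T\int_0^Te^{-i\ell\omega x}p(x)dx$ satisfying $\sum_\ell|\widetilde p_\ell|(1+\ell^2)^{1/4}<\infty$; $\mathbf H$ is the Hankel operator on $L^2(\mathbb R_+)$ with kernel $h(t)=p(\log t)/t$. For $s\in\mathbb C\setminus\Lambda$, $H(s)$ is the operator on $\ell^2(\mathbb Z)$ with matrix $[H(s)]_{n,m}=B(\frac12-i\omega n-is,\frac12+i\omega m+is)\widetilde p_{n-m}$, $B(z_1,z_2)=\Gamma(z_1)\Gamma(z_2)/\Gamma(z_1+z_2)$, and $H^{(N)}(s)$ is the (trace class) operator with the same entries for $|n-m|\le N$ and $0$ otherwise. The secular determinant is $\Delta(s;\lambda)=\lim_{N\to\infty}\det(I-\lambda^{-1}H^{(N)}(s))$ (the limit exists for all $s\notin\Lambda$, $\lambda\ne0$, and equals $\det(I-\lambda^{-1}H(s))$ when $|\operatorname{Im} s|<1$). Band functions: the (unique up to ordering) finite or countable list $\mathcal E$, repetitions allowed, of non-vanishing real analytic real functions on $\mathbb R$ such that for every real $k$ the non-zero eigenvalues of $H(k)$ with multiplicity are exactly $E(k)$, $E\in\mathcal E$, counted with repetition; flat = constant, non-flat = non-constant. With $\mathcal E^\flat$ the sublist of flat band functions (constants $E$), $\Delta^\flat(\lambda)=\prod_{E\in\mathcal E^\flat}(1-E/\lambda)$, and the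 residual secular determinant $\Delta^\#(s;\lambda)$ is the function, entire in $1/\lambda$ for each $s\notin\Lambda$, with $\Delta(s;\lambda)=\Delta^\#(s;\lambda)\Delta^\flat(\lambda)$. Finally $\mathcal P(s)=\sum_{n\in\mathbb Z}\frac{\pi}{\cosh\pi(n\omega+s)}$, $s\in\mathbb C\setminus\Lambda$. *)

theory Defs
  imports "HOL-Complex_Analysis.Complex_Analysis" "HOL-Combinatorics.Permutations"
begin

definition omega :: "real \<Rightarrow> real" where
  "omega T = 2 * pi / T"

definition Lam :: "real \<Rightarrow> complex set" where
  "Lam T = {complex_of_real (omega T * of_int n) + \<i> * (of_int m + 1/2) | n m :: int. True}"

definition fcoef :: "real \<Rightarrow> (real \<Rightarrow> real) \<Rightarrow> int \<Rightarrow> complex" where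
  "fcoef T p l = (1 / complex_of_real T) *
      integral {0..T} (\<lambda>x. exp (- \<i> * of_int l * complex_of_real (omega T * x)) * complex_of_real (p x))"

definition Hmat :: "real \<Rightarrow> (real \<Rightarrow> real) \<Rightarrow> complex \<Rightarrow> int \<Rightarrow> int \<Rightarrow> complex" where
  "Hmat T p s n m = Beta (1/2 - \<i> * complex_of_real (omega T * of_int n) - \<i> * s)
                         (1/2 + \<i> * complex_of_real (omega T * of_int m) + \<i> * s) * fcoef T p (n - m)"

definition HmatN :: "real \<Rightarrow> (real \<Rightarrow> real) \<Rightarrow> nat \<Rightarrow> complex \<Rightarrow> int \<Rightarrow> int \<Rightarrow> complex" where
  "HmatN T p N s n m = (if \<bar>n - m\<bar> \<le> int N then Hmat T p s n m else 0)"

definition subdet :: "(int \<Rightarrow> int \<Rightarrow> complex) \<Rightarrow> int set \<Rightarrow> complex" where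
  "subdet A I = (\<Sum>\<pi> \<in> {\<pi>. \<pi> permutes I}. of_int (sign \<pi>) * (\<Prod>i\<in>I. A i (\<pi> i)))"

text \<open>Fredholm determinant det(I - z A) of a trace class operator on l2(Z) given by its
  matrix A, via Fredholm's expansion in principal minors:
  det(I - zA) = sum over finite index sets I of (-z)^|I| det(A restricted to I).\<close>
definition fredholm_det :: "(int \<Rightarrow> int \<Rightarrow> complex) \<Rightarrow> complex \<Rightarrow> complex" where
  "fredholm_det A z = (\<Sum>\<^sub>\<infinity> I \<in> {I :: int set. finite I}. (- z) ^ card I * subdet A I)"

definition Delta :: "real \<Rightarrow> (real \<Rightarrow> real) \<Rightarrow> complex \<Rightarrow> complex \<Rightarrow> complex" where
  "Delta T p s lam = lim (\<lambda>N. fredholm_det (HmatN T p N s) (1 / lam))"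

definition l2 :: "(int \<Rightarrow> complex) \<Rightarrow> bool" where
  "l2 x \<longleftrightarrow> (\<lambda>n. (cmod (x n))\<^sup>2) summable_on UNIV"

definition eigvec :: "(int \<Rightarrow> int \<Rightarrow> complex) \<Rightarrow> complex \<Rightarrow> (int \<Rightarrow> complex) \<Rightarrow> bool" where
  "eigvec A mu x \<longleftrightarrow> l2 x \<and> (\<forall>n. ((\<lambda>m. A n m * x m) has_sum (mu * x n)) UNIV)"

definition lin_indep :: "(nat \<Rightarrow> int \<Rightarrow> complex) \<Rightarrow> nat \<Rightarrow> bool" where
  "lin_indep vs d \<longleftrightarrow>
     (\<forall>c :: nat \<Rightarrow> complex. (\<forall>n. (\<Sum>i<d. c i * vs i n) = 0) \<longrightarrow> (\<forall>i<d. c i = 0))"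

definition eig_mult :: "(int \<Rightarrow> int \<Rightarrow> complex) \<Rightarrow> complex \<Rightarrow> nat \<Rightarrow> bool" where
  "eig_mult A mu d \<longleftrightarrow>
     (\<exists>vs. (\<forall>i<d. eigvec A mu (vs i)) \<and> lin_indep vs d) \<and>
     \<not> (\<exists>vs. (\<forall>i<Suc d. eigvec A mu (vs i)) \<and> lin_indep vs (Suc d))"

definition real_analytic :: "(real \<Rightarrow> real) \<Rightarrow> bool" where
  "real_analytic f \<longleftrightarrow>
     (\<forall>x. \<exists>r>0. \<exists>c :: nat \<Rightarrow> real. \<forall>y. \<bar>y - x\<bar> < r \<longrightarrow> (\<lambda>n. c n * (y - x) ^ n) sums f y)"

text \<open>(E j)_{j in J} (J a subset of nat, i.e. a finite or countable list, repetitions allowed)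
  is the list of band functions of H.\<close>
definition band_functions :: "real \<Rightarrow> (real \<Rightarrow> real) \<Rightarrow> nat set \<Rightarrow> (nat \<Rightarrow> real \<Rightarrow> real) \<Rightarrow> bool" where
  "band_functions T p J E \<longleftrightarrow>
     (\<forall>j\<in>J. real_analytic (E j) \<and> (\<forall>k. E j k \<noteq> 0)) \<and>
     (\<forall>k::real. \<forall>mu::complex. mu \<noteq> 0 \<longrightarrow>
        finite {j\<in>J. complex_of_real (E j k) = mu} \<and>
        eig_mult (Hmat T p (complex_of_real k)) mu (card {j\<in>J. complex_of_real (E j k) = mu}))"

definition flat :: "(real \<Rightarrow> real) \<Rightarrow> bool" where
  "flat f \<longleftrightarrow> (\<exists>c. \<forall>k. f k = c)"

definition Delta_flat :: "nat set \<Rightarrow> (nat \<Rightarrow> real \<Rightarrow> real) \<Rightarrow> complex \<Rightarrow> complex" where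
  "Delta_flat J E lam =
     (\<Prod>j. if j \<in> J \<and> flat (E j) then 1 - complex_of_real (E j 0) / lam else 1)"

definition residual_det :: "real \<Rightarrow> (real \<Rightarrow> real) \<Rightarrow> nat set \<Rightarrow> (nat \<Rightarrow> real \<Rightarrow> real)
     \<Rightarrow> (complex \<Rightarrow> complex \<Rightarrow> complex) \<Rightarrow> bool" where
  "residual_det T p J E D \<longleftrightarrow>
     (\<forall>s. s \<notin> Lam T \<longrightarrow>
        (\<exists>g. g holomorphic_on UNIV \<and> (\<forall>lam. lam \<noteq> 0 \<longrightarrow> D s lam = g (1 / lam))) \<and>
        (\<forall>lam. lam \<noteq> 0 \<longrightarrow> Delta T p s lam = D s lam * Delta_flat J E lam))"

definition Pfun :: "real \<Rightarrow> complex \<Rightarrow> complex" where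
  "Pfun T s = (\<Sum>\<^sub>\<infinity> n::int. complex_of_real pi / cosh (pi * (complex_of_real (of_int n * omega T) + s)))"

definition alpha :: "(complex \<Rightarrow> complex \<Rightarrow> complex) \<Rightarrow> complex \<Rightarrow> complex" where
  "alpha D lam = - \<i> * residue (\<lambda>s. D s lam) (\<i> / 2)"

definition beta :: "real \<Rightarrow> (complex \<Rightarrow> complex \<Rightarrow> complex) \<Rightarrow> complex \<Rightarrow> complex" where
  "beta T D lam = D ((complex_of_real (omega T) + \<i>) / 2) lam"

definition entire_in_inverse :: "(complex \<Rightarrow> complex) \<Rightarrow> bool" where
  "entire_in_inverse f \<longleftrightarrow> (\<exists>g. g holomorphic_on UNIV \<and> (\<forall>lam. lam \<noteq> 0 \<longrightarrow> f lam = g (1 / lam)))"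

end

theory Submission
  imports Defs
begin

text \<open>
  Conjugation by Gamma factors turns the principal minors of \<open>H\<^bsup>(N)\<^esup>(s)\<close> into minors of a banded
  Toeplitz matrix times \<open>\<Prod>\<pi>/cosh \<pi>(n\<omega> + s)\<close>. The truncated determinant is therefore invariant under
  \<open>s \<mapsto> s + \<omega>\<close> and \<open>s \<mapsto> - s\<close>, while \<open>s \<mapsto> s + \<i>\<close> amounts to \<open>\<lambda> \<mapsto> - \<lambda>\<close>, and its singularities are simple
  poles on \<open>\<Lambda>\<close>. Subtracting a multiple of \<open>\<P>\<close> leaves an entire doubly periodic function, so by
  Liouville it equals \<open>- A\<^sub>N \<P>(s) + B\<^sub>N\<close> with \<open>A\<^sub>N\<close> odd and \<open>B\<^sub>N\<close> even in \<open>z = 1/\<lambda>\<close>.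

  For real \<open>k\<close> the hypothesis on the Fourier coefficients makes \<open>H(k)\<close> a hermitian matrix with absolutely
  summable entries. Hence the truncated determinants converge at real points, which forces \<open>A\<^sub>N\<close> and
  \<open>B\<^sub>N\<close> to converge and settles all other \<open>s\<close>, and the spectral theorem gives
  \<open>det (I - z H(k)) = \<Prod>(1 - z E\<^sub>j(k))\<close>.

  Splitting off the product \<open>\<phi>(z)\<close> over the flat bands leaves \<open>- a(z) \<P>(k) + b(z) = \<Prod>(1 - z E\<^sub>j(k))\<close> over the
  non-flat bands. A non-flat band takes a given value only countably often, so \<open>a\<close> and \<open>b\<close> have no
  common zero; this is (iv), and since \<open>\<phi> a\<close> is odd and \<open>\<phi> b\<close> is even it also shows that \<open>\<phi>\<close> is even.
\<close>

section \<open>Products over finite subsets\<close>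

text \<open>Three obstacles shape the proof. The quotient by Gamma in \<open>symb\<close> may grow
  exponentially, so the minors of the full Toeplitz matrix have no evident geometric bound. All work
  at complex \<open>s\<close> is therefore done on truncated matrices, and the limit is first taken
  at real points only. A cell with periods \<open>omega T\<close> and 2\<i> contains two poles,
  represented by \<i>/2 and 3\<i>/2, but only one multiple of \<open>Pfun\<close> can be subtracted.
  Evenness settles this: modulo 2\<i> the second pole is -\<i>/2, so its residue is the negative of
  the first one, as it is for \<open>Pfun\<close>. The determinant is defined by principal minors,
  which do not show eigenvalues. Summing minors of size \<open>k\<close> over functions from
  \<open>{..<k}\<close> instead of over sets makes each permutation term a sum of products; there
  the matrix can be exchanged for the diagonal matrix of its eigenvalues. Finally, \<open>a\<close>
  and \<open>b\<close> are read off at two real points from the product over the non-flat bands, so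
  they are entire without any division by \<phi>.\<close>

lemma infsum_dominated_convergence:
  fixes f :: "nat \<Rightarrow> 'a \<Rightarrow> 'b::{banach,second_countable_topology}"
  assumes lim: "\<And>x. x \<in> X \<Longrightarrow> (\<lambda>n. f n x) \<longlonglongrightarrow> g x"
    and bound: "\<And>n x. x \<in> X \<Longrightarrow> norm (f n x) \<le> M x"
    and M: "M summable_on X"
  shows "(\<lambda>n. infsum (f n) X) \<longlonglongrightarrow> infsum g X"
proof -
  have bg: "norm (g x) \<le> M x" if "x \<in> X" for x
    by (rule LIMSEQ_le_const2[OF tendsto_norm[OF lim[OF that]]]) (use bound that in auto)
  have "(\<lambda>x. norm (M x)) summable_on X"
    using summable_on_iff_abs_summable_on_real[THEN iffD1, OF M] .
  hence iM: "integrable (count_space X) M"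
    using abs_summable_equivalent[of M X] by (simp only: Infinite_Set_Sum.abs_summable_on_def)
  have lim': "(\<lambda>n. infsetsum (f n) X) \<longlonglongrightarrow> infsetsum g X"
    unfolding infsetsum_def
    by (rule integral_dominated_convergence[where w = M])
       (use lim bound iM in \<open>auto simp: AE_count_space\<close>)
  have "infsetsum (f n) X = infsum (f n) X" for n
    by (intro infsetsum_infsum abs_summable_equivalent[THEN iffD1]
          Infinite_Sum.abs_summable_on_comparison_test'[OF M bound])
  moreover have "infsetsum g X = infsum g X"
    by (intro infsetsum_infsum abs_summable_equivalent[THEN iffD1]
          Infinite_Sum.abs_summable_on_comparison_test'[OF M bg])
  ultimately show ?thesis using lim' by simp
qed

lemma sum_Fpow_finite:
  fixes a :: "'a \<Rightarrow> 'b::comm_semiring_1"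
  assumes "finite X"
  shows "(\<Sum>S\<in>Fpow X. \<Prod>j\<in>S. a j) = (\<Prod>j\<in>X. 1 + a j)"
proof -
  have "Fpow X = Pow X" using assms by (auto simp: Fpow_def intro: finite_subset)
  thus ?thesis using prod_add[OF assms, of a "\<lambda>_. 1"] by (simp add: add.commute)
qed

text \<open>A finite family of finite sets lies in the power set of its union \<open>U\<close>. Its
  sum is thus at most the product of the factors \<open>1 + a j\<close> over \<open>U\<close>, hence
  at most the exponential of the total sum of \<open>a\<close>.\<close>

lemma summable_prod_Fpow:
  fixes a :: "'a \<Rightarrow> real"
  assumes nn: "\<And>j. j \<in> X \<Longrightarrow> a j \<ge> 0" and a: "a summable_on X"
  shows "(\<lambda>S. \<Prod>j\<in>S. a j) summable_on Fpow X"
proof (rule nonneg_bdd_above_summable_on)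
  show "bdd_above (sum (\<lambda>S. \<Prod>j\<in>S. a j) ` {F. F \<subseteq> Fpow X \<and> finite F})"
  proof (rule bdd_aboveI2)
    fix F assume "F \<in> {F. F \<subseteq> Fpow X \<and> finite F}"
    hence F: "F \<subseteq> Fpow X" "finite F" by auto
    define U where "U = \<Union>F"
    have U: "finite U" "U \<subseteq> X" using F by (auto simp: U_def Fpow_def)
    have FU: "F \<subseteq> Fpow U" using F by (auto simp: U_def Fpow_def)
    have fin: "finite (Fpow U)" using U(1) by (auto simp: Fpow_def)
    have "(\<Sum>S\<in>F. \<Prod>j\<in>S. a j) \<le> (\<Sum>S\<in>Fpow U. \<Prod>j\<in>S. a j)"
      by (rule sum_mono2[OF fin FU]) (use nn U in \<open>auto simp: Fpow_def intro!: prod_nonneg\<close>)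
    also have "\<dots> = (\<Prod>j\<in>U. 1 + a j)" by (rule sum_Fpow_finite[OF U(1)])
    also have "\<dots> \<le> (\<Prod>j\<in>U. exp (a j))"
      by (rule prod_mono) (use nn U in \<open>auto intro!: exp_ge_add_one_self add_nonneg_nonneg\<close>)
    also have "\<dots> = exp (\<Sum>j\<in>U. a j)" using U by (simp add: exp_sum)
    also have "\<dots> \<le> exp (infsum a X)"
      using finite_sum_le_infsum[OF a U] nn by auto
    finally show "(\<Sum>S\<in>F. \<Prod>j\<in>S. a j) \<le> exp (infsum a X)" .
  qed
qed (use nn in \<open>auto simp: Fpow_def intro!: prod_nonneg\<close>)

text \<open>This is the infinite product of the factors \<open>1 + a j\<close> over
  \<open>X\<close>, multiplied out. The expanded form needs no enumeration of \<open>X\<close> and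
  has the shape of Fredholm's series, so the two can be compared directly.\<close>

definition fpow_prod :: "('a \<Rightarrow> complex) \<Rightarrow> 'a set \<Rightarrow> complex" where
  "fpow_prod a X = (\<Sum>\<^sub>\<infinity>S\<in>Fpow X. \<Prod>j\<in>S. a j)"

lemma abs_summable_prod_Fpow:
  fixes a :: "'a \<Rightarrow> complex"
  assumes "(\<lambda>j. norm (a j)) summable_on X"
  shows "(\<lambda>S. norm (\<Prod>j\<in>S. a j)) summable_on Fpow X"
  using summable_prod_Fpow[OF _ assms] by (simp add: prod_norm)

lemma summable_prod_Fpow_complex:
  fixes a :: "'a \<Rightarrow> complex"
  assumes "(\<lambda>j. norm (a j)) summable_on X"
  shows "(\<lambda>S. \<Prod>j\<in>S. a j) summable_on Fpow X"
  using abs_summable_summable[OF abs_summable_prod_Fpow[OF assms]] .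

lemma fpow_prod_Un:
  assumes a: "(\<lambda>j. norm (a j)) summable_on A \<union> B" and disj: "A \<inter> B = {}"
  shows "fpow_prod a (A \<union> B) = fpow_prod a A * fpow_prod a B"
proof -
  have bij: "bij_betw (\<lambda>(S,R). S \<union> R) (Fpow A \<times> Fpow B) (Fpow (A \<union> B))"
    by (rule bij_betw_byWitness[where f' = "\<lambda>U. (U \<inter> A, U \<inter> B)"])
       (use disj in \<open>auto simp: Fpow_def\<close>)
  have eq: "(\<Prod>j\<in>S \<union> R. a j) = (\<Prod>j\<in>S. a j) * (\<Prod>j\<in>R. a j)"
    if "S \<in> Fpow A" "R \<in> Fpow B" for S R
    using that disj by (intro prod.union_disjoint) (auto simp: Fpow_def)
  have "(\<lambda>U. \<Prod>j\<in>U. a j) summable_on Fpow (A \<union> B)"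
    by (rule summable_prod_Fpow_complex[OF a])
  hence "(\<lambda>(S,R). (\<Prod>j\<in>S \<union> R. a j)) summable_on (Fpow A \<times> Fpow B)"
    using summable_on_reindex_bij_betw[OF bij, of "\<lambda>U. \<Prod>j\<in>U. a j"] by (simp add: case_prod_unfold)
  hence sm: "(\<lambda>(S,R). (\<Prod>j\<in>S. a j) * (\<Prod>j\<in>R. a j)) summable_on (Fpow A \<times> Fpow B)"
    by (rule summable_on_cong[THEN iffD1, rotated]) (auto simp: eq)
  have "fpow_prod a (A \<union> B) = (\<Sum>\<^sub>\<infinity>(S,R)\<in>Fpow A \<times> Fpow B. (\<Prod>j\<in>S \<union> R. a j))"
    unfolding fpow_prod_def
    using infsum_reindex_bij_betw[OF bij, of "\<lambda>U. \<Prod>j\<in>U. a j"] by (simp add: case_prod_unfold)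
  also have "\<dots> = (\<Sum>\<^sub>\<infinity>(S,R)\<in>Fpow A \<times> Fpow B. (\<Prod>j\<in>S. a j) * (\<Prod>j\<in>R. a j))"
    by (rule infsum_cong) (auto simp: eq)
  also have "\<dots> = (\<Sum>\<^sub>\<infinity>S\<in>Fpow A. \<Sum>\<^sub>\<infinity>R\<in>Fpow B. (\<Prod>j\<in>S. a j) * (\<Prod>j\<in>R. a j))"
    by (rule infsum_Sigma'_banach[OF sm, symmetric])
  also have "\<dots> = fpow_prod a A * fpow_prod a B"
    by (simp add: infsum_cmult_right' infsum_cmult_left' fpow_prod_def)
  finally show ?thesis .
qed

lemma fpow_prod_finite: "finite X \<Longrightarrow> fpow_prod a X = (\<Prod>j\<in>X. 1 + a j)"
  unfolding fpow_prod_def using sum_Fpow_finite[of X a] by (subst infsum_finite) (auto simp: Fpow_def)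

lemma fpow_prod_cong: "(\<And>j. j \<in> X \<Longrightarrow> a j = b j) \<Longrightarrow> fpow_prod a X = fpow_prod b X"
  unfolding fpow_prod_def by (intro infsum_cong prod.cong) (auto simp: Fpow_def)

lemma fpow_prod_bij:
  assumes "bij_betw h X Y"
  shows "fpow_prod (\<lambda>x. a (h x)) X = fpow_prod a Y"
proof -
  have inj: "inj_on h X" and Y: "Y = h ` X" using assms by (auto simp: bij_betw_def)
  have bij: "bij_betw (image h) (Fpow X) (Fpow Y)"
    unfolding bij_betw_def
  proof
    show "image h ` Fpow X = Fpow Y"
    proof (intro equalityI subsetI)
      fix S assume "S \<in> Fpow Y"
      then obtain C where "C \<subseteq> X" "finite C" "S = h ` C"
        using Y finite_subset_image[of S h X] by (auto simp: Fpow_def)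
      thus "S \<in> image h ` Fpow X" by (auto simp: Fpow_def)
    qed (use Y in \<open>auto simp: Fpow_def\<close>)
  qed (rule inj_on_image_Fpow[OF inj])
  have "fpow_prod a Y = (\<Sum>\<^sub>\<infinity>S\<in>Fpow X. \<Prod>j\<in>h ` S. a j)"
    unfolding fpow_prod_def by (rule infsum_reindex_bij_betw[OF bij, symmetric])
  also have "\<dots> = fpow_prod (\<lambda>x. a (h x)) X"
    unfolding fpow_prod_def
    by (rule infsum_cong) (subst prod.reindex, auto simp: Fpow_def intro: inj_on_subset[OF inj])
  finally show ?thesis by simp
qed

text \<open>The partial product up to \<open>n\<close> is the same series with only the sets inside
  \<open>{..n}\<close> kept, so dominated convergence identifies the limits. An absolutely
  convergent product vanishes only if one of its factors does; this locates the zeros.\<close>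

lemma fpow_prod_eq_prodinf:
  fixes a :: "nat \<Rightarrow> complex"
  assumes a: "(\<lambda>j. norm (a j)) summable_on X"
  shows "fpow_prod a X = (\<Prod>j. if j \<in> X then 1 + a j else 1)"
    and "\<And>j. j \<in> X \<Longrightarrow> a j = -1 \<Longrightarrow> fpow_prod a X = 0"
    and "(\<And>j. j \<in> X \<Longrightarrow> a j \<noteq> -1) \<Longrightarrow> fpow_prod a X \<noteq> 0"
proof -
  define b where "b = (\<lambda>j. if j \<in> X then a j else 0)"
  have "(\<lambda>j. norm (b j)) summable_on UNIV"
    using a unfolding b_def
    by (rule summable_on_cong_neutral[THEN iffD1, rotated -1]) auto
  hence "summable (\<lambda>j. norm (b j))" by (rule summable_on_imp_summable)
  hence conv: "convergent_prod (\<lambda>j. 1 + b j)"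
    using summable_imp_abs_convergent_prod[of "\<lambda>j. 1 + b j"]
    by (intro abs_convergent_prod_imp_convergent_prod) auto
  have lim1: "(\<lambda>n. \<Prod>j\<le>n. 1 + b j) \<longlonglongrightarrow> (\<Prod>j. 1 + b j)"
    by (rule convergent_prod_LIMSEQ[OF conv])
  have part: "(\<Prod>j\<le>n. 1 + b j) = (\<Sum>\<^sub>\<infinity>S\<in>Fpow X. if S \<subseteq> {..n} then \<Prod>j\<in>S. a j else 0)" for n
  proof -
    have "(\<Prod>j\<le>n. 1 + b j) = (\<Prod>j\<in>{..n} \<inter> X. 1 + a j)"
      by (rule prod.mono_neutral_cong_right) (auto simp: b_def)
    also have "\<dots> = fpow_prod a ({..n} \<inter> X)" by (simp add: fpow_prod_finite)
    also have "\<dots> = (\<Sum>\<^sub>\<infinity>S\<in>Fpow X. if S \<subseteq> {..n} then \<Prod>j\<in>S. a j else 0)"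
      unfolding fpow_prod_def by (rule infsum_cong_neutral) (auto simp: Fpow_def)
    finally show ?thesis .
  qed
  have "(\<lambda>n. \<Sum>\<^sub>\<infinity>S\<in>Fpow X. if S \<subseteq> {..n} then \<Prod>j\<in>S. a j else 0) \<longlonglongrightarrow> fpow_prod a X"
    unfolding fpow_prod_def
  proof (rule infsum_dominated_convergence[where M = "\<lambda>S. norm (\<Prod>j\<in>S. a j)"])
    fix S assume S: "S \<in> Fpow X"
    show "(\<lambda>n. if S \<subseteq> {..n} then \<Prod>j\<in>S. a j else 0) \<longlonglongrightarrow> (\<Prod>j\<in>S. a j)"
    proof (rule tendsto_eventually, rule eventually_sequentiallyI)
      fix n assume "n \<ge> Max (insert 0 S)"
      thus "(if S \<subseteq> {..n} then \<Prod>j\<in>S. a j else 0) = (\<Prod>j\<in>S. a j)"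
        using S by (auto simp: Fpow_def)
    qed
  qed (use abs_summable_prod_Fpow[OF a] in auto)
  with lim1 part have eq: "fpow_prod a X = (\<Prod>j. 1 + b j)"
    using LIMSEQ_unique by simp
  also have "(\<lambda>j. 1 + b j) = (\<lambda>j. if j \<in> X then 1 + a j else 1)" by (auto simp: b_def)
  finally show "fpow_prod a X = (\<Prod>j. if j \<in> X then 1 + a j else 1)" .
  show "fpow_prod a X \<noteq> 0" if "\<And>j. j \<in> X \<Longrightarrow> a j \<noteq> -1"
    unfolding eq using that
    by (intro prodinf_nonzero conv) (auto simp: b_def add_eq_0_iff)
  show "fpow_prod a X = 0" if "j \<in> X" "a j = -1" for j
  proof -
    have "fpow_prod a ({j} \<union> (X - {j})) = fpow_prod a {j} * fpow_prod a (X - {j})"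
      using a that by (intro fpow_prod_Un) (auto simp: insert_absorb)
    thus ?thesis using that by (simp add: fpow_prod_finite insert_absorb)
  qed
qed

text \<open>The majorant \<open>M\<close> may change with the disc, since holomorphy is local. For
  the series of hyperbolic secants the majorant depends on the distance to the poles.\<close>

lemma holomorphic_on_infsum:
  fixes f :: "'a \<Rightarrow> complex \<Rightarrow> complex"
  assumes U: "open U" and hol: "\<And>x. x \<in> X \<Longrightarrow> f x holomorphic_on U"
    and bd: "\<And>s. s \<in> U \<Longrightarrow> \<exists>r>0. \<exists>M. cball s r \<subseteq> U \<and> M summable_on X \<and>
               (\<forall>x\<in>X. \<forall>y\<in>cball s r. norm (f x y) \<le> M x)"
  shows "(\<lambda>s. \<Sum>\<^sub>\<infinity>x\<in>X. f x s) holomorphic_on U"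
proof -
  have "(\<lambda>s. \<Sum>\<^sub>\<infinity>x\<in>X. f x s) field_differentiable at s" if s: "s \<in> U" for s
  proof -
    obtain r M where r: "r > 0" "cball s r \<subseteq> U" "M summable_on X"
        "\<And>x y. x \<in> X \<Longrightarrow> y \<in> cball s r \<Longrightarrow> norm (f x y) \<le> M x"
      using bd[OF s] by metis
    have ul: "uniform_limit (cball s r) (\<lambda>F y. \<Sum>x\<in>F. f x y) (\<lambda>y. \<Sum>\<^sub>\<infinity>x\<in>X. f x y) (finite_subsets_at_top X)"
      using r(4,3) by (rule Weierstrass_m_test_general)
    have "(\<lambda>y. \<Sum>\<^sub>\<infinity>x\<in>X. f x y) holomorphic_on ball s r"
    proof (rule holomorphic_uniform_limit[OF _ ul])
      show "\<forall>\<^sub>F F in finite_subsets_at_top X. continuous_on (cball s r) (\<lambda>y. \<Sum>x\<in>F. f x y) \<and>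
              (\<lambda>y. \<Sum>x\<in>F. f x y) holomorphic_on ball s r"
      proof (rule eventually_finite_subsets_at_top_weakI)
        fix F assume "finite F" "F \<subseteq> X"
        hence h: "(\<lambda>y. \<Sum>x\<in>F. f x y) holomorphic_on U" by (intro holomorphic_on_sum hol) auto
        have h': "(\<lambda>y. \<Sum>x\<in>F. f x y) holomorphic_on cball s r"
          by (rule holomorphic_on_subset[OF h r(2)])
        show "continuous_on (cball s r) (\<lambda>y. \<Sum>x\<in>F. f x y) \<and> (\<lambda>y. \<Sum>x\<in>F. f x y) holomorphic_on ball s r"
          using holomorphic_on_subset[OF h' ball_subset_cball] holomorphic_on_imp_continuous_on[OF h'] by blast
      qed
    qed auto
    thus ?thesis using r(1) by (intro holomorphic_on_imp_differentiable_at[of _ "ball s r"]) auto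
  qed
  thus ?thesis by (simp add: holomorphic_on_def field_differentiable_at_within)
qed

lemma holomorphic_fpow_prod:
  fixes e :: "'a \<Rightarrow> complex"
  assumes e: "(\<lambda>j. norm (e j)) summable_on X"
  shows "(\<lambda>z. fpow_prod (\<lambda>j. - (z * e j)) X) holomorphic_on UNIV"
  unfolding fpow_prod_def
proof (rule holomorphic_on_infsum)
  fix s :: complex
  define R where "R = norm s + 1"
  have "(\<lambda>j. R * norm (e j)) summable_on X" by (intro summable_on_cmult_right e)
  hence "(\<lambda>S. \<Prod>j\<in>S. R * norm (e j)) summable_on Fpow X"
    by (intro summable_prod_Fpow) (auto simp: R_def)
  moreover have "norm (\<Prod>j\<in>S. - (y * e j)) \<le> (\<Prod>j\<in>S. R * norm (e j))" if "y \<in> cball s 1" for S y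
  proof -
    have "norm y \<le> R" using that norm_triangle_ineq2[of y s] by (auto simp: R_def dist_norm norm_minus_commute)
    thus ?thesis unfolding prod_norm[symmetric] by (intro prod_mono) (auto simp: norm_mult intro!: mult_right_mono)
  qed
  ultimately show "\<exists>r>0. \<exists>M. cball s r \<subseteq> UNIV \<and> M summable_on Fpow X \<and>
               (\<forall>S\<in>Fpow X. \<forall>y\<in>cball s r. norm (\<Prod>j\<in>S. - (y * e j)) \<le> M S)"
    by (intro exI[of _ 1] exI[of _ "\<lambda>S. \<Prod>j\<in>S. R * norm (e j)"]) auto
next
  show "(\<lambda>z. \<Prod>j\<in>S. - (z * e j)) holomorphic_on UNIV" for S
    by (intro holomorphic_on_prod holomorphic_on_minus holomorphic_on_mult holomorphic_on_ident holomorphic_on_const)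
qed auto

section \<open>Determinants indexed by finite sets\<close>

text \<open>The formula of \<open>subdet\<close> for an arbitrary index type: minors indexed by
  positions \<open>{..<k}\<close> and by band labels are needed besides those indexed by
  integers.\<close>

definition pdet :: "('a \<Rightarrow> 'a \<Rightarrow> complex) \<Rightarrow> 'a set \<Rightarrow> complex" where
  "pdet A I = (\<Sum>\<pi> \<in> {\<pi>. \<pi> permutes I}. of_int (sign \<pi>) * (\<Prod>i\<in>I. A i (\<pi> i)))"

lemma subdet_eq_pdet: "subdet = pdet"
  by (simp add: subdet_def pdet_def fun_eq_iff)

lemma pdet_cong:
  "(\<And>i j. i \<in> I \<Longrightarrow> j \<in> I \<Longrightarrow> A i j = B i j) \<Longrightarrow> pdet A I = pdet B I"
  unfolding pdet_def by (intro sum.cong prod.cong arg_cong2[of _ _ _ _ "(*)"]) (auto simp: permutes_in_image)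

lemma pdet_reindex:
  assumes "finite I" "inj_on h I"
  shows "pdet A (h ` I) = pdet (\<lambda>a b. A (h a) (h b)) I"
proof -
  have bij: "bij_betw (map_permutation I h) {\<pi>. \<pi> permutes I} {\<pi>. \<pi> permutes h ` I}"
  proof (rule bij_betw_byWitness[where f' = "map_permutation (h ` I) (inv_into I h)"])
    show "\<forall>a\<in>{\<pi>. \<pi> permutes I}. map_permutation (h ` I) (inv_into I h) (map_permutation I h a) = a"
      using assms by (auto intro!: map_permutation_compose_inv inj_on_imp_bij_betw)
    show "\<forall>a\<in>{\<pi>. \<pi> permutes h ` I}. map_permutation I h (map_permutation (h ` I) (inv_into I h) a) = a"
      using assms by (auto intro!: map_permutation_compose_inv[of _ "h ` I" I] bij_betw_inv_into inj_on_imp_bij_betw simp: f_inv_into_f)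
    show "map_permutation I h ` {\<pi>. \<pi> permutes I} \<subseteq> {\<pi>. \<pi> permutes h ` I}"
      using assms by (auto intro!: map_permutation_permutes inj_on_imp_bij_betw)
    show "map_permutation (h ` I) (inv_into I h) ` {\<pi>. \<pi> permutes h ` I} \<subseteq> {\<pi>. \<pi> permutes I}"
      using assms by (auto intro!: map_permutation_permutes bij_betw_inv_into inj_on_imp_bij_betw)
  qed
  have "pdet A (h ` I) = (\<Sum>\<pi> | \<pi> permutes I. of_int (sign (map_permutation I h \<pi>)) *
          (\<Prod>i\<in>h ` I. A i (map_permutation I h \<pi> i)))"
    unfolding pdet_def by (rule sum.reindex_bij_betw[OF bij, symmetric])
  also have "\<dots> = pdet (\<lambda>a b. A (h a) (h b)) I"
    unfolding pdet_def using assms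
    by (intro sum.cong refl) (auto simp: sign_map_permutation prod.reindex map_permutation_apply)
  finally show ?thesis .
qed

lemma pdet_transpose: "pdet (\<lambda>i j. A j i) I = pdet A I" if "finite I"
proof -
  have "pdet (\<lambda>i j. A j i) I = (\<Sum>\<pi> | \<pi> permutes I. of_int (sign (inv \<pi>)) * (\<Prod>i\<in>I. A (inv \<pi> i) i))"
    unfolding pdet_def by (rule sum_permutations_inverse)
  also have "\<dots> = pdet A I"
    unfolding pdet_def
  proof (intro sum.cong refl arg_cong2[of _ _ _ _ "(*)"])
    fix \<pi> assume "\<pi> \<in> {\<pi>. \<pi> permutes I}"
    hence p: "\<pi> permutes I" by simp
    show "of_int (sign (inv \<pi>)) = (of_int (sign \<pi>) :: complex)"
      using p that by (simp add: sign_inverse permutation_permutes exI[of _ I] )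
    have "(\<Prod>i\<in>I. A (inv \<pi> i) i) = (\<Prod>i\<in>I. A (inv \<pi> (\<pi> i)) (\<pi> i))"
      by (rule prod.reindex_bij_betw[OF permutes_imp_bij[OF p], symmetric])
    thus "(\<Prod>i\<in>I. A (inv \<pi> i) i) = (\<Prod>i\<in>I. A i (\<pi> i))"
      using p by (simp add: permutes_inverses)
  qed
  finally show ?thesis .
qed

text \<open>Every permutation term uses each column once, so the column factors can be collected
  along the rows. In this way the Gamma factors leave the principal minors of
  \<open>Hmat\<close>.\<close>

lemma pdet_gauge: "pdet (\<lambda>i j. x i * y j * A i j) I = (\<Prod>i\<in>I. x i * y i) * pdet A I"
  unfolding pdet_def sum_distrib_left
proof (intro sum.cong refl)
  fix \<pi> assume "\<pi> \<in> {\<pi>. \<pi> permutes I}"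
  hence p: "\<pi> permutes I" by simp
  have "(\<Prod>i\<in>I. y (\<pi> i)) = (\<Prod>i\<in>I. y i)"
    by (rule prod.reindex_bij_betw[OF permutes_imp_bij[OF p]])
  thus "of_int (sign \<pi>) * (\<Prod>i\<in>I. x i * y (\<pi> i) * A i (\<pi> i)) =
        (\<Prod>i\<in>I. x i * y i) * (of_int (sign \<pi>) * (\<Prod>i\<in>I. A i (\<pi> i)))"
    by (simp add: prod.distrib)
qed

text \<open>Composing with the transposition of \<open>a\<close> and \<open>b\<close> flips every
  sign and changes no product. Because of this, sums over injective functions may be extended to all
  functions.\<close>

lemma pdet_eq_0_repeated:
  assumes fin: "finite I" and ab: "a \<in> I" "b \<in> I" "a \<noteq> b" "g a = g b"
  shows "pdet (\<lambda>i j. A i (g j)) I = 0"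
proof -
  let ?t = "Transposition.transpose a b"
  have t: "?t permutes I" using ab by (intro permutes_swap_id)
  have "pdet (\<lambda>i j. A i (g j)) I =
      (\<Sum>\<pi> | \<pi> permutes I. of_int (sign (?t \<circ> \<pi>)) * (\<Prod>i\<in>I. A i (g ((?t \<circ> \<pi>) i))))"
    unfolding pdet_def by (rule setum_permutations_compose_left[OF t])
  also have "\<dots> = (\<Sum>\<pi> | \<pi> permutes I. - (of_int (sign \<pi>) * (\<Prod>i\<in>I. A i (g (\<pi> i)))))"
  proof (intro sum.cong refl)
    fix \<pi> assume "\<pi> \<in> {\<pi>. \<pi> permutes I}"
    hence p: "\<pi> permutes I" by simp
    have "sign (?t \<circ> \<pi>) = - sign \<pi>"
      using p fin ab permutation_permutes by (subst sign_compose) (auto simp: sign_swap_id permutation_swap_id)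
    moreover have "g (?t x) = g x" for x
      using ab by (auto simp: Transposition.transpose_def)
    ultimately show "of_int (sign (?t \<circ> \<pi>)) * (\<Prod>i\<in>I. A i (g ((?t \<circ> \<pi>) i))) =
                     - (of_int (sign \<pi>) * (\<Prod>i\<in>I. A i (g (\<pi> i))))"
      by simp
  qed
  also have "\<dots> = - pdet (\<lambda>i j. A i (g j)) I"
    by (simp add: pdet_def sum_negf)
  finally show ?thesis by simp
qed

lemma pdet_diag: "finite I \<Longrightarrow> pdet (\<lambda>i j. if i = j then x i else 0) I = (\<Prod>i\<in>I. x i)"
proof -
  assume fin: "finite I"
  have z: "(\<Prod>i\<in>I. if i = \<pi> i then x i else 0) = 0" if p: "\<pi> permutes I" "\<pi> \<noteq> id" for \<pi>
  proof -
    obtain i where "\<pi> i \<noteq> i" using p by (auto simp: fun_eq_iff)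
    moreover have "i \<in> I" using p calculation by (metis permutes_not_in)
    ultimately show ?thesis using fin by (intro prod_zero bexI[of _ i]) auto
  qed
  have "pdet (\<lambda>i j. if i = j then x i else 0) I =
     (\<Sum>\<pi>\<in>{id}. of_int (sign \<pi>) * (\<Prod>i\<in>I. if i = \<pi> i then x i else 0))"
    unfolding pdet_def using z fin
    by (intro sum.mono_neutral_right) (auto simp: permutes_id finite_permutations)
  thus ?thesis by simp
qed

text \<open>Permutations of \<open>I\<close> are among all functions from \<open>I\<close> to
  \<open>I\<close>, and the sum over all functions factors into the product of the row sums. Unlike
  a bound with \<open>fact (card I)\<close>, this one is multiplicative over \<open>I\<close> and
  suits \<open>summable_prod_Fpow\<close>.\<close>

lemma norm_pdet_le:
  assumes fin: "finite I" and r: "\<And>i. i \<in> I \<Longrightarrow> (\<Sum>j\<in>I. norm (A i j)) \<le> r i"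
  shows "norm (pdet A I) \<le> (\<Prod>i\<in>I. r i)"
proof -
  have "norm (pdet A I) \<le> (\<Sum>\<pi> | \<pi> permutes I. norm (of_int (sign \<pi>) * (\<Prod>i\<in>I. A i (\<pi> i))))"
    unfolding pdet_def by (rule norm_sum)
  also have "\<dots> = (\<Sum>\<pi> | \<pi> permutes I. \<Prod>i\<in>I. norm (A i (\<pi> i)))"
    by (intro sum.cong refl) (simp add: norm_mult prod_norm sign_def)
  also have "\<dots> = (\<Sum>f\<in>(\<lambda>\<pi>. restrict \<pi> I) ` {\<pi>. \<pi> permutes I}. \<Prod>i\<in>I. norm (A i (f i)))"
  proof (subst sum.reindex)
    show "inj_on (\<lambda>\<pi>. restrict \<pi> I) {\<pi>. \<pi> permutes I}"
      by (rule inj_onI) (metis (no_types, lifting) ext mem_Collect_eq permutes_not_in restrict_apply')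
  qed auto
  also have "\<dots> \<le> (\<Sum>f\<in>PiE I (\<lambda>_. I). \<Prod>i\<in>I. norm (A i (f i)))"
    by (rule sum_mono2) (use fin in \<open>auto intro!: finite_PiE prod_nonneg simp: permutes_in_image\<close>)
  also have "\<dots> = (\<Prod>i\<in>I. \<Sum>j\<in>I. norm (A i j))"
    using fin by (subst prod_sum_PiE) auto
  also have "\<dots> \<le> (\<Prod>i\<in>I. r i)"
    using r by (intro prod_mono) (auto intro: sum_nonneg)
  finally show ?thesis .
qed

text \<open>Negating the indices of a Toeplitz matrix transposes it.\<close>

lemma pdet_uminus_image:
  fixes I :: "int set"
  assumes "finite I"
  shows "pdet (\<lambda>n m. q (n - m)) (uminus ` I) = pdet (\<lambda>n m. q (n - m)) I"
proof -
  have "pdet (\<lambda>n m. q (n - m)) (uminus ` I) = pdet (\<lambda>n m. q (m - n)) I"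
    by (subst pdet_reindex[OF assms]) (auto simp: algebra_simps)
  also have "\<dots> = pdet (\<lambda>n m. q (n - m)) I"
    by (rule pdet_transpose[OF assms])
  finally show ?thesis .
qed

lemma pdet_shift_image:
  fixes I :: "int set"
  assumes "finite I"
  shows "pdet (\<lambda>n m. q (n - m)) ((\<lambda>n. n + c) ` I) = pdet (\<lambda>n m. q (n - m)) I"
  by (subst pdet_reindex[OF assms]) auto

text \<open>Along a row the difference \<open>i - j\<close> takes each value at most once, so every
  row sum is bounded by the sum over the band, whatever \<open>I\<close> is.\<close>

lemma norm_pdet_band_toeplitz_le:
  fixes q :: "int \<Rightarrow> complex"
  assumes q: "\<And>l. l \<notin> L \<Longrightarrow> q l = 0" and L: "finite L" and "finite I"
  shows "norm (pdet (\<lambda>n m. q (n - m)) I) \<le> (\<Sum>l\<in>L. norm (q l)) ^ card I"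
proof -
  have "norm (pdet (\<lambda>n m. q (n - m)) I) \<le> (\<Prod>i\<in>I. \<Sum>l\<in>L. norm (q l))"
  proof (rule norm_pdet_le[OF assms(3)])
    fix i
    have "(\<Sum>j\<in>I. norm (q (i - j))) = (\<Sum>l\<in>(\<lambda>j. i - j) ` I. norm (q l))"
      by (subst sum.reindex) (auto simp: inj_on_def)
    also have "\<dots> = (\<Sum>l\<in>(\<lambda>j. i - j) ` I \<inter> L. norm (q l))"
      by (rule sum.mono_neutral_right) (use assms q in auto)
    also have "\<dots> \<le> (\<Sum>l\<in>L. norm (q l))"
      by (rule sum_mono2) (use L in auto)
    finally show "(\<Sum>j\<in>I. norm (q (i - j))) \<le> (\<Sum>l\<in>L. norm (q l))" .
  qed
  thus ?thesis by simp
qed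

section \<open>Series of products of hyperbolic secants\<close>

definition sech_term :: "real \<Rightarrow> complex \<Rightarrow> int \<Rightarrow> complex" where
  "sech_term w s n = complex_of_real pi / cosh (pi * (complex_of_real (of_int n * w) + s))"

text \<open>The term with index \<open>n\<close> has its poles on the line of real part
  \<open>- w * n\<close>, hence the test \<open>- n \<in> X\<close>. For \<open>X = UNIV\<close> and
  \<open>w = omega T\<close> the set is literally \<open>Lam T\<close>.\<close>

definition sech_poles :: "real \<Rightarrow> int set \<Rightarrow> complex set" where
  "sech_poles w X = {complex_of_real (w * of_int n) + \<i> * (of_int m + 1/2) | n m :: int. - n \<in> X}"

lemma cosh_pi_eq_0_iff: "cosh (complex_of_real pi * z) = 0 \<longleftrightarrow> (\<exists>m::int. z = \<i> * (of_int m + 1/2))"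
proof -
  have "cosh (complex_of_real pi * z) = 0 \<longleftrightarrow> (\<exists>n::int. \<i> * (pi * z) = complex_of_real (of_int n * pi) + of_real pi/2)"
    by (simp add: cosh_conv_cos cos_eq_0)
  also have "\<dots> \<longleftrightarrow> (\<exists>n::int. pi * (\<i> * z) = pi * (of_int n + 1/2))"
    by (simp add: algebra_simps)
  also have "\<dots> \<longleftrightarrow> (\<exists>n::int. \<i> * z = of_int n + 1/2)"
    by simp
  also have "\<dots> \<longleftrightarrow> (\<exists>m::int. z = \<i> * (of_int m + 1/2))"
  proof
    assume "\<exists>n::int. \<i> * z = of_int n + 1/2"
    then obtain n :: int where n: "\<i> * z = of_int n + 1/2" by blast
    have "z = - \<i> * (\<i> * z)" by simp
    also have "\<dots> = \<i> * (of_int (- n - 1) + 1/2)" unfolding n by (simp add: algebra_simps)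
    finally show "\<exists>m::int. z = \<i> * (of_int m + 1/2)" by blast
  next
    assume "\<exists>m::int. z = \<i> * (of_int m + 1/2)"
    then obtain m :: int where m: "z = \<i> * (of_int m + 1/2)" by blast
    have "\<i> * z = of_int (- m - 1) + 1/2" unfolding m by (simp add: algebra_simps)
    thus "\<exists>n::int. \<i> * z = of_int n + 1/2" by blast
  qed
  finally show ?thesis .
qed

lemma sech_poles_iff:
  "s \<in> sech_poles w X \<longleftrightarrow> (\<exists>n\<in>X. cosh (complex_of_real pi * (complex_of_real (of_int n * w) + s)) = 0)"
proof -
  have "s \<in> sech_poles w X \<longleftrightarrow> (\<exists>n\<in>X. \<exists>m::int. complex_of_real (of_int n * w) + s = \<i> * (of_int m + 1/2))"
  proof
    assume "s \<in> sech_poles w X"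
    then obtain n m :: int where "- n \<in> X" "s = complex_of_real (w * of_int n) + \<i> * (of_int m + 1/2)"
      unfolding sech_poles_def by blast
    thus "\<exists>n\<in>X. \<exists>m::int. complex_of_real (of_int n * w) + s = \<i> * (of_int m + 1/2)"
      by (intro bexI[of _ "- n"] exI[of _ m]) (auto simp: algebra_simps)
  next
    assume "\<exists>n\<in>X. \<exists>m::int. complex_of_real (of_int n * w) + s = \<i> * (of_int m + 1/2)"
    then obtain n m :: int where "n \<in> X" "complex_of_real (of_int n * w) + s = \<i> * (of_int m + 1/2)"
      by blast
    thus "s \<in> sech_poles w X" unfolding sech_poles_def
      by (intro CollectI exI[of _ "- n"] exI[of _ m]) (auto simp: algebra_simps eq_diff_eq)
  qed
  thus ?thesis by (simp only: cosh_pi_eq_0_iff)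
qed

lemma sech_poles_discrete:
  assumes w: "w > 0"
  shows "\<forall>x\<in>sech_poles w X. \<forall>y\<in>sech_poles w X. dist y x < min w 1 \<longrightarrow> y = x"
proof (intro ballI impI)
  fix x y assume "x \<in> sech_poles w X" "y \<in> sech_poles w X" and d: "dist y x < min w 1"
  then obtain n m n' m' :: int where
    x: "x = complex_of_real (w * of_int n) + \<i> * (of_int m + 1/2)" and
    y: "y = complex_of_real (w * of_int n') + \<i> * (of_int m' + 1/2)"
    unfolding sech_poles_def by blast
  have "\<bar>Re (y - x)\<bar> < w" "\<bar>Im (y - x)\<bar> < 1"
    using d abs_Re_le_cmod[of "y - x"] abs_Im_le_cmod[of "y - x"] by (auto simp: dist_norm)
  hence "\<bar>w * of_int (n' - n)\<bar> < w * 1" "\<bar>of_int (m' - m) :: real\<bar> < 1"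
    by (auto simp: x y algebra_simps)
  hence "\<bar>of_int (n' - n) :: real\<bar> < 1" "\<bar>of_int (m' - m) :: real\<bar> < 1"
    using w by (auto simp: abs_mult simp del: of_int_diff)
  hence "n' = n" "m' = m" by linarith+
  thus "y = x" by (simp add: x y)
qed

lemma closed_sech_poles:
  assumes w: "w > 0"
  shows "closed (sech_poles w X)"
  using w by (intro discrete_imp_closed[OF _ sech_poles_discrete[OF w]]) auto

lemma summable_exp_neg_abs_int:
  assumes "c > 0"
  shows "(\<lambda>n::int. exp (- c * \<bar>real_of_int n\<bar>)) summable_on UNIV"
proof -
  have "summable (\<lambda>n::nat. exp (- c) ^ n)" using assms by (intro summable_geometric) auto
  hence "summable (\<lambda>n::nat. exp (- c * real n))" by (simp add: exp_of_nat_mult[symmetric] mult.commute)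
  hence nat: "(\<lambda>n::nat. exp (- c * real n)) summable_on UNIV"
    by (intro summable_nonneg_imp_summable_on) auto
  have 1: "(\<lambda>n::int. exp (- c * \<bar>real_of_int n\<bar>)) summable_on (range int)"
    by (subst summable_on_reindex) (use nat in \<open>auto simp: o_def\<close>)
  have 2: "(\<lambda>n::int. exp (- c * \<bar>real_of_int n\<bar>)) summable_on (range (\<lambda>n. - int n))"
    by (subst summable_on_reindex) (use nat in \<open>auto simp: o_def inj_on_def\<close>)
  have "(UNIV :: int set) = range int \<union> range (\<lambda>n. - int n)"
  proof (intro equalityI subsetI)
    fix n :: int
    show "n \<in> range int \<union> range (\<lambda>n. - int n)"
      by (cases n rule: int_cases2) auto
  qed auto
  thus ?thesis using summable_on_union[OF 1 2] by simp
qed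

lemma norm_cosh_ge:
  assumes "\<bar>Re z\<bar> \<ge> 1"
  shows "norm (cosh z) \<ge> exp \<bar>Re z\<bar> / 4"
proof -
  define x where "x = \<bar>Re z\<bar>"
  have x: "x \<ge> 1" using assms by (simp add: x_def)
  have "exp x * exp x \<ge> 2"
    using x exp_ge_add_one_self[of "2 * x"] unfolding exp_add[symmetric] mult_2 by linarith
  hence e: "exp (- x) \<le> exp x / 2" by (simp add: exp_minus field_simps)
  have eq: "cosh z = (exp z + exp (- z)) / 2" by (simp add: cosh_def scaleR_conv_of_real)
  have "norm (exp z + exp (- z)) \<ge> exp x - exp (- x)"
  proof (cases "Re z \<ge> 0")
    case True
    thus ?thesis using norm_diff_ineq[of "exp z" "exp (- z)"] by (simp add: x_def)
  next
    case False
    thus ?thesis using norm_diff_ineq[of "exp (- z)" "exp z"] by (simp add: x_def add.commute)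
  qed
  hence "norm (cosh z) \<ge> (exp x - exp (- x)) / 2" by (simp add: eq norm_divide)
  thus ?thesis using e by (simp add: x_def)
qed

text \<open>Far out the terms decay like \<open>exp (- pi * w * \<bar>n\<bar>)\<close> uniformly on
  the disc; the finitely many remaining ones are bounded by compactness of the disc, which avoids
  their poles.\<close>

lemma sech_term_local_bound:
  assumes w: "w > 0" and s: "s \<notin> sech_poles w X"
  shows "\<exists>r>0. \<exists>M. cball s r \<subseteq> - sech_poles w X \<and> (\<forall>n. M n \<ge> 0) \<and> M summable_on X \<and>
           (\<forall>n\<in>X. \<forall>y\<in>cball s r. norm (sech_term w y n) \<le> M n)"
proof -
  have "open (- sech_poles w X)" using closed_sech_poles[OF w] by auto
  then obtain r0 where r0: "r0 > 0" "cball s r0 \<subseteq> - sech_poles w X"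
    using s open_contains_cball by (metis ComplI)
  define r where "r = min r0 1"
  have r: "r > 0" "r \<le> 1" "cball s r \<subseteq> - sech_poles w X"
    using r0 by (auto simp: r_def)
  define R where "R = \<bar>Re s\<bar> + 1"
  \<comment> \<open>Since \<open>\<bar>Re y\<bar> \<le> R\<close> on the disc, outside
    \<open>N\<close> the number \<open>of_int n * w + Re y\<close> has modulus at least 1, as
    \<open>norm_cosh_ge\<close> requires.\<close>
  define N where "N = {n::int. \<bar>of_int n\<bar> * w < R + 1}"
  have "finite N"
  proof (rule finite_subset)
    show "N \<subseteq> {- \<lceil>(R + 1) / w\<rceil> .. \<lceil>(R + 1) / w\<rceil>}"
    proof
      fix n assume "n \<in> N"
      hence "\<bar>real_of_int n\<bar> < (R + 1) / w" using w by (simp add: N_def field_simps)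
      hence "\<bar>n\<bar> \<le> \<lceil>(R + 1) / w\<rceil>" by linarith
      thus "n \<in> {- \<lceil>(R + 1) / w\<rceil> .. \<lceil>(R + 1) / w\<rceil>}" by auto
    qed
  qed auto
  have "\<exists>B. \<forall>y\<in>cball s r. norm (sech_term w y n) \<le> B" if "n \<in> X" for n
  proof -
    have "cosh (complex_of_real pi * (complex_of_real (of_int n * w) + y)) \<noteq> 0" if "y \<in> cball s r" for y
      using r(3) that \<open>n \<in> X\<close> sech_poles_iff[of y w X] by blast
    hence "continuous_on (cball s r) (\<lambda>y. sech_term w y n)"
      unfolding sech_term_def by (intro continuous_intros) auto
    hence "bounded ((\<lambda>y. sech_term w y n) ` cball s r)"
      by (intro compact_imp_bounded compact_continuous_image) auto
    thus ?thesis by (auto simp: bounded_iff)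
  qed
  then obtain B where B: "\<And>n y. n \<in> X \<Longrightarrow> y \<in> cball s r \<Longrightarrow> norm (sech_term w y n) \<le> B n" by metis
  define M where "M = (\<lambda>n. (if n \<in> N then \<bar>B n\<bar> else 0) + 4 * pi * exp (pi * R) * exp (- (pi * w) * \<bar>real_of_int n\<bar>))"
  have "(\<lambda>n. if n \<in> N then \<bar>B n\<bar> else 0) summable_on X"
    by (rule finite_nonzero_values_imp_summable_on) (rule finite_subset[OF _ \<open>finite N\<close>], auto)
  moreover have "(\<lambda>n. 4 * pi * exp (pi * R) * exp (- (pi * w) * \<bar>real_of_int n\<bar>)) summable_on X"
    using summable_exp_neg_abs_int[of "pi * w"] w
    by (intro summable_on_cmult_right) (auto intro: summable_on_subset)
  ultimately have MX: "M summable_on X" unfolding M_def by (rule summable_on_add)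
  have "norm (sech_term w y n) \<le> M n" if n: "n \<in> X" and y: "y \<in> cball s r" for n y
  proof (cases "n \<in> N")
    case True
    have "norm (sech_term w y n) \<le> \<bar>B n\<bar>" using B[OF n y] by linarith
    also have "\<dots> \<le> M n" using True by (simp add: M_def)
    finally show ?thesis .
  next
    case False
    hence nR: "\<bar>of_int n\<bar> * w \<ge> R + 1" by (simp add: N_def)
    define z where "z = complex_of_real pi * (complex_of_real (of_int n * w) + y)"
    have "\<bar>Re y - Re s\<bar> \<le> 1"
      using y r(2) abs_Re_le_cmod[of "y - s"] by (auto simp: dist_norm norm_minus_commute)
    hence "\<bar>Re y\<bar> \<le> R" by (auto simp: R_def)
    hence "\<bar>of_int n * w + Re y\<bar> \<ge> \<bar>of_int n\<bar> * w - R"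
      using w abs_triangle_ineq2[of "of_int n * w" "- Re y"] by (simp add: abs_mult)
    hence "\<bar>Re z\<bar> \<ge> pi * (\<bar>of_int n\<bar> * w - R)"
      by (simp add: z_def abs_mult)
    moreover have "pi * (\<bar>of_int n\<bar> * w - R) \<ge> 1"
      using nR pi_gt3 mult_mono[of 1 pi 1 "\<bar>of_int n\<bar> * w - R"] by auto
    ultimately have z: "\<bar>Re z\<bar> \<ge> 1" "exp \<bar>Re z\<bar> \<ge> exp (pi * (\<bar>of_int n\<bar> * w - R))" by auto
    have "norm (sech_term w y n) = pi / norm (cosh z)"
      by (simp add: sech_term_def z_def norm_divide)
    also have "\<dots> \<le> pi / (exp (pi * (\<bar>of_int n\<bar> * w - R)) / 4)"
    proof (rule divide_left_mono)
      show c: "exp (pi * (\<bar>of_int n\<bar> * w - R)) / 4 \<le> norm (cosh z)"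
        using norm_cosh_ge[OF z(1)] z(2) by linarith
      have "0 < exp (pi * (\<bar>of_int n\<bar> * w - R)) / 4" by simp
      thus "0 < norm (cosh z) * (exp (pi * (\<bar>of_int n\<bar> * w - R)) / 4)"
        using c by (intro mult_pos_pos) linarith+
    qed auto
    also have "\<dots> = 4 * pi * exp (pi * R) * exp (- (pi * w) * \<bar>real_of_int n\<bar>)"
      by (simp add: exp_diff exp_minus field_simps)
    finally show ?thesis using False by (simp add: M_def)
  qed
  moreover have "M n \<ge> 0" for n by (simp add: M_def)
  ultimately show ?thesis using r MX by blast
qed

text \<open>With \<open>X = UNIV\<close> and \<open>t I\<close> a Toeplitz minor times
  \<open>(- z) ^ card I\<close>, this is a truncated determinant (see
  \<open>fredholm_HmatN\<close>). Taking \<open>X = - {0}\<close> leaves out the term that is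
  singular on the imaginary axis.\<close>

definition sech_series :: "real \<Rightarrow> (int set \<Rightarrow> complex) \<Rightarrow> int set \<Rightarrow> complex \<Rightarrow> complex" where
  "sech_series w t X s = (\<Sum>\<^sub>\<infinity>I\<in>Fpow X. t I * (\<Prod>n\<in>I. sech_term w s n))"

text \<open>Under this growth the series is dominated by \<open>C\<close> times a product with
  factors \<open>1 + Q * M n\<close>, where \<open>M\<close> is summable; the size of
  \<open>Q\<close> does not matter for convergence.\<close>

definition geom_bounded :: "(int set \<Rightarrow> complex) \<Rightarrow> bool" where
  "geom_bounded t \<longleftrightarrow> (\<exists>C Q. C \<ge> 0 \<and> Q \<ge> 0 \<and> (\<forall>I. finite I \<longrightarrow> norm (t I) \<le> C * Q ^ card I))"

lemma sech_series_local_bound: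
  assumes w: "w > 0" and s: "s \<notin> sech_poles w X" and t: "geom_bounded t"
  shows "\<exists>r>0. \<exists>M. cball s r \<subseteq> - sech_poles w X \<and> M summable_on Fpow X \<and>
           (\<forall>I\<in>Fpow X. \<forall>y\<in>cball s r. norm (t I * (\<Prod>n\<in>I. sech_term w y n)) \<le> M I)"
proof -
  obtain r M where r: "r > 0" "cball s r \<subseteq> - sech_poles w X" "\<And>n. M n \<ge> 0" "M summable_on X"
      "\<And>n y. n \<in> X \<Longrightarrow> y \<in> cball s r \<Longrightarrow> norm (sech_term w y n) \<le> M n"
    using sech_term_local_bound[OF w s] by metis
  obtain C Q where CQ: "C \<ge> 0" "Q \<ge> 0" "\<And>I. finite I \<Longrightarrow> norm (t I) \<le> C * Q ^ card I"
    using t unfolding geom_bounded_def by blast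
  have "(\<lambda>I. C * (\<Prod>n\<in>I. Q * M n)) summable_on Fpow X"
    by (intro summable_on_cmult_right summable_prod_Fpow) (use r CQ in auto)
  moreover have "norm (t I * (\<Prod>n\<in>I. sech_term w y n)) \<le> C * (\<Prod>n\<in>I. Q * M n)"
    if I: "I \<in> Fpow X" and y: "y \<in> cball s r" for I y
  proof -
    have "norm (t I * (\<Prod>n\<in>I. sech_term w y n)) = norm (t I) * (\<Prod>n\<in>I. norm (sech_term w y n))"
      by (simp add: norm_mult prod_norm)
    also have "\<dots> \<le> (C * Q ^ card I) * (\<Prod>n\<in>I. M n)"
      using I CQ y by (intro mult_mono prod_mono prod_nonneg) (auto simp: Fpow_def intro!: r)
    also have "\<dots> = C * (\<Prod>n\<in>I. Q * M n)" by (simp add: prod.distrib)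
    finally show ?thesis .
  qed
  ultimately show ?thesis using r by blast
qed

lemma sech_series_summable:
  assumes "w > 0" "s \<notin> sech_poles w X" "geom_bounded t"
  shows "(\<lambda>I. t I * (\<Prod>n\<in>I. sech_term w s n)) summable_on Fpow X"
proof -
  obtain r M where r: "r > 0" "M summable_on Fpow X"
      "\<And>I y. I \<in> Fpow X \<Longrightarrow> y \<in> cball s r \<Longrightarrow> norm (t I * (\<Prod>n\<in>I. sech_term w y n)) \<le> M I"
    using sech_series_local_bound[OF assms] by metis
  have "(\<lambda>I. norm (t I * (\<Prod>n\<in>I. sech_term w s n))) summable_on Fpow X"
    using r by (intro Infinite_Sum.abs_summable_on_comparison_test'[OF r(2)]) auto
  thus ?thesis by (rule abs_summable_summable)
qed

lemma holomorphic_cosh: "f holomorphic_on S \<Longrightarrow> (\<lambda>z. cosh (f z)) holomorphic_on S"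
  unfolding cosh_conv_cos by (intro holomorphic_on_cos' holomorphic_on_mult holomorphic_on_const)

lemma holomorphic_sech_series:
  assumes "w > 0" "geom_bounded t"
  shows "sech_series w t X holomorphic_on (- sech_poles w X)"
  unfolding sech_series_def
proof (rule holomorphic_on_infsum)
  show "open (- sech_poles w X)" using closed_sech_poles[OF assms(1)] by auto
  show "(\<lambda>s. t I * (\<Prod>n\<in>I. sech_term w s n)) holomorphic_on - sech_poles w X" if "I \<in> Fpow X" for I
    unfolding sech_term_def using that
    by (intro holomorphic_on_mult holomorphic_on_prod holomorphic_on_divide holomorphic_on_const
          holomorphic_cosh holomorphic_on_add holomorphic_on_ident)
       (auto simp: sech_poles_iff Fpow_def)
qed (use sech_series_local_bound[OF assms(1) _ assms(2), of _ X] in auto)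

lemma sech_term_add_int: "sech_term w (s + \<i> * of_int k) n = (if even k then 1 else - 1) * sech_term w s n"
proof -
  define x where "x = complex_of_real pi * (complex_of_real (of_int n * w) + s)"
  have 1: "cosh (\<i> * (complex_of_real pi * of_int k)) = (if even k then 1 else - 1)"
  proof -
    have "cosh (\<i> * (complex_of_real pi * of_int k)) = cos (complex_of_real (pi * of_int k))"
      by (simp add: cosh_conv_cos mult.assoc[symmetric])
    also have "\<dots> = complex_of_real (cos (pi * of_int k))" by (simp only: cos_of_real)
    also have "\<dots> = (if even k then 1 else - 1)" by simp
    finally show ?thesis .
  qed
  have 2: "sinh (\<i> * (complex_of_real pi * of_int k)) = 0"
  proof -
    have "sinh (\<i> * (complex_of_real pi * of_int k)) = \<i> * sin (complex_of_real (pi * of_int k))"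
      by (simp add: sinh_conv_sin mult.assoc[symmetric])
    also have "\<dots> = \<i> * complex_of_real (sin (pi * of_int k))" by (simp only: sin_of_real)
    finally show ?thesis by simp
  qed
  have "complex_of_real pi * (complex_of_real (of_int n * w) + (s + \<i> * of_int k)) = x + \<i> * (complex_of_real pi * of_int k)"
    by (simp add: x_def algebra_simps)
  hence "cosh (complex_of_real pi * (complex_of_real (of_int n * w) + (s + \<i> * of_int k))) = (if even k then 1 else - 1) * cosh x"
    by (simp only: cosh_add 1 2) simp
  thus ?thesis by (auto simp: sech_term_def x_def)
qed

lemma sech_term_add_i: "sech_term w (s + \<i>) n = - sech_term w s n"
  using sech_term_add_int[of w s 1 n] by simp

lemma sech_term_minus: "sech_term w (- s) n = sech_term w s (- n)"
proof -
  have "complex_of_real pi * (complex_of_real (of_int n * w) + - s) = - (complex_of_real pi * (complex_of_real (of_int (- n) * w) + s))"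
    by (simp add: algebra_simps)
  thus ?thesis unfolding sech_term_def by (simp only: cosh_minus)
qed

lemma sech_term_shift: "sech_term w (s + of_real w) n = sech_term w s (n + 1)"
  by (simp add: sech_term_def algebra_simps)

lemma sech_series_add_i: "sech_series w t X (s + \<i>) = sech_series w (\<lambda>I. (-1) ^ card I * t I) X s"
  unfolding sech_series_def sech_term_add_i
  by (intro infsum_cong) (auto simp: prod_uminus)

lemma sech_series_shift:
  assumes "\<And>I. finite I \<Longrightarrow> t ((\<lambda>n. n + 1) ` I) = t I"
  shows "sech_series w t UNIV (s + of_real w) = sech_series w t UNIV s"
  unfolding sech_series_def sech_term_shift
proof (rule infsum_reindex_bij_witness[where i = "\<lambda>I. (\<lambda>n. n - 1) ` I" and j = "\<lambda>I. (\<lambda>n. n + 1) ` I"])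
  fix I :: "int set" assume I: "I \<in> Fpow UNIV"
  have "(\<Prod>n\<in>(\<lambda>n. n + 1) ` I. sech_term w s n) = (\<Prod>n\<in>I. sech_term w s (n + 1))"
    by (subst prod.reindex) auto
  thus "t ((\<lambda>n. n + 1) ` I) * (\<Prod>n\<in>(\<lambda>n. n + 1) ` I. sech_term w s n) = t I * (\<Prod>n\<in>I. sech_term w s (n + 1))"
    using I assms by (auto simp: Fpow_def)
qed (auto simp: Fpow_def image_image)

lemma sech_series_reflect:
  assumes "\<And>I. finite I \<Longrightarrow> t (uminus ` I) = t I" "uminus ` X = X"
  shows "sech_series w t X (- s) = sech_series w t X s"
  unfolding sech_series_def sech_term_minus
proof (rule infsum_reindex_bij_witness[where i = "image uminus" and j = "image uminus"])
  fix I :: "int set" assume I: "I \<in> Fpow X"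
  have "(\<Prod>n\<in>uminus ` I. sech_term w s n) = (\<Prod>n\<in>I. sech_term w s (- n))"
    by (subst prod.reindex) auto
  thus "t (uminus ` I) * (\<Prod>n\<in>uminus ` I. sech_term w s n) = t I * (\<Prod>n\<in>I. sech_term w s (- n))"
    using I assms by (auto simp: Fpow_def)
qed (use assms(2) in \<open>auto simp: Fpow_def image_image\<close>)

section \<open>Poles on the imaginary axis and series without poles\<close>

lemma geom_bounded_insert:
  assumes "geom_bounded t"
  shows "geom_bounded (\<lambda>I. t (insert a I))"
proof -
  obtain C Q where CQ: "C \<ge> 0" "Q \<ge> 0" "\<And>I. finite I \<Longrightarrow> norm (t I) \<le> C * Q ^ card I"
    using assms unfolding geom_bounded_def by blast
  \<comment> \<open>The base is raised to \<open>Q + 1\<close> because the exponent may grow by one,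
    and powers increase with the exponent only for a base of at least 1.\<close>
  have "norm (t (insert a I)) \<le> (C * (Q + 1)) * (Q + 1) ^ card I" if "finite I" for I
  proof -
    have "norm (t (insert a I)) \<le> C * Q ^ card (insert a I)" using CQ that by auto
    also have "\<dots> \<le> C * (Q + 1) ^ card (insert a I)" using CQ by (intro mult_left_mono power_mono) auto
    also have "\<dots> \<le> C * (Q + 1) ^ Suc (card I)"
      using CQ that by (intro mult_left_mono power_increasing) (auto simp: card_insert_if)
    finally show ?thesis by (simp add: mult_ac)
  qed
  thus ?thesis unfolding geom_bounded_def using CQ
    by (intro exI[of _ "C * (Q + 1)"] exI[of _ "Q + 1"]) auto
qed

text \<open>On the imaginary axis only the term of index 0 is singular, and it enters each product
  at most once. Hence the poles there are at most simple, and the second series carries the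
  residues.\<close>

lemma sech_series_split:
  assumes "w > 0" "s \<notin> sech_poles w UNIV" "geom_bounded t"
  shows "sech_series w t UNIV s = sech_series w t (- {0}) s
           + sech_term w s 0 * sech_series w (\<lambda>I. t (insert 0 I)) (- {0}) s"
proof -
  let ?f = "\<lambda>I. t I * (\<Prod>n\<in>I. sech_term w s n)"
  have U: "Fpow (UNIV::int set) = Fpow (- {0}) \<union> insert 0 ` Fpow (- {0})"
  proof (intro equalityI subsetI)
    fix I :: "int set" assume I: "I \<in> Fpow UNIV"
    show "I \<in> Fpow (- {0}) \<union> insert 0 ` Fpow (- {0})"
    proof (cases "0 \<in> I")
      case True
      hence "I = insert 0 (I - {0})" by auto
      moreover have "I - {0} \<in> Fpow (- {0})" using I by (auto simp: Fpow_def)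
      ultimately show ?thesis by blast
    qed (use I in \<open>auto simp: Fpow_def\<close>)
  qed (auto simp: Fpow_def)
  have disj: "Fpow (- {0}) \<inter> insert (0::int) ` Fpow (- {0}) = {}" by (auto simp: Fpow_def)
  have sm: "?f summable_on Fpow UNIV" by (rule sech_series_summable[OF assms])
  have inj: "inj_on (insert (0::int)) (Fpow (- {0}))"
    by (rule inj_onI) (simp add: Fpow_def insert_ident subset_iff, metis insert_ident)
  have "sech_series w t UNIV s = infsum ?f (Fpow (- {0})) + infsum ?f (insert 0 ` Fpow (- {0}))"
    unfolding sech_series_def U using sm
    by (intro infsum_Un_disjoint disj) (auto simp: U intro: summable_on_subset)
  also have "infsum ?f (insert 0 ` Fpow (- {0})) = infsum (?f \<circ> insert 0) (Fpow (- {0}))"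
    by (rule infsum_reindex[OF inj])
  also have "\<dots> = (\<Sum>\<^sub>\<infinity>I\<in>Fpow (- {0}). sech_term w s 0 * (t (insert 0 I) * (\<Prod>n\<in>I. sech_term w s n)))"
  proof (rule infsum_cong)
    fix I :: "int set" assume "I \<in> Fpow (- {0})"
    hence "finite I" "0 \<notin> I" by (auto simp: Fpow_def)
    thus "(?f \<circ> insert 0) I = sech_term w s 0 * (t (insert 0 I) * (\<Prod>n\<in>I. sech_term w s n))"
      by (simp add: mult_ac)
  qed
  also have "\<dots> = sech_term w s 0 * sech_series w (\<lambda>I. t (insert 0 I)) (- {0}) s"
    by (simp add: sech_series_def infsum_cmult_right')
  finally show ?thesis by (simp add: sech_series_def)
qed

lemma sech_poles_isolated:
  assumes w: "w > 0"
  shows "\<exists>e>0. \<forall>y. y \<noteq> p \<and> dist y p < e \<longrightarrow> y \<notin> sech_poles w UNIV"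
proof -
  have "closed (sech_poles w UNIV - {p})"
  proof (rule discrete_imp_closed[of "min w 1"])
    show "\<forall>x\<in>sech_poles w UNIV - {p}. \<forall>y\<in>sech_poles w UNIV - {p}. dist y x < min w 1 \<longrightarrow> y = x"
      using sech_poles_discrete[OF w] by blast
  qed (use w in auto)
  hence "open (- (sech_poles w UNIV - {p}))" by (rule open_Compl)
  then obtain r where "r > 0" "cball p r \<subseteq> - (sech_poles w UNIV - {p})"
    using open_contains_cball by (metis Compl_iff DiffE singletonI)
  thus ?thesis by (intro exI[of _ r]) (force simp: dist_commute)
qed

text \<open>The hypothesis \<open>no_pole\<close> concerns the single point \<i>/2. Reflection and
  the period 2\<i> of \<open>v\<close> carry it to all poles on the imaginary axis, and the shift by
  \<open>w\<close> to all other lines. What remains is a bounded entire function.\<close>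

lemma sech_series_const:
  assumes w: "w > 0" and t: "geom_bounded t"
    and shift: "\<And>I. finite I \<Longrightarrow> t ((\<lambda>n. n + 1) ` I) = t I"
    and reflect: "\<And>I. finite I \<Longrightarrow> t (uminus ` I) = t I"
    and no_pole: "sech_series w (\<lambda>I. t (insert 0 I)) (- {0}) (\<i> / 2) = 0"
  shows "\<exists>B. \<forall>s. s \<notin> sech_poles w UNIV \<longrightarrow> sech_series w t UNIV s = B"
proof -
  define G where "G = sech_series w t UNIV"
  define u where "u = sech_series w t (- {0})"
  define v where "v = sech_series w (\<lambda>I. t (insert 0 I)) (- {0})"
  have t0: "geom_bounded (\<lambda>I. t (insert 0 I))" by (rule geom_bounded_insert[OF t])
  have neg: "uminus ` (- {0::int}) = - {0}"
  proof (intro equalityI subsetI)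
    fix x :: int assume "x \<in> - {0}"
    thus "x \<in> uminus ` (- {0})" by (intro image_eqI[of _ _ "- x"]) auto
  qed auto
  have reflect0: "t (insert 0 (uminus ` I)) = t (insert 0 I)" if "finite I" for I
    using reflect[of "insert 0 I"] that by simp
  \<comment> \<open>For \<open>p = \<i>(m + 1/2)\<close> the points \<open>p + \<i>\<close> and \<open>- p\<close> differ by an even multiple of \<open>\<i>\<close>, a period of \<open>v\<close>,
    so the invariance under \<open>s \<mapsto> - s\<close> transports the residue from pole to pole.\<close>
  have v_i: "v (\<i> * (of_int (m + 1) + 1/2)) = v (\<i> * (of_int m + 1/2))" for m :: int
  proof -
    define p where "p = \<i> * (of_int m + 1/2 :: complex)"
    have mp: "p + \<i> = - p + \<i> * of_int (2 * m + 2)" by (simp add: p_def algebra_simps)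
    have "sech_term w (p + \<i>) n = sech_term w (- p) n" for n
      unfolding mp sech_term_add_int by simp
    hence "v (p + \<i>) = v (- p)" by (simp add: v_def sech_series_def)
    also have "\<dots> = v p" unfolding v_def by (rule sech_series_reflect) (use reflect0 neg in auto)
    finally show ?thesis by (simp add: p_def algebra_simps)
  qed
  have v0: "v (\<i> * (of_int m + 1/2)) = 0" for m :: int
  proof (induction m rule: int_induct[where k = 0])
    case base
    thus ?case using no_pole by (simp add: v_def)
  next
    case (step1 i)
    thus ?case using v_i[of i] by simp
  next
    case (step2 i)
    thus ?case using v_i[of "i - 1"] by simp
  qed
  have G_w: "G (s + of_real w) = G s" for s
    unfolding G_def by (rule sech_series_shift) (use shift in auto)
  have G_2i: "G (s + 2 * \<i>) = G s" for s
  proof -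
    have "sech_term w (s + 2 * \<i>) n = sech_term w s n" for n
      using sech_term_add_int[of w s 2 n] by (simp add: mult.commute)
    thus ?thesis by (simp add: G_def sech_series_def)
  qed
  have openP: "open (- sech_poles w X)" for X using closed_sech_poles[OF w] by auto
  have holG: "G holomorphic_on - sech_poles w UNIV"
    unfolding G_def by (rule holomorphic_sech_series[OF w t])
  note dist1 = sech_poles_isolated[OF w]
  \<comment> \<open>By the splitting, \<open>G\<close> is \<open>u\<close> plus a multiple of the
    quotient of \<open>v\<close> by \<open>cosh\<close>. Near \<open>p\<close> both \<open>u\<close>
    and \<open>v\<close> are holomorphic, \<open>v\<close> vanishes at \<open>p\<close> and
    \<open>cosh\<close> has a simple zero, so the quotient has a limit by l'Hopital's rule.\<close>
  have lim_i: "\<exists>L. (G \<longlongrightarrow> L) (at (\<i> * (of_int m + 1/2)))" for m :: int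
  proof -
    define p where "p = \<i> * (of_int m + 1/2 :: complex)"
    have p: "p \<in> - sech_poles w (- {0})"
    proof -
      have "cosh (complex_of_real pi * (complex_of_real (of_int n * w) + p)) \<noteq> 0" if "n \<noteq> 0" for n
      proof
        assume "cosh (complex_of_real pi * (complex_of_real (of_int n * w) + p)) = 0"
        then obtain k :: int where "complex_of_real (of_int n * w) + p = \<i> * (of_int k + 1/2)"
          by (auto simp: cosh_pi_eq_0_iff)
        from arg_cong[OF this, of Re] show False using w that by (simp add: p_def)
      qed
      thus ?thesis by (auto simp: sech_poles_iff)
    qed
    have "isCont u p" "v field_differentiable at p"
      using holomorphic_sech_series[OF w t, of "- {0}"] holomorphic_sech_series[OF w t0, of "- {0}"] p openP
      unfolding u_def v_def
      by (auto intro!: holomorphic_on_imp_differentiable_at[OF _ openP]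
            continuous_on_interior[of "- sech_poles w (- {0})"] holomorphic_on_imp_continuous_on
            simp: interior_open)
    then obtain v' where v': "(v has_field_derivative v') (at p)" and u: "(u \<longlongrightarrow> u p) (at p)"
      by (auto simp: field_differentiable_def isCont_def)
    have cp: "cosh (complex_of_real pi * p) = 0" by (auto simp: cosh_pi_eq_0_iff p_def)
    have "sinh (complex_of_real pi * p) \<noteq> 0"
      using cosh_square_eq[of "complex_of_real pi * p"] cp by auto
    hence sp: "sinh (complex_of_real pi * p) * of_real pi \<noteq> 0" by simp
    have dc: "((\<lambda>s. cosh (complex_of_real pi * s)) has_field_derivative sinh (complex_of_real pi * p) * of_real pi) (at p)"
      by (auto intro!: derivative_eq_intros)
    have "v p = 0" using v0[of m] by (simp add: p_def)
    from lhopital_complex_simple[OF v' dc this cp sp refl]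
    have "((\<lambda>s. v s / cosh (complex_of_real pi * s)) \<longlongrightarrow> v' / (sinh (complex_of_real pi * p) * of_real pi)) (at p)" .
    hence "((\<lambda>s. u s + complex_of_real pi * (v s / cosh (complex_of_real pi * s))) \<longlongrightarrow>
             u p + pi * (v' / (sinh (complex_of_real pi * p) * of_real pi))) (at p)"
      by (intro tendsto_add[OF u] tendsto_mult[OF tendsto_const])
    moreover have "\<forall>\<^sub>F s in at p. u s + complex_of_real pi * (v s / cosh (complex_of_real pi * s)) = G s"
    proof -
      obtain e where "e > 0" "\<And>y. y \<noteq> p \<Longrightarrow> dist y p < e \<Longrightarrow> y \<notin> sech_poles w UNIV"
        using dist1[of p] by blast
      thus ?thesis
        by (auto simp: eventually_at G_def u_def v_def sech_series_split[OF w _ t] sech_term_def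
              intro!: exI[of _ e])
    qed
    ultimately have "(G \<longlongrightarrow> u p + pi * (v' / (sinh (complex_of_real pi * p) * of_real pi))) (at p)"
      by (rule Lim_transform_eventually)
    thus ?thesis unfolding p_def by blast
  qed
  interpret G: periodic_fun_simple G "of_real w" by standard (rule G_w)
  have lim: "\<exists>L. (G \<longlongrightarrow> L) (at p)" for p
  proof (cases "p \<in> sech_poles w UNIV")
    case True
    then obtain n m :: int where p: "p = complex_of_real (w * of_int n) + \<i> * (of_int m + 1/2)"
      unfolding sech_poles_def by blast
    obtain L where "(G \<longlongrightarrow> L) (at (\<i> * (of_int m + 1/2)))" using lim_i by blast
    from LIM_offset[OF this, of "- (of_int n * of_real w)"]
    have "((\<lambda>x. G (x - of_int n * of_real w)) \<longlongrightarrow> L) (at p)"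
      by (simp add: p algebra_simps)
    thus ?thesis by (auto simp: G.minus_of_int)
  next
    case False
    hence "isCont G p" using holG openP
      by (auto intro!: continuous_on_interior[OF holomorphic_on_imp_continuous_on] simp: interior_open)
    thus ?thesis by (auto simp: isCont_def)
  qed
  \<comment> \<open>At the poles the values of \<open>G\<close> come from division by zero and mean
    nothing, so \<open>G\<close> is replaced by its removable extension.\<close>
  define g where "g = remove_sings G"
  have g_eq: "g s = G s" if "s \<notin> sech_poles w UNIV" for s
  proof -
    have "G analytic_on {s}" using that holG openP analytic_at by blast
    thus ?thesis by (simp add: g_def)
  qed
  have holg: "g holomorphic_on UNIV"
  proof -
    have "g analytic_on {p}" for p
    proof -
      obtain e where e: "e > 0" "\<And>y. y \<noteq> p \<Longrightarrow> dist y p < e \<Longrightarrow> y \<notin> sech_poles w UNIV"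
        using dist1[of p] by blast
      have "ball p e - {p} \<subseteq> - sech_poles w UNIV" using e by (auto simp: dist_commute)
      hence "G analytic_on ball p e - {p}"
        using holG openP analytic_on_open analytic_on_subset by blast
      hence iso: "isolated_singularity_at G p" unfolding isolated_singularity_at_def using e(1) by blast
      obtain L where "(G \<longlongrightarrow> L) (at p)" using lim by blast
      from remove_sings_analytic_at[OF iso this] show ?thesis by (simp add: g_def)
    qed
    thus ?thesis by (meson analytic_at analytic_on_analytic_at analytic_on_open open_UNIV)
  qed
  have per: "g (s + c) = g s" if "\<And>s. G (s + c) = G s" for s c
  proof -
    have "G (s + c + x) = G (s + x)" for x
      using that[of "s + x"] by (simp add: add_ac)
    thus ?thesis unfolding g_def by (subst (1 2) remove_sings_shift_0) simp
  qed
  interpret g1: periodic_fun_simple g "of_real w" by standard (rule per[OF G_w])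
  interpret g2: periodic_fun_simple g "2 * \<i>" by standard (rule per[OF G_2i])
  \<comment> \<open>Every point is moved into one closed period cell, so the range is the image of a
    compact set.\<close>
  have "range g \<subseteq> g ` cbox 0 (Complex w 2)"
  proof
    fix x assume "x \<in> range g"
    then obtain s where x: "x = g s" by blast
    define n where "n = \<lfloor>Re s / w\<rfloor>"
    define m where "m = \<lfloor>Im s / 2\<rfloor>"
    define s' where "s' = (s - of_int n * of_real w) - of_int m * (2 * \<i>)"
    have "g s' = x" unfolding s'_def x g2.minus_of_int g1.minus_of_int ..
    moreover have "s' \<in> cbox 0 (Complex w 2)"
    proof -
      have "of_int n \<le> Re s / w" "Re s / w < of_int n + 1" "of_int m \<le> Im s / 2" "Im s / 2 < of_int m + 1"
        unfolding n_def m_def by linarith+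
      hence "0 \<le> Re s - of_int n * w" "Re s - of_int n * w \<le> w" "0 \<le> Im s - of_int m * 2" "Im s - of_int m * 2 \<le> 2"
        using w by (auto simp: field_simps)
      thus ?thesis by (auto simp: in_cbox_complex_iff s'_def)
    qed
    ultimately show "x \<in> g ` cbox 0 (Complex w 2)" by blast
  qed
  moreover have "compact (g ` cbox 0 (Complex w 2))"
    using holg by (intro compact_continuous_image compact_cbox)
      (auto intro: holomorphic_on_imp_continuous_on holomorphic_on_subset)
  ultimately have "bounded (range g)" using compact_imp_bounded bounded_subset by blast
  hence "g constant_on UNIV" by (rule Liouville_theorem[OF holg])
  then obtain B where "\<And>s. g s = B" by (auto simp: constant_on_def)
  thus ?thesis using g_eq unfolding G_def by metis
qed


section \<open>The sum over all integers and the affine form of the series\<close>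

definition sech_sum :: "real \<Rightarrow> complex \<Rightarrow> complex" where
  "sech_sum w s = (\<Sum>\<^sub>\<infinity>n. sech_term w s n)"

text \<open>These coefficients make \<open>sech_sum\<close> itself a \<open>sech_series\<close>, so
  that it can be subtracted coefficientwise and inherits holomorphy and the splitting.\<close>

definition singletons :: "int set \<Rightarrow> complex" where
  "singletons I = (if card I = 1 then 1 else 0)"

lemma geom_bounded_singletons: "geom_bounded singletons"
  unfolding geom_bounded_def singletons_def by (intro exI[of _ 1]) auto

lemma sech_series_singletons:
  "sech_series w singletons UNIV s = sech_sum w s"
proof -
  have bij: "bij_betw (\<lambda>n::int. {n}) UNIV {I. card I = 1}"
    by (auto simp: bij_betw_def inj_on_def card_1_singleton_iff)
  have "sech_series w singletons UNIV s = (\<Sum>\<^sub>\<infinity>I\<in>{I. card I = 1}. \<Prod>n\<in>I. sech_term w s n)"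
    unfolding sech_series_def
    by (rule infsum_cong_neutral) (auto simp: singletons_def Fpow_def card_1_singleton_iff)
  also have "\<dots> = sech_sum w s"
    unfolding sech_sum_def infsum_reindex_bij_betw[OF bij, symmetric] by simp
  finally show ?thesis .
qed

lemma half_i_not_pole:
  assumes "w > 0"
  shows "\<i> / 2 \<notin> sech_poles w (- {0})"
proof
  assume "\<i> / 2 \<in> sech_poles w (- {0})"
  then obtain n m :: int where "n \<noteq> 0" "\<i> / 2 = complex_of_real (w * of_int n) + \<i> * (of_int m + 1/2)"
    unfolding sech_poles_def by auto
  from arg_cong[OF this(2), of Re] show False using assms \<open>n \<noteq> 0\<close> by simp
qed

text \<open>Only the empty set contributes. The value 1 is the normalisation: adding
  \<open>A\<close> times \<open>singletons\<close> to the coefficients changes the pole coefficient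
  at \<i>/2 by exactly \<open>A\<close>.\<close>

lemma sech_series_singletons_insert:
  "sech_series w (\<lambda>I. singletons (insert 0 I)) (- {0}) s = 1"
proof -
  have "sech_series w (\<lambda>I. singletons (insert 0 I)) (- {0}) s =
     (\<Sum>\<^sub>\<infinity>I\<in>{{}}. singletons (insert 0 I) * (\<Prod>n\<in>I. sech_term w s n))"
    unfolding sech_series_def
  proof (rule infsum_cong_neutral)
    fix I :: "int set" assume "I \<in> Fpow (- {0}) - {{}}"
    hence "finite I" "0 \<notin> I" "I \<noteq> {}" by (auto simp: Fpow_def)
    hence "card (insert 0 I) \<noteq> 1" by simp
    thus "singletons (insert 0 I) * (\<Prod>n\<in>I. sech_term w s n) = 0" by (simp add: singletons_def)
  qed (auto simp: Fpow_def)
  thus ?thesis by (simp add: singletons_def)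
qed

lemma geom_bounded_add:
  assumes "geom_bounded t" "geom_bounded t'"
  shows "geom_bounded (\<lambda>I. t I + a * t' I)"
proof -
  obtain C Q where CQ: "C \<ge> 0" "Q \<ge> 0" "\<And>I. finite I \<Longrightarrow> norm (t I) \<le> C * Q ^ card I"
    using assms(1) unfolding geom_bounded_def by blast
  obtain C' Q' where CQ': "C' \<ge> 0" "Q' \<ge> 0" "\<And>I. finite I \<Longrightarrow> norm (t' I) \<le> C' * Q' ^ card I"
    using assms(2) unfolding geom_bounded_def by blast
  have "norm (t I + a * t' I) \<le> (C + norm a * C') * (max Q Q') ^ card I" if "finite I" for I
  proof -
    have "norm (t I + a * t' I) \<le> norm (t I) + norm a * norm (t' I)"
      using norm_triangle_ineq[of "t I" "a * t' I"] by (simp add: norm_mult)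
    also have "\<dots> \<le> C * Q ^ card I + norm a * (C' * Q' ^ card I)"
      using CQ CQ' that by (intro add_mono mult_left_mono) auto
    also have "\<dots> \<le> C * (max Q Q') ^ card I + norm a * (C' * (max Q Q') ^ card I)"
      using CQ CQ' by (intro add_mono mult_left_mono power_mono) auto
    finally show ?thesis by (simp add: algebra_simps)
  qed
  moreover have "C + norm a * C' \<ge> 0" "max Q Q' \<ge> 0" using CQ CQ' by (auto simp: le_max_iff_disj)
  ultimately show ?thesis unfolding geom_bounded_def by blast
qed

lemma sech_series_add:
  assumes "w > 0" "s \<notin> sech_poles w X" "geom_bounded t" "geom_bounded t'"
  shows "sech_series w (\<lambda>I. t I + a * t' I) X s = sech_series w t X s + a * sech_series w t' X s"
  unfolding sech_series_def infsum_cmult_right'[symmetric]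
  using sech_series_summable[OF assms(1-3)] sech_series_summable[OF assms(1,2,4)]
  by (subst infsum_add[symmetric]) (auto intro!: infsum_cong summable_on_cmult_right simp: algebra_simps)

lemma sech_sum_add_i: "sech_sum w (s + \<i>) = - sech_sum w s"
  by (simp add: sech_sum_def sech_term_add_i infsum_uminus)

lemma sech_sum_minus: "sech_sum w (- s) = sech_sum w s"
  unfolding sech_sum_def sech_term_minus
  by (rule infsum_reindex_bij_witness[of _ uminus uminus]) auto

lemma sech_sum_shift: "sech_sum w (s + of_real w) = sech_sum w s"
  unfolding sech_sum_def sech_term_shift
  by (rule infsum_reindex_bij_witness[of _ "\<lambda>n. n - 1" "\<lambda>n. n + 1"]) auto

text \<open>The point is fixed by the map \<open>s\<close> to \<open>- s + w + \<i>\<close>, under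
  which the sum changes sign. Evaluating an affine expression in \<open>sech_sum\<close> here leaves
  its constant term, which explains the definition of \<open>beta\<close>.\<close>

lemma sech_sum_half_periods: "sech_sum w ((of_real w + \<i>) / 2) = 0"
proof -
  define s where "s = (of_real w + \<i>) / 2"
  have "s = - s + of_real w + \<i>" by (simp add: s_def field_simps)
  hence "sech_sum w s = sech_sum w (- s + of_real w + \<i>)" by (rule arg_cong)
  also have "\<dots> = - sech_sum w s" by (simp only: sech_sum_add_i sech_sum_shift sech_sum_minus)
  finally show ?thesis by (simp add: s_def)
qed

text \<open>The second series is the first one at \<open>s + \<i>\<close>, where
  \<open>sech_sum\<close> changes sign. Both therefore share \<open>A\<close> and \<open>B\<close>,
  and this is the source of the parity of the coefficients in \<open>z\<close>.\<close>

theorem sech_series_affine: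
  assumes w: "w > 0" and t: "geom_bounded t"
    and shift: "\<And>I. finite I \<Longrightarrow> t ((\<lambda>n. n + 1) ` I) = t I"
    and reflect: "\<And>I. finite I \<Longrightarrow> t (uminus ` I) = t I"
  shows "\<exists>A B. \<forall>s. s \<notin> sech_poles w UNIV \<longrightarrow>
           sech_series w t UNIV s = - A * sech_sum w s + B \<and>
           sech_series w (\<lambda>I. (-1) ^ card I * t I) UNIV s = A * sech_sum w s + B"
proof -
  \<comment> \<open>Chosen so that \<open>t'\<close> has pole coefficient 0 at \<i>/2, as
    \<open>sech_series_const\<close> demands.\<close>
  define A where "A = - sech_series w (\<lambda>I. t (insert 0 I)) (- {0}) (\<i> / 2)"
  define t' where "t' = (\<lambda>I. t I + A * singletons I)"
  have t': "geom_bounded t'" unfolding t'_def by (rule geom_bounded_add[OF t geom_bounded_singletons])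
  have "\<exists>B. \<forall>s. s \<notin> sech_poles w UNIV \<longrightarrow> sech_series w t' UNIV s = B"
  proof (rule sech_series_const[OF w t'])
    show "t' ((\<lambda>n. n + 1) ` I) = t' I" if "finite I" for I
      using that shift by (simp add: t'_def singletons_def card_image)
    show "t' (uminus ` I) = t' I" if "finite I" for I
      using that reflect by (simp add: t'_def singletons_def card_image)
    show "sech_series w (\<lambda>I. t' (insert 0 I)) (- {0}) (\<i> / 2) = 0"
      unfolding t'_def
      by (subst sech_series_add[OF w half_i_not_pole[OF w] geom_bounded_insert[OF t] geom_bounded_insert[OF geom_bounded_singletons]])
         (simp add: sech_series_singletons_insert A_def)
  qed
  then obtain B where B: "\<And>s. s \<notin> sech_poles w UNIV \<Longrightarrow> sech_series w t' UNIV s = B" by blast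
  have 1: "sech_series w t UNIV s = - A * sech_sum w s + B" if s: "s \<notin> sech_poles w UNIV" for s
    using B[OF s] unfolding t'_def sech_series_add[OF w s t geom_bounded_singletons] sech_series_singletons
    by (simp add: algebra_simps)
  have "sech_series w (\<lambda>I. (-1) ^ card I * t I) UNIV s = A * sech_sum w s + B"
    if s: "s \<notin> sech_poles w UNIV" for s
  proof -
    have "s + \<i> \<notin> sech_poles w UNIV"
    proof
      assume "s + \<i> \<in> sech_poles w UNIV"
      then obtain n m :: int where "s + \<i> = complex_of_real (w * of_int n) + \<i> * (of_int m + 1/2)"
        unfolding sech_poles_def by auto
      hence "s = complex_of_real (w * of_int n) + \<i> * (of_int m + 1/2) - \<i>"
        by (simp add: eq_diff_eq)
      also have "\<dots> = complex_of_real (w * of_int n) + \<i> * (of_int (m - 1) + 1/2)"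
        by (simp add: algebra_simps)
      finally have "s = complex_of_real (w * of_int n) + \<i> * (of_int (m - 1) + 1/2)" .
      thus False using s unfolding sech_poles_def by blast
    qed
    from 1[OF this] show ?thesis by (simp add: sech_series_add_i sech_sum_add_i)
  qed
  with 1 show ?thesis by blast
qed

lemma sech_sum_local:
  assumes w: "w > 0"
  obtains u where "u holomorphic_on - sech_poles w (- {0})"
    "\<And>s. s \<notin> sech_poles w UNIV \<Longrightarrow> sech_sum w s = u s + sech_term w s 0"
proof
  show "sech_series w singletons (- {0}) holomorphic_on - sech_poles w (- {0})"
    by (rule holomorphic_sech_series[OF w geom_bounded_singletons])
  show "sech_sum w s = sech_series w singletons (- {0}) s + sech_term w s 0"
    if "s \<notin> sech_poles w UNIV" for s
    using sech_series_split[OF w that geom_bounded_singletons]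
    by (simp add: sech_series_singletons sech_series_singletons_insert)
qed

lemma holomorphic_sech_sum:
  assumes "w > 0"
  shows "sech_sum w holomorphic_on - sech_poles w UNIV"
proof -
  have "sech_sum w = sech_series w singletons UNIV" by (rule ext) (simp add: sech_series_singletons)
  thus ?thesis using holomorphic_sech_series[OF assms geom_bounded_singletons] by simp
qed

text \<open>The derivative of \<open>cosh (pi * s)\<close> at \<i>/2 is \<open>\<i> * pi\<close>, so
  the residue is \<open>pi / (\<i> * pi)\<close>. This accounts for the factor \<open>- \<i>\<close>
  in \<open>alpha\<close>.\<close>

lemma sech_sum_simple_pole:
  assumes w: "w > 0"
  shows "((\<lambda>s. sech_sum w s * (s - \<i> / 2)) \<longlongrightarrow> - \<i>) (at (\<i> / 2))"
proof -
  obtain u where u: "u holomorphic_on - sech_poles w (- {0})"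
    "\<And>s. s \<notin> sech_poles w UNIV \<Longrightarrow> sech_sum w s = u s + sech_term w s 0"
    using sech_sum_local[OF w] by blast
  have op: "open (- sech_poles w (- {0}))" using closed_sech_poles[OF w] by auto
  have "isCont u (\<i> / 2)"
    using u(1) op half_i_not_pole[OF w]
    by (auto intro!: continuous_on_interior[OF holomorphic_on_imp_continuous_on] simp: interior_open)
  hence 1: "((\<lambda>s. u s * (s - \<i> / 2)) \<longlongrightarrow> u (\<i> / 2) * (\<i> / 2 - \<i> / 2)) (at (\<i> / 2))"
    by (intro tendsto_mult tendsto_diff tendsto_ident_at tendsto_const) (simp add: isCont_def)
  have sinh: "sinh (complex_of_real pi * (\<i> / 2)) = \<i>"
  proof -
    have "sinh (\<i> * complex_of_real (pi / 2)) = \<i> * sin (complex_of_real (pi / 2))"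
      by (simp add: sinh_conv_sin)
    also have "\<dots> = \<i>" by (simp only: sin_of_real sin_pi_half) simp
    finally show ?thesis by (simp add: mult.commute)
  qed
  have cosh0: "cosh (complex_of_real pi * (\<i> / 2)) = 0"
    by (subst cosh_pi_eq_0_iff) (rule exI[of _ 0], simp)
  have "((\<lambda>s. cosh (complex_of_real pi * s)) has_field_derivative
          sinh (complex_of_real pi * (\<i> / 2)) * of_real pi) (at (\<i> / 2))"
    by (auto intro!: derivative_eq_intros)
  hence dc: "((\<lambda>s. cosh (complex_of_real pi * s)) has_field_derivative \<i> * of_real pi) (at (\<i> / 2))"
    by (simp only: sinh)
  have di: "((\<lambda>s. complex_of_real pi * (s - \<i> / 2)) has_field_derivative of_real pi) (at (\<i> / 2))"
    by (auto intro!: derivative_eq_intros)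
  have "((\<lambda>s. complex_of_real pi * (s - \<i> / 2) / cosh (complex_of_real pi * s)) \<longlongrightarrow> - \<i>) (at (\<i> / 2))"
    by (rule lhopital_complex_simple[OF di dc _ cosh0]) (auto simp: field_simps)
  from tendsto_add[OF 1 this]
  have "((\<lambda>s. u s * (s - \<i> / 2) + complex_of_real pi * (s - \<i> / 2) / cosh (complex_of_real pi * s)) \<longlongrightarrow> - \<i>) (at (\<i> / 2))"
    by simp
  moreover have "\<forall>\<^sub>F s in at (\<i> / 2). u s * (s - \<i> / 2) + complex_of_real pi * (s - \<i> / 2) / cosh (complex_of_real pi * s)
      = sech_sum w s * (s - \<i> / 2)"
  proof -
    obtain e where "e > 0" "\<And>y. y \<noteq> \<i> / 2 \<Longrightarrow> dist y (\<i> / 2) < e \<Longrightarrow> y \<notin> sech_poles w UNIV"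
      using sech_poles_isolated[OF w, of "\<i> / 2"] by blast
    thus ?thesis
      by (auto simp: eventually_at u(2) sech_term_def distrib_right times_divide_eq_left
            simp del: right_diff_distrib intro!: exI[of _ e])
  qed
  ultimately show ?thesis by (rule Lim_transform_eventually)
qed

lemma residue_affine_sech_sum:
  assumes w: "w > 0" and f: "\<And>s. s \<notin> sech_poles w UNIV \<Longrightarrow> f s = - a * sech_sum w s + b"
  shows "residue f (\<i> / 2) = \<i> * a"
proof -
  obtain e where e: "e > 0" "\<And>y. y \<noteq> \<i> / 2 \<Longrightarrow> dist y (\<i> / 2) < e \<Longrightarrow> y \<notin> sech_poles w UNIV"
    using sech_poles_isolated[OF w, of "\<i> / 2"] by blast
  define g where "g = (\<lambda>s. - a * sech_sum w s + b)"
  have "residue f (\<i> / 2) = residue g (\<i> / 2)"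
    by (rule residue_cong) (use e f in \<open>auto simp: eventually_at g_def intro!: exI[of _ e]\<close>)
  also have "\<dots> = \<i> * a"
  proof (rule residue_simple'[of "ball (\<i> / 2) e"])
    have "sech_sum w holomorphic_on ball (\<i> / 2) e - {\<i> / 2}"
      by (rule holomorphic_on_subset[OF holomorphic_sech_sum[OF w]]) (use e in \<open>auto simp: dist_commute\<close>)
    thus "g holomorphic_on ball (\<i> / 2) e - {\<i> / 2}"
      unfolding g_def by (intro holomorphic_intros)
    have "((\<lambda>s. - a * (sech_sum w s * (s - \<i> / 2)) + b * (s - \<i> / 2)) \<longlongrightarrow>
             - a * (- \<i>) + b * (\<i> / 2 - \<i> / 2)) (at (\<i> / 2))"
      by (intro tendsto_add tendsto_mult tendsto_const sech_sum_simple_pole[OF w] tendsto_diff tendsto_ident_at)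
    thus "((\<lambda>s. g s * (s - \<i> / 2)) \<longlongrightarrow> \<i> * a) (at (\<i> / 2))"
      by (simp add: g_def algebra_simps)
  qed (use e in auto)
  finally show ?thesis .
qed

lemma real_not_pole: "complex_of_real k \<notin> sech_poles w X"
proof
  assume "complex_of_real k \<in> sech_poles w X"
  then obtain n m :: int where "complex_of_real k = complex_of_real (w * of_int n) + \<i> * (of_int m + 1/2)"
    unfolding sech_poles_def by auto
  from arg_cong[OF this, of Im] have "0 = 2 * real_of_int m + 1" by simp
  hence "real_of_int (2 * m + 1) = 0" by simp
  hence "2 * m + 1 = 0" by (simp only: of_int_eq_0_iff)
  thus False by presburger
qed

text \<open>A function constant on the reals would be constant on the complement of the poles, which
  is connected because the poles are countable; this contradicts the pole at \<i>/2. Two real points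
  with different values determine the two coefficients of an affine expression in
  \<open>sech_sum\<close>.\<close>

lemma sech_sum_nonconstant_on_reals:
  assumes w: "w > 0"
  shows "\<exists>k1 k2 :: real. sech_sum w (of_real k1) \<noteq> sech_sum w (of_real k2)"
proof (rule ccontr)
  assume "\<not> ?thesis"
  hence c: "sech_sum w (of_real k) - sech_sum w 0 = 0" for k :: real
    by (metis of_real_0 right_minus_eq)
  define S where "S = - sech_poles w UNIV"
  have "sech_poles w UNIV \<subseteq> range (\<lambda>(n::int, m::int). complex_of_real (w * of_int n) + \<i> * (of_int m + 1/2))"
    unfolding sech_poles_def by auto
  hence cnt: "countable (sech_poles w UNIV)" by (rule countable_subset) auto
  have "connected (UNIV - sech_poles w UNIV)"
    by (rule connected_open_diff_countable) (use cnt in auto)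
  hence conn: "connected S" by (simp add: S_def Compl_eq_Diff_UNIV)
  have op: "open S" using closed_sech_poles[OF w] by (auto simp: S_def)
  have "(\<lambda>s. sech_sum w s - sech_sum w 0) holomorphic_on S"
    using holomorphic_sech_sum[OF w] by (intro holomorphic_intros) (simp add: S_def)
  moreover have "range complex_of_real \<subseteq> S" using real_not_pole by (auto simp: S_def)
  moreover have "0 \<in> S" using real_not_pole[of 0] by (simp add: S_def)
  moreover have "0 islimpt range complex_of_real"
    unfolding islimpt_approachable
  proof (intro allI impI)
    fix e :: real assume "e > 0"
    thus "\<exists>x'\<in>range complex_of_real. x' \<noteq> 0 \<and> dist x' 0 < e"
      by (intro bexI[of _ "complex_of_real (e / 2)"] rangeI) auto
  qed
  ultimately have const: "sech_sum w s - sech_sum w 0 = 0" if "s \<in> S" for s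
    by (rule analytic_continuation[OF _ op conn]) (use c that in auto)
  obtain e where e: "e > 0" "\<And>y. y \<noteq> \<i> / 2 \<Longrightarrow> dist y (\<i> / 2) < e \<Longrightarrow> y \<notin> sech_poles w UNIV"
    using sech_poles_isolated[OF w, of "\<i> / 2"] by blast
  have "((\<lambda>s. sech_sum w 0 * (s - \<i> / 2)) \<longlongrightarrow> sech_sum w 0 * (\<i> / 2 - \<i> / 2)) (at (\<i> / 2))"
    by (intro tendsto_intros)
  moreover have "\<forall>\<^sub>F s in at (\<i> / 2). sech_sum w 0 * (s - \<i> / 2) = sech_sum w s * (s - \<i> / 2)"
    unfolding eventually_at using e const by (intro exI[of _ e]) (auto simp: S_def)
  ultimately have "((\<lambda>s. sech_sum w s * (s - \<i> / 2)) \<longlongrightarrow> 0) (at (\<i> / 2))"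
    using Lim_transform_eventually by fastforce
  hence "- \<i> = 0" using sech_sum_simple_pole[OF w] by (intro tendsto_unique[of "at (\<i> / 2)"]) auto
  thus False by simp
qed

lemma cnj_sech_sum_of_real: "cnj (sech_sum w (of_real k)) = sech_sum w (of_real k)"
proof -
  have "cnj (sech_term w (of_real k) n) = sech_term w (of_real k) n" for n
    by (simp add: sech_term_def cosh_def scaleR_conv_of_real exp_cnj)
  thus ?thesis unfolding sech_sum_def by (simp flip: infsum_cnj)
qed

section \<open>Hermitian matrices with summable entries\<close>

lemma l2_bounded:
  assumes "l2 x"
  shows "\<exists>B\<ge>0. \<forall>n. cmod (x n) \<le> B"
proof -
  have "cmod (x n) \<le> sqrt (\<Sum>\<^sub>\<infinity>n. (cmod (x n))\<^sup>2)" for n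
    using finite_sum_le_infsum[of "\<lambda>n. (cmod (x n))\<^sup>2" UNIV "{n}"] assms
    by (intro real_le_rsqrt) (auto simp: l2_def)
  moreover have "sqrt (\<Sum>\<^sub>\<infinity>n. (cmod (x n))\<^sup>2) \<ge> 0" by (intro real_sqrt_ge_zero infsum_nonneg) auto
  ultimately show ?thesis by blast
qed

lemma l2_add:
  assumes "l2 x" "l2 y"
  shows "l2 (\<lambda>n. x n + y n)"
  unfolding l2_def
proof (rule summable_on_comparison_test)
  show "(\<lambda>n. 2 * (cmod (x n))\<^sup>2 + 2 * (cmod (y n))\<^sup>2) summable_on UNIV"
    using assms unfolding l2_def by (intro summable_on_add summable_on_cmult_right)
  show "(cmod (x n + y n))\<^sup>2 \<le> 2 * (cmod (x n))\<^sup>2 + 2 * (cmod (y n))\<^sup>2" for n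
  proof -
    have "(cmod (x n + y n))\<^sup>2 \<le> (cmod (x n) + cmod (y n))\<^sup>2"
      by (intro power_mono norm_triangle_ineq) auto
    also have "\<dots> \<le> 2 * (cmod (x n))\<^sup>2 + 2 * (cmod (y n))\<^sup>2"
      using sum_squares_bound[of "cmod (x n)" "cmod (y n)"] by (simp add: power2_sum)
    finally show ?thesis .
  qed
qed auto

lemma l2_scale: "l2 x \<Longrightarrow> l2 (\<lambda>n. c * x n)"
  unfolding l2_def by (auto simp: norm_mult power_mult_distrib intro!: summable_on_cmult_right)

lemma l2_diff: "l2 x \<Longrightarrow> l2 y \<Longrightarrow> l2 (\<lambda>n. x n - c * y n)"
  using l2_add[of x "\<lambda>n. - c * y n"] l2_scale[of y "- c"] by simp

lemma l2_0: "l2 (\<lambda>_. 0)" by (simp add: l2_def)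

lemma l2_sum: "(\<And>i. i \<in> F \<Longrightarrow> l2 (x i)) \<Longrightarrow> l2 (\<lambda>n. \<Sum>i\<in>F. c i * x i n)"
proof (induction F rule: infinite_finite_induct)
  case (insert i F)
  thus ?case using l2_add[OF l2_scale[of "x i" "c i"], of "\<lambda>n. \<Sum>i\<in>F. c i * x i n"] by simp
qed (auto simp: l2_0)

lemma abs_summable_imp_l2:
  assumes "(\<lambda>n. cmod (x n)) summable_on UNIV"
  shows "l2 x"
proof -
  define C where "C = (\<Sum>\<^sub>\<infinity>n. cmod (x n))"
  have "cmod (x n) \<le> C" for n
    using finite_sum_le_infsum[of "\<lambda>n. cmod (x n)" UNIV "{n}"] assms by (auto simp: C_def)
  hence "(cmod (x n))\<^sup>2 \<le> C * cmod (x n)" for n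
    by (simp add: power2_eq_square mult_right_mono)
  thus ?thesis unfolding l2_def
    using summable_on_comparison_test[OF summable_on_cmult_right[OF assms, of C]] by simp
qed

definition ip :: "(int \<Rightarrow> complex) \<Rightarrow> (int \<Rightarrow> complex) \<Rightarrow> complex" where
  "ip x y = (\<Sum>\<^sub>\<infinity>n. x n * cnj (y n))"

lemma ip_summable:
  assumes "l2 x" "l2 y"
  shows "(\<lambda>n. x n * cnj (y n)) summable_on UNIV"
proof -
  have "(\<lambda>n. norm (x n * cnj (y n))) summable_on UNIV"
  proof (rule Infinite_Sum.abs_summable_on_comparison_test')
    show "(\<lambda>n. (cmod (x n))\<^sup>2 + (cmod (y n))\<^sup>2) summable_on UNIV"
      using assms unfolding l2_def by (intro summable_on_add)
    show "norm (x n * cnj (y n)) \<le> (cmod (x n))\<^sup>2 + (cmod (y n))\<^sup>2" for n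
    proof -
      have "2 * (cmod (x n) * cmod (y n)) \<le> (cmod (x n))\<^sup>2 + (cmod (y n))\<^sup>2"
        using sum_squares_bound[of "cmod (x n)" "cmod (y n)"] by (simp add: mult.assoc)
      moreover have "cmod (x n) * cmod (y n) \<ge> 0" by simp
      ultimately show ?thesis unfolding norm_mult complex_mod_cnj by linarith
    qed
  qed
  thus ?thesis by (rule abs_summable_summable)
qed

lemma ip_cnj: "cnj (ip x y) = ip y x"
  unfolding ip_def by (simp flip: infsum_cnj add: mult.commute)

lemma ip_add_left: "l2 x \<Longrightarrow> l2 y \<Longrightarrow> l2 z \<Longrightarrow> ip (\<lambda>n. x n + y n) z = ip x z + ip y z"
  unfolding ip_def by (subst infsum_add[symmetric]) (auto intro: ip_summable simp: algebra_simps)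

lemma ip_scale_left: "ip (\<lambda>n. c * x n) y = c * ip x y"
  unfolding ip_def by (simp add: mult.assoc infsum_cmult_right')

lemma ip_scale_right: "ip x (\<lambda>n. c * y n) = cnj c * ip x y"
  using ip_cnj[of "\<lambda>n. c * y n" x] by (simp add: ip_scale_left ip_cnj)

lemma ip_add_right: "l2 x \<Longrightarrow> l2 y \<Longrightarrow> l2 z \<Longrightarrow> ip z (\<lambda>n. x n + y n) = ip z x + ip z y"
  using ip_cnj[of "\<lambda>n. x n + y n" z] by (simp add: ip_add_left ip_cnj)

lemma ip_diff_left:
  assumes "l2 x" "l2 y" "l2 z"
  shows "ip (\<lambda>n. x n - c * y n) z = ip x z - c * ip y z"
  using ip_add_left[OF assms(1) l2_scale[OF assms(2), of "- c"] assms(3)] ip_scale_left[of "- c" y z] by simp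

lemma ip_zero_left: "ip (\<lambda>_. 0) y = 0" by (simp add: ip_def)

lemma ip_sum_left:
  assumes "finite F" "\<And>i. i \<in> F \<Longrightarrow> l2 (x i)" "l2 y"
  shows "ip (\<lambda>n. \<Sum>i\<in>F. c i * x i n) y = (\<Sum>i\<in>F. c i * ip (x i) y)"
  using assms
proof (induction F rule: finite_induct)
  case (insert i F)
  have "ip (\<lambda>n. \<Sum>i\<in>insert i F. c i * x i n) y = ip (\<lambda>n. c i * x i n + (\<Sum>i\<in>F. c i * x i n)) y"
    using insert by simp
  also have "\<dots> = c i * ip (x i) y + (\<Sum>i\<in>F. c i * ip (x i) y)"
    using insert by (subst ip_add_left) (auto intro!: l2_scale l2_sum simp: ip_scale_left)
  finally show ?case using insert by simp
qed (simp add: ip_zero_left)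

definition sqn :: "(int \<Rightarrow> complex) \<Rightarrow> real" where
  "sqn x = (\<Sum>\<^sub>\<infinity>n. (cmod (x n))\<^sup>2)"

lemma ip_self:
  assumes "l2 x"
  shows "ip x x = of_real (sqn x)"
proof -
  have "((\<lambda>n. (cmod (x n))\<^sup>2) has_sum sqn x) UNIV"
    using assms by (simp add: sqn_def l2_def)
  hence "((\<lambda>n. complex_of_real ((cmod (x n))\<^sup>2)) has_sum of_real (sqn x)) UNIV"
    by (rule has_sum_of_real)
  hence "((\<lambda>n. x n * cnj (x n)) has_sum of_real (sqn x)) UNIV"
    by (simp only: complex_norm_square)
  thus ?thesis unfolding ip_def by (rule infsumI)
qed

lemma sqn_nonneg: "sqn x \<ge> 0" unfolding sqn_def by (rule infsum_nonneg) auto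

lemma sqn_eq_0D:
  assumes "l2 x" "sqn x \<le> 0"
  shows "x n = 0"
proof -
  have "(cmod (x n))\<^sup>2 = 0"
    by (rule nonneg_infsum_le_0D[where A = UNIV]) (use assms in \<open>auto simp: sqn_def l2_def\<close>)
  thus ?thesis by simp
qed

lemma sqn_scale: "sqn (\<lambda>n. of_real c * x n) = c\<^sup>2 * sqn x"
  unfolding sqn_def by (simp add: norm_mult power_mult_distrib infsum_cmult_right')

text \<open>Stated by finite partial sums, the ball is an intersection of conditions on finitely
  many coordinates, hence visibly closed for coordinatewise convergence.\<close>

definition unit_ball :: "(int \<Rightarrow> complex) set" where
  "unit_ball = {x. \<forall>F. finite F \<longrightarrow> (\<Sum>n\<in>F. (cmod (x n))\<^sup>2) \<le> 1}"

lemma unit_ball_iff: "x \<in> unit_ball \<longleftrightarrow> l2 x \<and> sqn x \<le> 1"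
proof
  assume x: "x \<in> unit_ball"
  have "l2 x" unfolding l2_def
    by (rule nonneg_bdd_above_summable_on) (use x in \<open>auto simp: unit_ball_def intro!: bdd_aboveI2[of _ _ 1]\<close>)
  moreover have "sqn x \<le> 1" unfolding sqn_def
    by (rule infsum_le_finite_sums) (use x \<open>l2 x\<close> in \<open>auto simp: unit_ball_def l2_def\<close>)
  ultimately show "l2 x \<and> sqn x \<le> 1" by blast
next
  assume x: "l2 x \<and> sqn x \<le> 1"
  show "x \<in> unit_ball" unfolding unit_ball_def
  proof (intro CollectI allI impI)
    fix F :: "int set" assume "finite F"
    hence "(\<Sum>n\<in>F. (cmod (x n))\<^sup>2) \<le> sqn x" unfolding sqn_def
      by (intro finite_sum_le_infsum) (use x in \<open>auto simp: l2_def\<close>)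
    thus "(\<Sum>n\<in>F. (cmod (x n))\<^sup>2) \<le> 1" using x by linarith
  qed
qed

text \<open>A product of discs, compact by Tychonoff's theorem. It contains the unit ball, and
  continuity of the forms is proved here because it only needs coordinates of modulus at most
  1.\<close>

definition poly_disc :: "(int \<Rightarrow> complex) set" where
  "poly_disc = PiE UNIV (\<lambda>_. cball 0 1)"

lemma compact_poly_disc: "compact poly_disc"
proof -
  have "compactin (product_topology (\<lambda>_::int. euclidean :: complex topology) UNIV) poly_disc"
    unfolding poly_disc_def by (subst compactin_PiE) auto
  thus ?thesis by (simp add: euclidean_product_topology)
qed

lemma unit_ball_subset: "unit_ball \<subseteq> poly_disc"
proof
  fix x assume x: "x \<in> unit_ball"
  have "cmod (x n) \<le> 1" for n
  proof -
    have "(\<Sum>n\<in>{n}. (cmod (x n))\<^sup>2) \<le> 1"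
      by (rule x[unfolded unit_ball_def mem_Collect_eq, rule_format]) auto
    thus ?thesis by (simp add: abs_square_le_1)
  qed
  thus "x \<in> poly_disc" by (auto simp: poly_disc_def)
qed

lemma continuous_on_coordinate: "continuous_on S (\<lambda>x :: int \<Rightarrow> complex. x n)"
  by (rule continuous_on_subset[OF continuous_on_product_coordinates subset_UNIV])

lemma compact_unit_ball: "compact unit_ball"
proof -
  have "closed {x :: int \<Rightarrow> complex. (\<Sum>n\<in>F. (cmod (x n))\<^sup>2) \<le> 1}" for F
    by (intro closed_Collect_le continuous_intros continuous_on_product_coordinates)
  hence "closed unit_ball"
    unfolding unit_ball_def by (intro closed_Collect_all closed_Collect_imp) auto
  thus ?thesis using compact_Int_closed[OF compact_poly_disc, of unit_ball] unit_ball_subset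
    by (simp add: Int_absorb1)
qed

lemma continuous_on_infsum_poly_disc:
  fixes f :: "'i \<Rightarrow> (int \<Rightarrow> complex) \<Rightarrow> complex"
  assumes "\<And>i. continuous_on poly_disc (f i)" "\<And>i x. x \<in> poly_disc \<Longrightarrow> norm (f i x) \<le> M i" "M summable_on UNIV"
  shows "continuous_on poly_disc (\<lambda>x. \<Sum>\<^sub>\<infinity>i. f i x)"
proof (rule uniform_limit_theorem)
  show "uniform_limit poly_disc (\<lambda>F x. \<Sum>i\<in>F. f i x) (\<lambda>x. \<Sum>\<^sub>\<infinity>i. f i x) (finite_subsets_at_top UNIV)"
    by (rule Weierstrass_m_test_general) (use assms in auto)
  show "\<forall>\<^sub>F F in finite_subsets_at_top UNIV. continuous_on poly_disc (\<lambda>x. \<Sum>i\<in>F. f i x)"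
    by (intro always_eventually allI continuous_on_sum assms(1))
qed auto

text \<open>Absolute summability of all entries implies trace class and stands in for operator
  theory: double sums may be rearranged, and the quadratic form is continuous for coordinatewise
  convergence on bounded sets.\<close>

locale summable_hermitian =
  fixes H :: "int \<Rightarrow> int \<Rightarrow> complex"
  assumes sumH: "(\<lambda>(n,m). cmod (H n m)) summable_on UNIV"
    and herm: "\<And>n m. H m n = cnj (H n m)"
begin

definition app :: "(int \<Rightarrow> complex) \<Rightarrow> int \<Rightarrow> complex" where
  "app x n = (\<Sum>\<^sub>\<infinity>m. H n m * x m)"

definition form :: "(int \<Rightarrow> complex) \<Rightarrow> (int \<Rightarrow> complex) \<Rightarrow> complex" where
  "form x y = (\<Sum>\<^sub>\<infinity>(n,m). H n m * x m * cnj (y n))"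

lemma form_abs_summable:
  assumes "l2 x" "l2 y"
  shows "(\<lambda>(n,m). norm (H n m * x m * cnj (y n))) summable_on UNIV"
proof -
  obtain B where B: "B \<ge> 0" "\<And>n. cmod (x n) \<le> B" using l2_bounded[OF assms(1)] by blast
  obtain C where C: "C \<ge> 0" "\<And>n. cmod (y n) \<le> C" using l2_bounded[OF assms(2)] by blast
  have "(\<lambda>(n,m). cmod (H n m) * (B * C)) summable_on UNIV"
    using summable_on_cmult_left[OF sumH, of "B * C"] by (simp add: case_prod_unfold)
  thus ?thesis
  proof (rule summable_on_comparison_test)
    fix nm :: "int \<times> int"
    show "(case nm of (n, m) \<Rightarrow> norm (H n m * x m * cnj (y n))) \<le> (case nm of (n, m) \<Rightarrow> cmod (H n m) * (B * C))"
      using B C by (cases nm) (auto simp: norm_mult mult.assoc intro!: mult_left_mono mult_mono)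
  qed (auto simp: case_prod_unfold)
qed

lemma form_summable:
  assumes "l2 x" "l2 y"
  shows "(\<lambda>(n,m). H n m * x m * cnj (y n)) summable_on UNIV"
  using abs_summable_summable[of "\<lambda>(n,m). H n m * x m * cnj (y n)" UNIV] form_abs_summable[OF assms]
  by (simp add: case_prod_unfold)

lemma row_summable:
  assumes "l2 x"
  shows "(\<lambda>m. H n m * x m) summable_on UNIV" "(\<lambda>m. cmod (H n m)) summable_on UNIV"
    "(\<lambda>m. norm (H n m * x m)) summable_on UNIV"
proof -
  obtain B where B: "B \<ge> 0" "\<And>n. cmod (x n) \<le> B" using l2_bounded[OF assms(1)] by blast
  show r: "(\<lambda>m. cmod (H n m)) summable_on UNIV"
    using summable_on_SigmaD1[of "\<lambda>n m. cmod (H n m)" UNIV "\<lambda>_. UNIV" n] sumH by simp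
  show a: "(\<lambda>m. norm (H n m * x m)) summable_on UNIV"
    by (rule Infinite_Sum.abs_summable_on_comparison_test'[OF summable_on_cmult_left[OF r, of B]])
       (use B in \<open>auto simp: norm_mult intro!: mult_left_mono\<close>)
  show "(\<lambda>m. H n m * x m) summable_on UNIV" by (rule abs_summable_summable[OF a])
qed

text \<open>A consequence is that eigenvectors for non-zero eigenvalues are absolutely summable.
  This makes orthogonality to them a closed condition on the compact ball.\<close>

lemma app_abs_summable:
  assumes "l2 x"
  shows "(\<lambda>n. cmod (app x n)) summable_on UNIV"
proof -
  obtain B where B: "B \<ge> 0" "\<And>n. cmod (x n) \<le> B" using l2_bounded[OF assms(1)] by blast
  have s: "(\<lambda>n. B * (\<Sum>\<^sub>\<infinity>m. cmod (H n m))) summable_on UNIV"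
    using summable_on_Sigma_banach[of "\<lambda>n m. cmod (H n m)" UNIV "\<lambda>_. UNIV"] sumH
    by (intro summable_on_cmult_right) simp
  show ?thesis
  proof (rule Infinite_Sum.abs_summable_on_comparison_test'[OF s])
    fix n
    have "norm (app x n) \<le> (\<Sum>\<^sub>\<infinity>m. norm (H n m * x m))"
      unfolding app_def by (rule norm_infsum_bound) (rule row_summable(3)[OF assms])
    also have "\<dots> \<le> (\<Sum>\<^sub>\<infinity>m. B * cmod (H n m))"
      by (intro infsum_mono row_summable[OF assms] summable_on_cmult_right)
         (use B in \<open>auto simp: norm_mult mult.commute[of B] intro!: mult_left_mono\<close>)
    finally show "norm (app x n) \<le> B * (\<Sum>\<^sub>\<infinity>m. cmod (H n m))" by (simp add: infsum_cmult_right')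
  qed
qed

lemma l2_app: "l2 x \<Longrightarrow> l2 (app x)"
  by (rule abs_summable_imp_l2) (rule app_abs_summable)

lemma form_eq_ip:
  assumes "l2 x" "l2 y"
  shows "form x y = ip (app x) y"
proof -
  have "form x y = (\<Sum>\<^sub>\<infinity>n. \<Sum>\<^sub>\<infinity>m. H n m * x m * cnj (y n))"
    unfolding form_def
    using infsum_Sigma'_banach[of "\<lambda>n m. H n m * x m * cnj (y n)" UNIV "\<lambda>_. UNIV"] form_summable[OF assms] by simp
  thus ?thesis by (simp add: ip_def app_def infsum_cmult_left')
qed

lemma form_cnj:
  shows "cnj (form x y) = form y x"
proof -
  have "cnj (form x y) = (\<Sum>\<^sub>\<infinity>(n,m). H m n * cnj (x m) * y n)"
    unfolding form_def by (simp flip: infsum_cnj add: case_prod_unfold herm[symmetric])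
  also have "\<dots> = form y x" unfolding form_def
    by (rule infsum_reindex_bij_witness[of _ prod.swap prod.swap]) auto
  finally show ?thesis .
qed

lemma ip_app_sym:
  assumes "l2 x" "l2 y"
  shows "ip (app x) y = ip x (app y)"
  using form_eq_ip[OF assms] form_eq_ip[OF assms(2,1)] form_cnj[of y x] ip_cnj[of "app y" x] by simp

lemma eigvec_iff: "eigvec H \<mu> x \<longleftrightarrow> l2 x \<and> (\<forall>n. app x n = \<mu> * x n)"
  unfolding eigvec_def app_def using row_summable(1)[of x] by (auto simp: has_sum_iff)

lemma app_add: "l2 x \<Longrightarrow> l2 y \<Longrightarrow> app (\<lambda>n. x n + y n) n = app x n + app y n"
  unfolding app_def distrib_left by (intro infsum_add row_summable)

lemma app_scale: "app (\<lambda>n. c * x n) n = c * app x n"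
  unfolding app_def by (simp add: infsum_cmult_right'[symmetric] mult_ac)

definition quad :: "(int \<Rightarrow> complex) \<Rightarrow> real" where "quad x = Re (form x x)"

lemma quad_scale: "l2 x \<Longrightarrow> quad (\<lambda>n. of_real c * x n) = c\<^sup>2 * quad x"
  unfolding quad_def
  by (simp add: form_eq_ip l2_scale app_scale[abs_def] ip_scale_left ip_scale_right power2_eq_square mult.assoc)

lemma continuous_quad: "continuous_on poly_disc quad"
  unfolding quad_def form_def
proof (intro continuous_on_Re continuous_on_infsum_poly_disc)
  show "continuous_on poly_disc (\<lambda>x. case i of (n, m) \<Rightarrow> H n m * x m * cnj (x n))" for i
    by (cases i) (auto intro!: continuous_on_mult continuous_on_const continuous_on_cnj continuous_on_coordinate)
  show "norm (case i of (n, m) \<Rightarrow> H n m * x m * cnj (x n)) \<le> (case i of (n, m) \<Rightarrow> cmod (H n m))"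
    if "x \<in> poly_disc" for i x
  proof (cases i)
    case (Pair n m)
    have "cmod (x m) \<le> 1" "cmod (x n) \<le> 1" using that by (auto simp: poly_disc_def)
    hence "cmod (x m) * cmod (x n) \<le> 1 * 1" by (intro mult_mono) auto
    thus ?thesis using mult_left_mono[of "cmod (x m) * cmod (x n)" 1 "cmod (H n m)"]
      by (simp add: Pair norm_mult mult.assoc)
  qed
qed (rule sumH)

lemma quad_expand:
  assumes "l2 x" "l2 y"
  shows "quad (\<lambda>n. x n + of_real t * y n) = quad x + 2 * t * Re (form x y) + t\<^sup>2 * quad y"
proof -
  let ?y = "\<lambda>n. of_real t * y n"
  have y: "l2 ?y" by (rule l2_scale[OF assms(2)])
  have xy: "l2 (\<lambda>n. x n + ?y n)" by (rule l2_add[OF assms(1) y])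
  have "form (\<lambda>n. x n + ?y n) (\<lambda>n. x n + ?y n) = ip (\<lambda>n. app x n + app ?y n) (\<lambda>n. x n + ?y n)"
    using form_eq_ip[OF xy xy] app_add[OF assms(1) y, abs_def] by (simp only: )
  also have "\<dots> = form x x + form x ?y + form ?y x + form ?y ?y"
    using assms y xy by (simp add: ip_add_left ip_add_right l2_app form_eq_ip)
  also have "form x ?y = of_real t * form x y"
    using assms y by (simp add: form_eq_ip ip_scale_right)
  finally have "form (\<lambda>n. x n + ?y n) (\<lambda>n. x n + ?y n) = form x x + of_real t * form x y + form ?y x + form ?y ?y" .
  moreover have "form ?y x = cnj (of_real t * form x y)"
    using form_cnj[of x ?y] assms y by (simp add: form_eq_ip ip_scale_right)
  moreover have "Re (form ?y ?y) = t\<^sup>2 * quad y" using quad_scale[OF assms(2), of t] by (simp add: quad_def)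
  ultimately show ?thesis by (simp add: quad_def)
qed

lemma app_diff: "l2 x \<Longrightarrow> l2 y \<Longrightarrow> app (\<lambda>n. x n - c * y n) n = app x n - c * app y n"
  using app_add[of x "\<lambda>n. - c * y n" n] app_scale[of "- c" y n] l2_scale[of y "- c"] by simp

lemma sqn_expand:
  assumes "l2 x" "l2 y"
  shows "sqn (\<lambda>n. x n + of_real t * y n) = sqn x + 2 * t * Re (ip x y) + t\<^sup>2 * sqn y"
proof -
  let ?y = "\<lambda>n. of_real t * y n"
  have y: "l2 ?y" by (rule l2_scale[OF assms(2)])
  have xy: "l2 (\<lambda>n. x n + ?y n)" by (rule l2_add[OF assms(1) y])
  have "ip (\<lambda>n. x n + ?y n) (\<lambda>n. x n + ?y n) = ip x x + ip x ?y + ip ?y x + ip ?y ?y"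
    using assms y xy by (simp add: ip_add_left ip_add_right)
  also have "\<dots> = ip x x + of_real t * ip x y + of_real t * cnj (ip x y) + of_real (t\<^sup>2) * ip y y"
    by (simp add: ip_scale_left ip_scale_right ip_cnj power2_eq_square mult.assoc)
  finally show ?thesis
    unfolding ip_self[OF xy] ip_self[OF assms(1)] ip_self[OF assms(2)]
    by (auto dest!: arg_cong[of _ _ Re])
qed

text \<open>The maximum of the quadratic form over the unit ball of \<open>V\<^sup>\<bottom>\<close> exists because the ball is compact
  for coordinatewise convergence, and it is attained at an eigenvector.\<close>

lemma positive_quad_eigvec:
  fixes V :: "(int \<Rightarrow> complex) set"
  assumes V: "\<And>v. v \<in> V \<Longrightarrow> l2 v \<and> (\<lambda>n. cmod (v n)) summable_on UNIV \<and> (\<exists>c. \<forall>n. app v n = c * v n)"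
    and x0: "l2 x0" "\<And>v. v \<in> V \<Longrightarrow> ip x0 v = 0" "quad x0 > 0"
  shows "\<exists>M x. M > 0 \<and> l2 x \<and> x \<noteq> (\<lambda>_. 0) \<and> (\<forall>n. app x n = complex_of_real M * x n) \<and> (\<forall>v\<in>V. ip x v = 0)"
proof -
  define K where "K = unit_ball \<inter> (\<Inter>v\<in>V. {x \<in> unit_ball. ip x v = 0})"
  have closed_ball: "closed unit_ball" using compact_unit_ball by (rule compact_imp_closed)
  have "closed {x \<in> unit_ball. ip x v = 0}" if v: "v \<in> V" for v
  proof (rule continuous_closed_preimage_constant[OF _ closed_ball])
    have "continuous_on poly_disc (\<lambda>x. \<Sum>\<^sub>\<infinity>n. x n * cnj (v n))"
    proof (rule continuous_on_infsum_poly_disc)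
      show "continuous_on poly_disc (\<lambda>x. x n * cnj (v n))" for n
        by (intro continuous_on_mult continuous_on_const continuous_on_coordinate)
      show "(\<lambda>n. cmod (v n)) summable_on UNIV" using V[OF v] by blast
      show "norm (x n * cnj (v n)) \<le> cmod (v n)" if "x \<in> poly_disc" for n x
      proof -
        have "cmod (x n) \<le> 1" using that by (auto simp: poly_disc_def)
        thus ?thesis by (simp add: norm_mult mult_left_le_one_le)
      qed
    qed
    thus "continuous_on unit_ball (\<lambda>x. ip x v)"
      unfolding ip_def by (rule continuous_on_subset[OF _ unit_ball_subset])
  qed
  hence compK: "compact K" unfolding K_def by (intro compact_Int_closed compact_unit_ball closed_INT) auto
  have K_iff: "x \<in> K \<longleftrightarrow> l2 x \<and> sqn x \<le> 1 \<and> (\<forall>v\<in>V. ip x v = 0)" for x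
    by (auto simp: K_def unit_ball_iff)
  have "(\<lambda>_. 0) \<in> K" by (simp add: K_iff l2_0 sqn_def ip_zero_left)
  hence "K \<noteq> {}" by blast
  moreover have "continuous_on K quad"
    by (rule continuous_on_subset[OF continuous_quad]) (use unit_ball_subset in \<open>auto simp: K_def\<close>)
  ultimately obtain x where x: "x \<in> K" "\<And>y. y \<in> K \<Longrightarrow> quad y \<le> quad x"
    using continuous_attains_sup[OF compK] by blast
  define M where "M = quad x"
  \<comment> \<open>By scaling, the maximum over the ball becomes a homogeneous inequality on the
    whole of the orthogonal complement of \<open>V\<close>.\<close>
  have bound: "quad y \<le> M * sqn y" if y: "l2 y" "\<And>v. v \<in> V \<Longrightarrow> ip y v = 0" for y
  proof (cases "sqn y \<le> 0")
    case True
    hence "y = (\<lambda>_. 0)" using sqn_eq_0D[OF y(1)] by auto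
    thus ?thesis by (simp add: quad_def form_def sqn_def case_prod_unfold)
  next
    case False
    define c where "c = 1 / sqrt (sqn y)"
    have c: "c\<^sup>2 * sqn y = 1" "c\<^sup>2 > 0" using False by (auto simp: c_def power_divide)
    have "(\<lambda>n. of_real c * y n) \<in> K"
      unfolding K_iff using y c by (simp add: l2_scale sqn_scale ip_scale_left)
    from x(2)[OF this] have "c\<^sup>2 * quad y \<le> M" by (simp add: quad_scale[OF y(1)] M_def)
    also have "M = c\<^sup>2 * (M * sqn y)" using c by (simp add: mult.left_commute)
    finally show ?thesis using c(2) by simp
  qed
  have xl: "l2 x" "sqn x \<le> 1" "\<And>v. v \<in> V \<Longrightarrow> ip x v = 0" using x(1) by (auto simp: K_iff)
  have Mpos: "M > 0"
  proof (rule ccontr)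
    assume "\<not> M > 0"
    hence "M * sqn x0 \<le> 0" using sqn_nonneg[of x0] by (simp add: mult_nonpos_nonneg)
    thus False using bound[OF x0(1,2)] x0(3) by linarith
  qed
  have "M \<le> M * sqn x" using bound[OF xl(1,3)] by (simp add: M_def)
  hence sx: "sqn x = 1" using Mpos xl(2) by simp
  \<comment> \<open>The defect of the eigenvalue equation at the maximiser. It is an admissible
    direction: \<open>V\<close> consists of eigenvectors and the matrix is hermitian, so
    \<open>y\<close> is again orthogonal to \<open>V\<close>.\<close>
  define y where "y = (\<lambda>n. app x n - of_real M * x n)"
  have yl: "l2 y" unfolding y_def by (intro l2_diff l2_app xl)
  have yV: "ip y v = 0" if v: "v \<in> V" for v
  proof -
    obtain c where c: "\<And>n. app v n = c * v n" using V[OF v] by blast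
    have "ip y v = ip (app x) v - of_real M * ip x v"
      unfolding y_def using V[OF v] by (intro ip_diff_left l2_app xl) auto
    also have "ip (app x) v = ip x (app v)" using V[OF v] xl by (intro ip_app_sym) auto
    also have "app v = (\<lambda>n. c * v n)" using c by auto
    finally show ?thesis using xl(3)[OF v] by (simp add: ip_scale_right)
  qed
  have sy: "form x y - of_real M * ip x y = of_real (sqn y)"
    unfolding ip_self[OF yl, symmetric] form_eq_ip[OF xl(1) yl]
    using ip_diff_left[OF l2_app[OF xl(1)] xl(1) yl, of "of_real M"] by (simp add: y_def)
  \<comment> \<open>Moving from \<open>x\<close> along \<open>y\<close> must not violate
    \<open>bound\<close>. The terms of first order in \<open>t\<close> combine to
    \<open>2 * sqn y\<close>, so letting \<open>t\<close> be small forces \<open>y\<close> to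
    vanish.\<close>
  have ineq: "2 * sqn y \<le> t * (M * sqn y - quad y)" if t: "t > 0" for t
  proof -
    have "quad (\<lambda>n. x n + of_real t * y n) \<le> M * sqn (\<lambda>n. x n + of_real t * y n)"
    proof (rule bound)
      show "l2 (\<lambda>n. x n + of_real t * y n)" by (intro l2_add l2_scale xl yl)
      show "ip (\<lambda>n. x n + of_real t * y n) v = 0" if "v \<in> V" for v
        using that V[OF that] xl yl yV by (simp add: ip_add_left l2_scale ip_scale_left)
    qed
    hence "M + 2 * t * Re (form x y) + t\<^sup>2 * quad y \<le> M * (1 + 2 * t * Re (ip x y) + t\<^sup>2 * sqn y)"
      unfolding quad_expand[OF xl(1) yl] sqn_expand[OF xl(1) yl] sx M_def[symmetric] .
    moreover have "Re (form x y) = sqn y + M * Re (ip x y)"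
      using arg_cong[OF sy, of Re] by simp
    ultimately have "t * (2 * sqn y) \<le> t * (t * (M * sqn y - quad y))"
      by (simp add: algebra_simps power2_eq_square)
    thus ?thesis using t by simp
  qed
  have "sqn y \<le> 0"
  proof (rule ccontr)
    assume "\<not> sqn y \<le> 0"
    hence pos: "sqn y > 0" by simp
    \<comment> \<open>With \<open>t = sqn y / C\<close> the right-hand side of \<open>ineq\<close>
      is at most \<open>sqn y\<close>; the summand 1 keeps \<open>C\<close> positive.\<close>
    define C where "C = \<bar>M * sqn y - quad y\<bar> + 1"
    have "2 * sqn y \<le> sqn y / C * (M * sqn y - quad y)"
      using pos by (intro ineq) (auto simp: C_def)
    also have "\<dots> \<le> sqn y / C * C" using pos by (intro mult_left_mono) (auto simp: C_def)
    also have "\<dots> = sqn y" by (simp add: C_def)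
    finally show False using pos by simp
  qed
  hence "y n = 0" for n by (rule sqn_eq_0D[OF yl])
  hence "app x n = of_real M * x n" for n by (simp add: y_def)
  moreover have "x \<noteq> (\<lambda>_. 0)" using sx by (auto simp: sqn_def)
  ultimately show ?thesis using Mpos xl by blast
qed

end

lemma (in summable_hermitian) summable_hermitian_uminus: "summable_hermitian (\<lambda>n m. - H n m)"
proof
  show "(\<lambda>(n, m). cmod (- H n m)) summable_on UNIV" using sumH by simp
  show "- H m n = cnj (- H n m)" for n m by (subst herm[of m n]) simp
qed

context summable_hermitian
begin

lemma nonzero_quad_eigvec:
  fixes V :: "(int \<Rightarrow> complex) set"
  assumes V: "\<And>v. v \<in> V \<Longrightarrow> l2 v \<and> (\<lambda>n. cmod (v n)) summable_on UNIV \<and> (\<exists>c. \<forall>n. app v n = c * v n)"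
    and x0: "l2 x0" "\<And>v. v \<in> V \<Longrightarrow> ip x0 v = 0" "quad x0 \<noteq> 0"
  shows "\<exists>M x. M \<noteq> 0 \<and> eigvec H M x \<and> x \<noteq> (\<lambda>_. 0) \<and> (\<forall>v\<in>V. ip x v = 0)"
proof (cases "quad x0 > 0")
  case True
  thus ?thesis using positive_quad_eigvec[OF V x0(1,2)] unfolding eigvec_iff
    by (metis of_real_eq_0_iff less_irrefl)
next
  case False
  interpret m: summable_hermitian "\<lambda>n m. - H n m" by (rule summable_hermitian_uminus)
  have app: "m.app x n = - app x n" for x n by (simp add: m.app_def app_def infsum_uminus)
  have "m.quad x0 = - quad x0"
    by (simp add: m.quad_def quad_def m.form_def form_def case_prod_unfold infsum_uminus)
  hence q: "m.quad x0 > 0" using False x0(3) by simp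
  have "\<exists>M x. M > 0 \<and> l2 x \<and> x \<noteq> (\<lambda>_. 0) \<and> (\<forall>n. m.app x n = complex_of_real M * x n) \<and> (\<forall>v\<in>V. ip x v = 0)"
  proof (rule m.positive_quad_eigvec[OF _ x0(1,2) q])
    fix v assume "v \<in> V"
    from V[OF this] obtain c where "l2 v" "(\<lambda>n. cmod (v n)) summable_on UNIV" "\<And>n. app v n = c * v n" by blast
    thus "l2 v \<and> (\<lambda>n. cmod (v n)) summable_on UNIV \<and> (\<exists>c. \<forall>n. m.app v n = c * v n)"
      by (auto simp: app intro!: exI[of _ "- c"])
  qed
  then obtain M x where Mx: "M > 0" "l2 x" "x \<noteq> (\<lambda>_. 0)" "\<And>n. m.app x n = complex_of_real M * x n" "\<forall>v\<in>V. ip x v = 0" by blast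
  have "app x n = - of_real M * x n" for n using Mx(4)[of n] by (simp add: app minus_equation_iff[of "app x n"])
  thus ?thesis unfolding eigvec_iff using Mx by (intro exI[of _ "- of_real M"] exI[of _ x]) auto
qed

end

section \<open>Bessel's inequality and the spectral decomposition\<close>

lemma has_sum_finite_sum:
  fixes f :: "'i \<Rightarrow> 'a \<Rightarrow> 'b::{topological_comm_monoid_add,t2_space}"
  assumes "finite F" "\<And>i. i \<in> F \<Longrightarrow> (f i has_sum s i) A"
  shows "((\<lambda>x. \<Sum>i\<in>F. f i x) has_sum (\<Sum>i\<in>F. s i)) A"
  using assms by (induction F rule: finite_induct) (auto intro!: has_sum_add)

definition unit_vec :: "int \<Rightarrow> int \<Rightarrow> complex" where
  "unit_vec n k = (if k = n then 1 else 0)"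

lemma unit_vec_has_sum: "((\<lambda>k. unit_vec n k * f k) has_sum f n) UNIV"
  by (rule has_sum_finite_neutralI[of "{n}"]) (auto simp: unit_vec_def)

lemma l2_unit_vec: "l2 (unit_vec n)"
  unfolding l2_def
  by (rule finite_nonzero_values_imp_summable_on) (rule finite_subset[of _ "{n}"], auto simp: unit_vec_def)

lemma ip_unit_vec_left: "ip (unit_vec n) y = cnj (y n)"
  unfolding ip_def by (rule infsumI[OF unit_vec_has_sum])

text \<open>The \<open>v j\<close> need not span: completeness is required only against eigenvectors
  with non-zero eigenvalue, and the kernel is left out. This matches \<open>band_functions\<close>,
  which counts non-zero eigenvalues only.\<close>

locale eigenbasis = summable_hermitian +
  fixes J :: "'j set" and v :: "'j \<Rightarrow> int \<Rightarrow> complex" and lam :: "'j \<Rightarrow> real"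
  assumes eig: "\<And>j. j \<in> J \<Longrightarrow> eigvec H (complex_of_real (lam j)) (v j)"
    and lam_nz: "\<And>j. j \<in> J \<Longrightarrow> lam j \<noteq> 0"
    and orth: "\<And>i j. i \<in> J \<Longrightarrow> j \<in> J \<Longrightarrow> ip (v i) (v j) = (if i = j then 1 else 0)"
    and compl: "\<And>\<mu> x. \<mu> \<noteq> 0 \<Longrightarrow> eigvec H \<mu> x \<Longrightarrow> (\<forall>j\<in>J. ip x (v j) = 0) \<Longrightarrow> x = (\<lambda>_. 0)"
begin

lemma l2_v: "j \<in> J \<Longrightarrow> l2 (v j)" and app_v: "j \<in> J \<Longrightarrow> app (v j) n = of_real (lam j) * v j n"
  using eig eigvec_iff by auto

lemma v_abs_summable:
  assumes "j \<in> J"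
  shows "(\<lambda>n. cmod (v j n)) summable_on UNIV"
proof -
  have "cmod (v j n) = inverse \<bar>lam j\<bar> * cmod (app (v j) n)" for n
    using lam_nz[OF assms] by (simp add: app_v[OF assms] norm_mult)
  thus ?thesis using app_abs_summable[OF l2_v[OF assms]] by (simp add: summable_on_cmult_right)
qed

text \<open>The finite sum \<open>y\<close> is the projection of the unit vector at \<open>n\<close>
  to the span of the \<open>v j\<close>. Bessel's inequality is the positivity of the squared norm
  of the remainder, which is \<open>1 - s\<close>.\<close>

lemma bessel_finite:
  assumes F: "finite F" "F \<subseteq> J"
  shows "(\<Sum>j\<in>F. (cmod (v j n))\<^sup>2) \<le> 1"
    and "l2 (\<lambda>k. \<Sum>j\<in>F. cnj (v j n) * v j k)"
    and "sqn (\<lambda>k. \<Sum>j\<in>F. cnj (v j n) * v j k) = (\<Sum>j\<in>F. (cmod (v j n))\<^sup>2)"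
proof -
  define y where "y = (\<lambda>k. \<Sum>j\<in>F. cnj (v j n) * v j k)"
  define s where "s = (\<Sum>j\<in>F. (cmod (v j n))\<^sup>2)"
  have lF: "l2 (v j)" if "j \<in> F" for j using that F l2_v by auto
  have yl: "l2 y" unfolding y_def by (rule l2_sum[OF lF])
  have y_lin: "ip y z = (\<Sum>i\<in>F. cnj (v i n) * ip (v i) z)" if "l2 z" for z
    unfolding y_def by (rule ip_sum_left[OF F(1) lF that])
  have yv: "ip y (v j) = cnj (v j n)" if j: "j \<in> F" for j
  proof -
    have "ip y (v j) = (\<Sum>i\<in>F. cnj (v i n) * ip (v i) (v j))"
      by (rule y_lin[OF lF[OF j]])
    also have "\<dots> = (\<Sum>i\<in>F. if i = j then cnj (v j n) else 0)"
      using F j by (intro sum.cong) (auto simp: orth subset_iff)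
    finally show ?thesis using F j by simp
  qed
  have ss: "(\<Sum>j\<in>F. cnj (v j n) * v j n) = of_real s"
    by (simp add: s_def complex_norm_square mult.commute flip: of_real_power)
  have "ip y y = (\<Sum>j\<in>F. cnj (v j n) * ip (v j) y)" by (rule y_lin[OF yl])
  also have "\<dots> = (\<Sum>j\<in>F. cnj (v j n) * v j n)"
    by (intro sum.cong refl) (metis yv ip_cnj complex_cnj_cnj)
  finally have yy: "ip y y = of_real s" using ss by simp
  have yn: "y n = of_real s" using ss by (simp add: y_def)
  define x where "x = (\<lambda>k. unit_vec n k - 1 * y k)"
  have xl: "l2 x" unfolding x_def by (intro l2_diff l2_unit_vec yl)
  have x_lin: "ip x z = ip (unit_vec n) z - ip y z" if "l2 z" for z
    using ip_diff_left[OF l2_unit_vec yl that, of n 1] by (simp add: x_def)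
  have "ip x y = 0" using x_lin[OF yl] by (simp add: ip_unit_vec_left yy yn)
  hence "ip y x = 0" using ip_cnj[of x y] by simp
  moreover have "x n = 1 - of_real s" by (simp add: x_def unit_vec_def yn)
  ultimately have "ip x x = of_real (1 - s)"
    using x_lin[OF xl] by (simp add: ip_unit_vec_left)
  hence "sqn x = 1 - s" unfolding ip_self[OF xl] by (simp only: of_real_eq_iff)
  thus "(\<Sum>j\<in>F. (cmod (v j n))\<^sup>2) \<le> 1" using sqn_nonneg[of x] by (simp add: s_def)
  show "l2 (\<lambda>k. \<Sum>j\<in>F. cnj (v j n) * v j k)" using yl by (simp add: y_def)
  show "sqn (\<lambda>k. \<Sum>j\<in>F. cnj (v j n) * v j k) = (\<Sum>j\<in>F. (cmod (v j n))\<^sup>2)"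
    using yy unfolding ip_self[OF yl] by (simp only: of_real_eq_iff y_def s_def)
qed

lemma bessel_prod_finite:
  assumes F: "finite F" "F \<subseteq> J"
  shows "(\<Sum>j\<in>F. cmod (v j n) * cmod (v j m)) \<le> 1"
proof -
  have "(\<Sum>j\<in>F. cmod (v j n) * cmod (v j m)) \<le> (\<Sum>j\<in>F. ((cmod (v j n))\<^sup>2 + (cmod (v j m))\<^sup>2) / 2)"
  proof (rule sum_mono)
    show "cmod (v j n) * cmod (v j m) \<le> ((cmod (v j n))\<^sup>2 + (cmod (v j m))\<^sup>2) / 2" for j
      using sum_squares_bound[of "cmod (v j n)" "cmod (v j m)"] by (simp add: mult.assoc)
  qed
  also have "\<dots> = ((\<Sum>j\<in>F. (cmod (v j n))\<^sup>2) + (\<Sum>j\<in>F. (cmod (v j m))\<^sup>2)) / 2"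
    by (simp add: sum_divide_distrib[symmetric] sum.distrib)
  also have "\<dots> \<le> 1" using bessel_finite(1)[OF F, of n] bessel_finite(1)[OF F, of m] by simp
  finally show ?thesis .
qed

lemma bessel_prod:
  shows "(\<lambda>j. cmod (v j n) * cmod (v j m)) summable_on J"
    and "(\<Sum>\<^sub>\<infinity>j\<in>J. cmod (v j n) * cmod (v j m)) \<le> 1"
proof -
  show s: "(\<lambda>j. cmod (v j n) * cmod (v j m)) summable_on J"
    by (rule nonneg_bdd_above_summable_on)
       (auto intro!: bdd_aboveI2[of _ _ 1] bessel_prod_finite)
  show "(\<Sum>\<^sub>\<infinity>j\<in>J. cmod (v j n) * cmod (v j m)) \<le> 1"
    by (rule infsum_le_finite_sums[OF s]) (rule bessel_prod_finite)
qed

text \<open>Each eigenvalue is the value of the form at its eigenvector. Summing over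
  \<open>j\<close> inside the double sum first, Bessel's inequality leaves at most the sum of the
  moduli of the entries.\<close>

lemma lam_summable: "(\<lambda>j. \<bar>lam j\<bar>) summable_on J"
proof (rule nonneg_bdd_above_summable_on)
  define C where "C = (\<Sum>\<^sub>\<infinity>(n,m). cmod (H n m))"
  show "bdd_above (sum (\<lambda>j. \<bar>lam j\<bar>) ` {F. F \<subseteq> J \<and> finite F})"
  proof (rule bdd_aboveI2)
    fix F assume "F \<in> {F. F \<subseteq> J \<and> finite F}"
    hence F: "finite F" "F \<subseteq> J" by auto
    let ?f = "\<lambda>j (n,m). norm (H n m * v j m * cnj (v j n))"
    have hs: "(?f j has_sum infsum (?f j) UNIV) UNIV" if "j \<in> F" for j
      using form_abs_summable[of "v j" "v j"] l2_v F that by (intro has_sum_infsum) auto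
    have "(\<Sum>j\<in>F. \<bar>lam j\<bar>) \<le> (\<Sum>j\<in>F. infsum (?f j) UNIV)"
    proof (rule sum_mono)
      fix j assume "j \<in> F"
      hence j: "j \<in> J" using F by auto
      have "complex_of_real (lam j) = ip (\<lambda>n. of_real (lam j) * v j n) (v j)"
        by (simp add: ip_scale_left orth j)
      also have "\<dots> = form (v j) (v j)"
        using form_eq_ip[OF l2_v l2_v, OF j j] app_v[OF j, abs_def] by (simp only:)
      finally have "\<bar>lam j\<bar> = norm (form (v j) (v j))" by (metis norm_of_real real_norm_def)
      also have "\<dots> \<le> (\<Sum>\<^sub>\<infinity>nm. norm (case nm of (n, m) \<Rightarrow> H n m * v j m * cnj (v j n)))"
        unfolding form_def
        by (rule norm_infsum_bound) (use form_abs_summable[OF l2_v l2_v, OF j j] in \<open>simp add: case_prod_unfold\<close>)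
      also have "\<dots> = infsum (?f j) UNIV" by (simp add: case_prod_unfold)
      finally show "\<bar>lam j\<bar> \<le> infsum (?f j) UNIV" .
    qed
    also have "\<dots> \<le> C"
    proof (rule has_sum_mono)
      show "((\<lambda>nm. \<Sum>j\<in>F. ?f j nm) has_sum (\<Sum>j\<in>F. infsum (?f j) UNIV)) UNIV"
        by (rule has_sum_finite_sum[OF F(1) hs])
      show "((\<lambda>(n,m). cmod (H n m)) has_sum C) UNIV"
        using sumH by (simp add: C_def)
      fix nm :: "int \<times> int"
      obtain n m where nm: "nm = (n, m)" by fastforce
      have "(\<Sum>j\<in>F. ?f j nm) = cmod (H n m) * (\<Sum>j\<in>F. cmod (v j m) * cmod (v j n))"
        by (simp add: nm norm_mult sum_distrib_left mult.assoc)
      also have "\<dots> \<le> cmod (H n m) * 1" by (intro mult_left_mono bessel_prod_finite F) auto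
      finally show "(\<Sum>j\<in>F. ?f j nm) \<le> (case nm of (n,m) \<Rightarrow> cmod (H n m))" by (simp add: nm)
    qed
    finally show "(\<Sum>j\<in>F. \<bar>lam j\<bar>) \<le> C" .
  qed
qed auto

text \<open>On the complement of all \<open>v j\<close> the quadratic form vanishes, since otherwise
  it would provide a further eigenvector. Polarising with \<open>y = app r\<close>, which lies in
  the same complement, turns \<open>Re (form r y) = 0\<close> into \<open>sqn y = 0\<close>.\<close>

lemma app_eq_0:
  assumes r: "l2 r" "\<And>j. j \<in> J \<Longrightarrow> ip r (v j) = 0"
  shows "app r n = 0"
proof -
  have q0: "quad x = 0" if x: "l2 x" "\<And>j. j \<in> J \<Longrightarrow> ip x (v j) = 0" for x
  proof (rule ccontr)
    assume q: "quad x \<noteq> 0"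
    have "\<exists>M y. M \<noteq> 0 \<and> eigvec H M y \<and> y \<noteq> (\<lambda>_. 0) \<and> (\<forall>u\<in>v ` J. ip y u = 0)"
    proof (rule nonzero_quad_eigvec[OF _ x(1) _ q])
      fix u assume "u \<in> v ` J"
      then obtain j where j: "j \<in> J" "u = v j" by blast
      show "l2 u \<and> (\<lambda>n. cmod (u n)) summable_on UNIV \<and> (\<exists>c. \<forall>n. app u n = c * u n)"
        using l2_v v_abs_summable app_v j by blast
      show "ip x u = 0" using x(2) j by blast
    qed
    thus False using compl by blast
  qed
  define y where "y = app r"
  have yl: "l2 y" unfolding y_def by (rule l2_app[OF r(1)])
  have yv: "ip y (v j) = 0" if j: "j \<in> J" for j
  proof -
    have "ip y (v j) = ip r (app (v j))" unfolding y_def by (rule ip_app_sym[OF r(1) l2_v[OF j]])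
    also have "app (v j) = (\<lambda>n. of_real (lam j) * v j n)" using app_v[OF j] by auto
    finally show ?thesis using r(2)[OF j] by (simp add: ip_scale_right)
  qed
  have "quad (\<lambda>n. r n + of_real 1 * y n) = 0"
    by (rule q0) (use r yl yv in \<open>auto simp: ip_add_left l2_add l2_v\<close>)
  hence "Re (form r y) = 0"
    unfolding quad_expand[OF r(1) yl] using q0[OF r] q0[OF yl yv] by simp
  hence "sqn y = 0" unfolding form_eq_ip[OF r(1) yl] y_def[symmetric] ip_self[OF yl] by simp
  thus ?thesis using sqn_eq_0D[OF yl] by (simp add: y_def)
qed

lemma proj_summable: "(\<lambda>j. v j n * cnj (v j m)) summable_on J"
  by (rule abs_summable_summable) (use bessel_prod(1)[of n m] in \<open>simp add: norm_mult\<close>)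

text \<open>The matrix of the orthogonal projection to the closed span of the
  \<open>v j\<close>.\<close>

definition proj :: "int \<Rightarrow> int \<Rightarrow> complex" where
  "proj n m = (\<Sum>\<^sub>\<infinity>j\<in>J. v j n * cnj (v j m))"

lemma l2_proj: "l2 (\<lambda>n. proj n m)"
proof -
  have "(\<lambda>n. proj n m) \<in> unit_ball"
    unfolding unit_ball_def
  proof (intro CollectI allI impI)
    fix N :: "int set" assume N: "finite N"
    have "((\<lambda>F. \<Sum>n\<in>N. (cmod (\<Sum>j\<in>F. v j n * cnj (v j m)))\<^sup>2) \<longlongrightarrow> (\<Sum>n\<in>N. (cmod (proj n m))\<^sup>2)) (finite_subsets_at_top J)"
      unfolding proj_def by (intro tendsto_intros infsum_tendsto proj_summable)
    thus "(\<Sum>n\<in>N. (cmod (proj n m))\<^sup>2) \<le> 1"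
    proof (rule tendsto_upperbound)
      show "\<forall>\<^sub>F F in finite_subsets_at_top J. (\<Sum>n\<in>N. (cmod (\<Sum>j\<in>F. v j n * cnj (v j m)))\<^sup>2) \<le> 1"
      proof (rule eventually_finite_subsets_at_top_weakI)
        fix F assume F: "finite F" "F \<subseteq> J"
        have "(\<Sum>n\<in>N. (cmod (\<Sum>j\<in>F. v j n * cnj (v j m)))\<^sup>2) \<le> sqn (\<lambda>k. \<Sum>j\<in>F. cnj (v j m) * v j k)"
          unfolding sqn_def mult.commute[of "cnj _"]
          by (rule finite_sum_le_infsum)
             (use bessel_finite(2)[OF F, of m] N in \<open>auto simp: l2_def mult.commute\<close>)
        also have "\<dots> \<le> 1" unfolding bessel_finite(3)[OF F] by (rule bessel_finite(1)[OF F])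
        finally show "(\<Sum>n\<in>N. (cmod (\<Sum>j\<in>F. v j n * cnj (v j m)))\<^sup>2) \<le> 1" .
      qed
    qed auto
  qed
  thus ?thesis by (simp add: unit_ball_iff)
qed

lemma infsum_mult_proj:
  assumes "(\<lambda>n. cmod (f n)) summable_on UNIV"
  shows "(\<Sum>\<^sub>\<infinity>n. f n * proj n m) = (\<Sum>\<^sub>\<infinity>j\<in>J. (\<Sum>\<^sub>\<infinity>n. f n * v j n) * cnj (v j m))"
proof -
  have s: "(\<lambda>x. norm (case x of (n,j) \<Rightarrow> f n * (v j n * cnj (v j m)))) summable_on (UNIV \<times> J)"
  proof (subst Infinite_Sum.abs_summable_on_Sigma_iff, intro conjI ballI)
    show "(\<lambda>j. norm (case (n, j) of (n, j) \<Rightarrow> f n * (v j n * cnj (v j m)))) summable_on J" for n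
      using summable_on_cmult_right[OF bessel_prod(1)[of n m], of "cmod (f n)"] by (simp add: norm_mult)
    show "(\<lambda>n. norm (\<Sum>\<^sub>\<infinity>j\<in>J. norm (case (n, j) of (n, j) \<Rightarrow> f n * (v j n * cnj (v j m))))) summable_on UNIV"
    proof (rule Infinite_Sum.abs_summable_on_comparison_test'[OF assms])
      fix n
      have "(\<Sum>\<^sub>\<infinity>j\<in>J. norm (case (n, j) of (n, j) \<Rightarrow> f n * (v j n * cnj (v j m)))) =
            cmod (f n) * (\<Sum>\<^sub>\<infinity>j\<in>J. cmod (v j n) * cmod (v j m))"
        by (simp add: norm_mult infsum_cmult_right')
      also have "\<dots> \<le> cmod (f n) * 1" by (intro mult_left_mono bessel_prod) auto
      finally show "norm (\<Sum>\<^sub>\<infinity>j\<in>J. norm (case (n, j) of (n, j) \<Rightarrow> f n * (v j n * cnj (v j m)))) \<le> cmod (f n)"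
        by (simp add: infsum_nonneg)
    qed
  qed
  have "(\<lambda>(n,j). f n * (v j n * cnj (v j m))) summable_on (UNIV \<times> J)"
    by (rule abs_summable_summable[OF s])
  from infsum_swap_banach[OF this]
  have "(\<Sum>\<^sub>\<infinity>n. f n * proj n m) = (\<Sum>\<^sub>\<infinity>j\<in>J. \<Sum>\<^sub>\<infinity>n. f n * (v j n * cnj (v j m)))"
    by (simp add: proj_def infsum_cmult_right')
  thus ?thesis by (simp add: mult.assoc[symmetric] infsum_cmult_left')
qed

text \<open>The unit vector at \<open>m\<close> minus its projection is orthogonal to all
  \<open>v j\<close>, so the matrix annihilates it. Column \<open>m\<close> is thus the matrix
  applied to the projection, which acts on each \<open>v j\<close> by its eigenvalue.\<close>

theorem spectral_decomposition:
  "H n m = (\<Sum>\<^sub>\<infinity>j\<in>J. of_real (lam j) * v j n * cnj (v j m))"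
proof -
  define r where "r = (\<lambda>k. unit_vec m k - 1 * proj k m)"
  have rl: "l2 r" unfolding r_def by (intro l2_diff l2_unit_vec l2_proj)
  have "app r n = 0"
  proof (rule app_eq_0[OF rl])
    fix i assume i: "i \<in> J"
    have "ip (\<lambda>k. proj k m) (v i) = (\<Sum>\<^sub>\<infinity>k. cnj (v i k) * proj k m)"
      by (simp add: ip_def mult.commute)
    also have "\<dots> = (\<Sum>\<^sub>\<infinity>j\<in>J. (\<Sum>\<^sub>\<infinity>k. cnj (v i k) * v j k) * cnj (v j m))"
      by (rule infsum_mult_proj) (use v_abs_summable[OF i] in simp)
    also have "\<dots> = (\<Sum>\<^sub>\<infinity>j\<in>J. if j = i then cnj (v i m) else 0)"
      by (rule infsum_cong) (use orth[OF _ i] in \<open>auto simp: ip_def mult.commute\<close>)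
    also have "\<dots> = cnj (v i m)"
      by (rule infsumI, rule has_sum_finite_neutralI[of "{i}"]) (use i in auto)
    finally show "ip r (v i) = 0"
      unfolding r_def using ip_diff_left[OF l2_unit_vec l2_proj l2_v[OF i], of m 1 m]
      by (simp add: ip_unit_vec_left)
  qed
  moreover have "app r n = app (unit_vec m) n - 1 * app (\<lambda>k. proj k m) n"
    unfolding r_def by (rule app_diff[OF l2_unit_vec l2_proj])
  moreover have "app (unit_vec m) n = H n m"
    unfolding app_def using infsumI[OF unit_vec_has_sum[of m "H n"]] by (simp add: mult.commute)
  moreover have "app (\<lambda>k. proj k m) n = (\<Sum>\<^sub>\<infinity>j\<in>J. (\<Sum>\<^sub>\<infinity>k. H n k * v j k) * cnj (v j m))"
    unfolding app_def by (rule infsum_mult_proj[OF row_summable(2)[OF l2_0]])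
  moreover have "\<dots> = (\<Sum>\<^sub>\<infinity>j\<in>J. of_real (lam j) * v j n * cnj (v j m))"
    by (rule infsum_cong) (simp add: app_def[symmetric] app_v)
  ultimately show ?thesis by simp
qed

end

section \<open>Orthonormal eigenvectors with prescribed multiplicities\<close>

context summable_hermitian
begin

lemma eigvec_add_scale:
  assumes "eigvec H \<mu> x" "eigvec H \<mu> y"
  shows "eigvec H \<mu> (\<lambda>n. x n - c * y n)"
  using assms unfolding eigvec_iff by (auto intro!: l2_diff simp: app_diff algebra_simps)

lemma eigvec_scale: "eigvec H \<mu> x \<Longrightarrow> eigvec H \<mu> (\<lambda>n. c * x n)"
  unfolding eigvec_iff by (auto intro!: l2_scale simp: app_scale)

lemma eigvec_diff_sum:
  fixes d :: nat
  assumes "eigvec H \<mu> x" "\<And>i. i < d \<Longrightarrow> eigvec H \<mu> (u i)"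
  shows "eigvec H \<mu> (\<lambda>n. x n - (\<Sum>i<d. c i * u i n))"
  using assms(2)
proof (induction d)
  case (Suc d)
  hence "eigvec H \<mu> (\<lambda>n. (x n - (\<Sum>i<d. c i * u i n)) - c d * u d n)"
    by (intro eigvec_add_scale) auto
  thus ?case by (simp add: algebra_simps)
qed (use assms(1) in simp)

text \<open>The clause on linear combinations serves the induction: it turns a vanishing new vector
  \<open>w\<close> into a linear relation among the \<open>vs\<close> with coefficient 1 at
  \<open>d\<close>, which independence forbids.\<close>

lemma gram_schmidt:
  assumes "\<forall>i<d. eigvec H \<mu> (vs i)" "lin_indep vs d"
  shows "\<exists>us. (\<forall>i<d. eigvec H \<mu> (us i) \<and> (\<exists>a. \<forall>n. us i n = (\<Sum>k<d. a k * vs k n))) \<and>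
              (\<forall>i<d. \<forall>j<d. ip (us i) (us j) = (if i = j then 1 else 0))"
  using assms
proof (induction d)
  case (Suc d)
  have "lin_indep vs d"
    unfolding lin_indep_def
  proof (intro allI impI)
    fix c :: "nat \<Rightarrow> complex" and i assume c: "\<forall>n. (\<Sum>i<d. c i * vs i n) = 0" and i: "i < d"
    have "\<forall>n. (\<Sum>i<Suc d. (c(d := 0)) i * vs i n) = 0" using c by simp
    hence "(c(d := 0)) i = 0"
      using Suc.prems(2) i unfolding lin_indep_def by (metis less_SucI)
    thus "c i = 0" using i by simp
  qed
  moreover have "\<forall>i<d. eigvec H \<mu> (vs i)" using Suc.prems(1) by simp
  ultimately obtain us where
     us0: "\<forall>i<d. eigvec H \<mu> (us i) \<and> (\<exists>a. \<forall>n. us i n = (\<Sum>k<d. a k * vs k n))" and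
     us3: "\<And>i j. i < d \<Longrightarrow> j < d \<Longrightarrow> ip (us i) (us j) = (if i = j then 1 else 0)"
    using Suc.IH by blast
  have us: "\<And>i. i < d \<Longrightarrow> eigvec H \<mu> (us i)"
     "\<And>i. i < d \<Longrightarrow> \<exists>a. \<forall>n. us i n = (\<Sum>k<d. a k * vs k n)"
     "\<And>i j. i < d \<Longrightarrow> j < d \<Longrightarrow> ip (us i) (us j) = (if i = j then 1 else 0)"
    using us0 us3 by blast+
  obtain a where a: "\<And>i n. i < d \<Longrightarrow> us i n = (\<Sum>k<d. a i k * vs k n)" using us(2) by metis
  define b where "b = (\<lambda>i. ip (vs d) (us i))"
  define w where "w = (\<lambda>n. vs d n - (\<Sum>i<d. b i * us i n))"
  have ew: "eigvec H \<mu> w" unfolding w_def by (rule eigvec_diff_sum) (use Suc.prems us in auto)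
  have lw: "l2 w" and lu: "\<And>i. i < d \<Longrightarrow> l2 (us i)" and lv: "l2 (vs d)"
    using ew us(1) Suc.prems(1) by (auto simp: eigvec_iff)
  define c where "c = (\<lambda>k. if k = d then 1 else - (\<Sum>i<d. b i * a i k))"
  have wc: "w n = (\<Sum>k<Suc d. c k * vs k n)" for n
  proof -
    have "(\<Sum>i<d. b i * us i n) = (\<Sum>i<d. \<Sum>k<d. b i * a i k * vs k n)"
      by (simp add: a sum_distrib_left mult.assoc)
    also have "\<dots> = (\<Sum>k<d. (\<Sum>i<d. b i * a i k) * vs k n)"
      by (subst sum.swap) (simp add: sum_distrib_right)
    finally show ?thesis by (simp add: w_def c_def sum_negf)
  qed
  have wu: "ip w (us j) = 0" if j: "j < d" for j
  proof -
    have "ip w (us j) = ip (vs d) (us j) - 1 * ip (\<lambda>n. \<Sum>i<d. b i * us i n) (us j)"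
      using ip_diff_left[OF lv l2_sum[of "{..<d}" us b] lu[OF j], of 1] lu by (simp add: w_def)
    also have "ip (\<lambda>n. \<Sum>i<d. b i * us i n) (us j) = (\<Sum>i<d. b i * ip (us i) (us j))"
      using lu j by (intro ip_sum_left) auto
    also have "\<dots> = (\<Sum>i<d. if i = j then b j else 0)" using us(3) j by (intro sum.cong) auto
    finally show ?thesis using j by (simp add: b_def)
  qed
  have "sqn w > 0"
  proof (rule ccontr)
    assume "\<not> sqn w > 0"
    hence "w n = 0" for n using sqn_eq_0D[OF lw] by simp
    hence "\<forall>n. (\<Sum>k<Suc d. c k * vs k n) = 0" using wc by simp
    hence "c d = 0" using Suc.prems(2) unfolding lin_indep_def by blast
    thus False by (simp add: c_def)
  qed
  define q where "q = complex_of_real (1 / sqrt (sqn w))"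
  define us' where "us' = us(d := (\<lambda>n. q * w n))"
  have qq: "q * cnj q * of_real (sqn w) = 1"
    using \<open>sqn w > 0\<close> by (simp add: q_def flip: of_real_mult)
  have "eigvec H \<mu> (us' i) \<and> (\<exists>a. \<forall>n. us' i n = (\<Sum>k<Suc d. a k * vs k n))" if i: "i < Suc d" for i
  proof (cases "i = d")
    case True
    have F: "us' d n = (\<Sum>k<Suc d. (q * c k) * vs k n)" for n
      by (simp only: us'_def fun_upd_same wc sum_distrib_left mult.assoc)
    have "\<exists>a. \<forall>n. us' d n = (\<Sum>k<Suc d. a k * vs k n)"
      by (rule exI[of _ "\<lambda>k. q * c k"], rule allI, rule F)
    moreover have "eigvec H \<mu> (us' d)" unfolding us'_def using eigvec_scale[OF ew, of q] by simp
    ultimately show ?thesis using True by blast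
  next
    case False
    hence id: "i < d" using i by simp
    have F: "us' i n = (\<Sum>k<Suc d. (if k < d then a i k else 0) * vs k n)" for n
      using a[OF id] False by (simp add: us'_def)
    have "\<exists>a. \<forall>n. us' i n = (\<Sum>k<Suc d. a k * vs k n)"
      by (rule exI[of _ "\<lambda>k. if k < d then a i k else 0"], rule allI, rule F)
    moreover have "eigvec H \<mu> (us' i)" using us(1)[OF id] False by (simp add: us'_def)
    ultimately show ?thesis by blast
  qed
  moreover have "ip (us' i) (us' j) = (if i = j then 1 else 0)" if i: "i < Suc d" and j: "j < Suc d" for i j
  proof -
    have uw: "ip (us i) w = 0" if "i < d" for i using wu[OF that] ip_cnj[of w "us i"] by simp
    have "ip (\<lambda>n. q * w n) (\<lambda>n. q * w n) = 1"
      using qq by (simp add: ip_scale_left ip_scale_right ip_self[OF lw] mult.assoc)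
    thus ?thesis using i j us(3)[of i j] wu uw
      by (auto simp: us'_def ip_scale_left ip_scale_right less_Suc_eq)
  qed
  ultimately show ?case by blast
qed auto

lemma orthogonal_lin_indep:
  assumes l: "\<And>i. i < d \<Longrightarrow> l2 (u i)" and nz: "\<And>i. i < d \<Longrightarrow> ip (u i) (u i) \<noteq> 0"
    and o: "\<And>i j. i < d \<Longrightarrow> j < d \<Longrightarrow> i \<noteq> j \<Longrightarrow> ip (u i) (u j) = 0"
  shows "lin_indep u d"
  unfolding lin_indep_def
proof (intro allI impI)
  fix c :: "nat \<Rightarrow> complex" and j assume c: "\<forall>n. (\<Sum>i<d. c i * u i n) = 0" and j: "j < d"
  have "0 = ip (\<lambda>n. \<Sum>i<d. c i * u i n) (u j)" using c by (simp add: ip_zero_left)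
  also have "\<dots> = (\<Sum>i<d. c i * ip (u i) (u j))" using l j by (intro ip_sum_left) auto
  also have "\<dots> = (\<Sum>i<d. if i = j then c j * ip (u j) (u j) else 0)"
    using o j by (intro sum.cong) auto
  finally show "c j = 0" using j nz[OF j] by simp
qed

text \<open>A non-zero eigenvector orthogonal to all \<open>us i\<close> would give
  \<open>d + 1\<close> independent eigenvectors, against the maximality in
  \<open>eig_mult\<close>.\<close>

lemma orthonormal_eigvecs:
  assumes "eig_mult H \<mu> d"
  shows "\<exists>us. (\<forall>i<d. eigvec H \<mu> (us i)) \<and> (\<forall>i<d. \<forall>j<d. ip (us i) (us j) = (if i = j then 1 else 0)) \<and>
           (\<forall>x. eigvec H \<mu> x \<longrightarrow> (\<forall>i<d. ip x (us i) = 0) \<longrightarrow> x = (\<lambda>_. 0))"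
proof -
  obtain vs where vs: "\<forall>i<d. eigvec H \<mu> (vs i)" "lin_indep vs d"
    using assms unfolding eig_mult_def by blast
  obtain us where us0: "\<forall>i<d. eigvec H \<mu> (us i) \<and> (\<exists>a. \<forall>n. us i n = (\<Sum>k<d. a k * vs k n))"
     "\<forall>i<d. \<forall>j<d. ip (us i) (us j) = (if i = j then 1 else 0)"
    using gram_schmidt[OF vs] by blast
  have us: "\<And>i. i < d \<Longrightarrow> eigvec H \<mu> (us i)"
     "\<And>i j. i < d \<Longrightarrow> j < d \<Longrightarrow> ip (us i) (us j) = (if i = j then 1 else 0)"
    using us0 by blast+
  have "x = (\<lambda>_. 0)" if x: "eigvec H \<mu> x" "\<forall>i<d. ip x (us i) = 0" for x
  proof (rule ccontr)
    assume nx: "x \<noteq> (\<lambda>_. 0)"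
    have lx: "l2 x" using x by (simp add: eigvec_iff)
    have "ip x x \<noteq> 0"
    proof
      assume "ip x x = 0"
      hence "sqn x = 0" using ip_self[OF lx] by simp
      thus False using nx sqn_eq_0D[OF lx] by auto
    qed
    moreover have "ip (us i) x = 0" if "i < d" for i using x(2) that ip_cnj[of x "us i"] by simp
    moreover have "l2 (us i)" if "i < d" for i using us(1)[OF that] by (simp add: eigvec_iff)
    ultimately have "lin_indep (us(d := x)) (Suc d)"
      using lx x(2) us(2) by (intro orthogonal_lin_indep) (auto simp: less_Suc_eq)
    moreover have "\<forall>i<Suc d. eigvec H \<mu> ((us(d := x)) i)" using us(1) x(1) by (auto simp: less_Suc_eq)
    ultimately show False using assms unfolding eig_mult_def by blast
  qed
  thus ?thesis using us by blast
qed

text \<open>The labels sharing a value \<mu> are as many as the orthonormal vectors for \<mu>, and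
  the bijection \<open>f\<close> \<mu> matches them. Vectors for different values are orthogonal
  because the matrix is hermitian and the values are real.\<close>

lemma ex_eigenbasis:
  fixes J :: "'j set" and lam :: "'j \<Rightarrow> real"
  assumes nz: "\<And>j. j \<in> J \<Longrightarrow> lam j \<noteq> 0"
    and mult: "\<And>\<mu>::complex. \<mu> \<noteq> 0 \<Longrightarrow> finite {j\<in>J. complex_of_real (lam j) = \<mu>} \<and>
             eig_mult H \<mu> (card {j\<in>J. complex_of_real (lam j) = \<mu>})"
  shows "\<exists>v. eigenbasis H J v lam"
proof -
  define d where "d = (\<lambda>\<mu>. card {j\<in>J. complex_of_real (lam j) = \<mu>})"
  define G where "G = (\<lambda>\<mu> us. (\<forall>i<d \<mu>. eigvec H \<mu> (us i)) \<and>
     (\<forall>i<d \<mu>. \<forall>j<d \<mu>. ip (us i) (us j) = (if i = j then 1 else 0)) \<and>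
     (\<forall>x. eigvec H \<mu> x \<longrightarrow> (\<forall>i<d \<mu>. ip x (us i) = 0) \<longrightarrow> x = (\<lambda>_. 0)))"
  have "\<exists>us. G \<mu> us" if "\<mu> \<noteq> 0" for \<mu>
    using orthonormal_eigvecs[of \<mu> "d \<mu>"] mult[OF that] unfolding d_def G_def by blast
  then obtain us where us0: "\<And>\<mu>. \<mu> \<noteq> 0 \<Longrightarrow> G \<mu> (us \<mu>)" by metis
  have us: "\<And>\<mu> i. \<mu> \<noteq> 0 \<Longrightarrow> i < d \<mu> \<Longrightarrow> eigvec H \<mu> (us \<mu> i)"
    "\<And>\<mu> i j. \<mu> \<noteq> 0 \<Longrightarrow> i < d \<mu> \<Longrightarrow> j < d \<mu> \<Longrightarrow> ip (us \<mu> i) (us \<mu> j) = (if i = j then 1 else 0)"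
    "\<And>\<mu> x. \<mu> \<noteq> 0 \<Longrightarrow> eigvec H \<mu> x \<Longrightarrow> (\<forall>i<d \<mu>. ip x (us \<mu> i) = 0) \<Longrightarrow> x = (\<lambda>_. 0)"
    using us0 unfolding G_def by blast+
  have "\<exists>f. bij_betw f {j\<in>J. complex_of_real (lam j) = \<mu>} {..<d \<mu>}" if "\<mu> \<noteq> 0" for \<mu>
    unfolding d_def by (rule finite_same_card_bij) (use mult[OF that] in auto)
  then obtain f where f: "\<And>\<mu>. \<mu> \<noteq> 0 \<Longrightarrow> bij_betw (f \<mu>) {j\<in>J. complex_of_real (lam j) = \<mu>} {..<d \<mu>}"
    by metis
  define l where "l = (\<lambda>j. complex_of_real (lam j))"
  have lnz: "l j \<noteq> 0" if "j \<in> J" for j using nz[OF that] by (simp add: l_def)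
  define v where "v = (\<lambda>j. us (l j) (f (l j) j))"
  have fl: "f (l j) j < d (l j)" if "j \<in> J" for j
    using bij_betwE[OF f[OF lnz[OF that]]] that by (auto simp: l_def)
  have eig: "eigvec H (l j) (v j)" if "j \<in> J" for j
    unfolding v_def using us(1)[OF lnz fl, OF that that] .
  have "eigenbasis H J v lam"
  proof
    show "eigvec H (complex_of_real (lam j)) (v j)" if "j \<in> J" for j using eig[OF that] by (simp add: l_def)
    show "lam j \<noteq> 0" if "j \<in> J" for j by (rule nz[OF that])
    show "ip (v i) (v j) = (if i = j then 1 else 0)" if i: "i \<in> J" and j: "j \<in> J" for i j
    proof (cases "l i = l j")
      case True
      have "f (l j) i = f (l j) j \<longleftrightarrow> i = j"
        using bij_betw_imp_inj_on[OF f[OF lnz[OF j]]] i j True by (auto simp: inj_on_def l_def)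
      thus ?thesis unfolding v_def True using us(2)[OF lnz[OF j], of "f (l j) i" "f (l j) j"] fl[OF i] fl[OF j] True
        by simp
    next
      case False
      have li: "l2 (v i)" "app (v i) = (\<lambda>n. l i * v i n)" and lj: "l2 (v j)" "app (v j) = (\<lambda>n. l j * v j n)"
        using eig[OF i] eig[OF j] by (auto simp: eigvec_iff)
      have "l i * ip (v i) (v j) = cnj (l j) * ip (v i) (v j)"
        using ip_app_sym[OF li(1) lj(1)] unfolding li(2) lj(2) ip_scale_left ip_scale_right .
      hence "l i * ip (v i) (v j) = l j * ip (v i) (v j)" by (simp add: l_def)
      thus ?thesis using False by auto
    qed
    show "x = (\<lambda>_. 0)" if \<mu>: "\<mu> \<noteq> 0" and x: "eigvec H \<mu> x" "\<forall>j\<in>J. ip x (v j) = 0" for \<mu> x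
    proof (rule us(3)[OF \<mu> x(1)], intro allI impI)
      fix i assume "i < d \<mu>"
      hence "i \<in> f \<mu> ` {j\<in>J. complex_of_real (lam j) = \<mu>}"
        using bij_betw_imp_surj_on[OF f[OF \<mu>]] by simp
      then obtain j where j: "j \<in> J" "l j = \<mu>" "f \<mu> j = i" unfolding l_def by blast
      thus "ip x (us \<mu> i) = 0" using x(2) by (auto simp: v_def)
    qed
  qed
  thus ?thesis by blast
qed

end

section \<open>The Fredholm determinant as a product over eigenvalues\<close>

lemma abs_summable_prod_PiE:
  fixes f :: "'a \<Rightarrow> 'b \<Rightarrow> complex"
  assumes "finite A" "countable B" "\<And>x. x \<in> A \<Longrightarrow> (\<lambda>y. norm (f x y)) summable_on B"
  shows "(\<lambda>g. norm (\<Prod>x\<in>A. f x (g x))) summable_on (A \<rightarrow>\<^sub>E B)"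
proof -
  have "Infinite_Set_Sum.abs_summable_on (\<lambda>g. \<Prod>x\<in>A. f x (g x)) (A \<rightarrow>\<^sub>E B)"
    by (rule abs_summable_on_prod_PiE)
       (use assms in \<open>auto intro!: abs_summable_equivalent[THEN iffD1]\<close>)
  thus ?thesis by (rule abs_summable_equivalent[THEN iffD2])
qed

text \<open>A set of size \<open>k\<close> is the image of exactly \<open>fact k\<close> injective
  functions from \<open>{..<k}\<close>.\<close>

lemma infsum_injective_functions:
  fixes f :: "'a set \<Rightarrow> complex"
  assumes f: "(\<lambda>I. norm (f I)) summable_on {I \<in> Fpow X. card I = k}"
  shows "(\<Sum>\<^sub>\<infinity>g\<in>{g \<in> {..<k} \<rightarrow>\<^sub>E X. inj_on g {..<k}}. f (g ` {..<k})) = fact k * (\<Sum>\<^sub>\<infinity>I\<in>{I \<in> Fpow X. card I = k}. f I)"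
proof -
  let ?K = "{..<k}" and ?S = "{I \<in> Fpow X. card I = k}"
  define B where "B = (\<lambda>I::'a set. {g \<in> ?K \<rightarrow>\<^sub>E I. inj_on g ?K})"
  have img: "g ` ?K = I" if "I \<in> ?S" "g \<in> B I" for g I
    using that by (intro card_subset_eq) (auto simp: B_def Fpow_def card_image)
  have finB: "finite (B I)" "card (B I) = fact k" if I: "I \<in> ?S" for I
  proof -
    have fin: "finite I" "card I = k" using I by (auto simp: Fpow_def)
    have "finite (?K \<rightarrow>\<^sub>E I)" using fin by (intro finite_PiE) auto
    thus "finite (B I)" by (rule finite_subset[rotated]) (auto simp: B_def)
    have "card (B I) = card I ^ (card ?K - card ?K) * prod ((-) (card I)) {0..<card ?K}"
      unfolding B_def by (rule card_inj_on_subset_funcset) (use fin in auto)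
    also have "\<dots> = fact k" using fin by (simp add: fact_prod_rev)
    finally show "card (B I) = fact k" .
  qed
  have bij: "bij_betw snd (Sigma ?S B) {g \<in> ?K \<rightarrow>\<^sub>E X. inj_on g ?K}"
  proof (rule bij_betw_byWitness[where f' = "\<lambda>g. (g ` ?K, g)"])
    show "\<forall>a\<in>Sigma ?S B. (snd a ` ?K, snd a) = a" using img by auto
    show "snd ` Sigma ?S B \<subseteq> {g \<in> ?K \<rightarrow>\<^sub>E X. inj_on g ?K}"
    proof
      fix g assume "g \<in> snd ` Sigma ?S B"
      then obtain I where "I \<in> ?S" "g \<in> B I" by auto
      thus "g \<in> {g \<in> ?K \<rightarrow>\<^sub>E X. inj_on g ?K}" by (auto simp: B_def Fpow_def PiE_iff)
    qed
    show "(\<lambda>g. (g ` ?K, g)) ` {g \<in> ?K \<rightarrow>\<^sub>E X. inj_on g ?K} \<subseteq> Sigma ?S B"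
      by (auto simp: B_def Fpow_def card_image PiE_iff)
  qed auto
  have sm: "(\<lambda>(I,g). f I) summable_on Sigma ?S B"
  proof -
    have "(\<lambda>(I,g). norm (f I)) summable_on Sigma ?S B"
    proof (rule summable_on_SigmaI)
      show "((\<lambda>g. case (I, g) of (I, g) \<Rightarrow> norm (f I)) has_sum (fact k * norm (f I))) (B I)" if "I \<in> ?S" for I
        using finB[OF that] by (intro has_sum_finiteI) auto
      show "(\<lambda>I. fact k * norm (f I)) summable_on ?S" by (intro summable_on_cmult_right f)
    qed auto
    thus ?thesis by (intro abs_summable_summable[of "\<lambda>(I,g). f I"]) (simp add: case_prod_unfold)
  qed
  have "(\<Sum>\<^sub>\<infinity>g\<in>{g \<in> ?K \<rightarrow>\<^sub>E X. inj_on g ?K}. f (g ` ?K)) = (\<Sum>\<^sub>\<infinity>x\<in>Sigma ?S B. f (snd x ` ?K))"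
    by (rule infsum_reindex_bij_betw[OF bij, symmetric])
  also have "\<dots> = (\<Sum>\<^sub>\<infinity>(I,g)\<in>Sigma ?S B. f I)"
    by (rule infsum_cong) (use img in auto)
  also have "\<dots> = (\<Sum>\<^sub>\<infinity>I\<in>?S. \<Sum>\<^sub>\<infinity>g\<in>B I. f I)"
    by (rule infsum_Sigma'_banach[OF sm, symmetric])
  also have "\<dots> = (\<Sum>\<^sub>\<infinity>I\<in>?S. fact k * f I)"
    by (rule infsum_cong) (use finB in auto)
  finally show ?thesis by (simp add: infsum_cmult_right')
qed

text \<open>Non-injective functions contribute zero, so they may be added freely. Over all
  functions, and unlike over sets, an infinite sum of products factors into a product of infinite
  sums.\<close>

lemma infsum_pdet_functions:
  fixes A :: "'a \<Rightarrow> 'a \<Rightarrow> complex"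
  assumes s: "(\<lambda>I. norm (pdet A I)) summable_on {I \<in> Fpow X. card I = k}"
  shows "(\<Sum>\<^sub>\<infinity>g\<in>{..<k} \<rightarrow>\<^sub>E X. pdet (\<lambda>a b. A (g a) (g b)) {..<k}) = fact k * (\<Sum>\<^sub>\<infinity>I\<in>{I \<in> Fpow X. card I = k}. pdet A I)"
proof -
  have "(\<Sum>\<^sub>\<infinity>g\<in>{..<k} \<rightarrow>\<^sub>E X. pdet (\<lambda>a b. A (g a) (g b)) {..<k}) =
     (\<Sum>\<^sub>\<infinity>g\<in>{g \<in> {..<k} \<rightarrow>\<^sub>E X. inj_on g {..<k}}. pdet A (g ` {..<k}))"
  proof (rule infsum_cong_neutral)
    fix g assume "g \<in> ({..<k} \<rightarrow>\<^sub>E X) - {g \<in> {..<k} \<rightarrow>\<^sub>E X. inj_on g {..<k}}"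
    hence "\<not> inj_on g {..<k}" by auto
    then obtain a b where "a \<in> {..<k}" "b \<in> {..<k}" "a \<noteq> b" "g a = g b" by (auto simp: inj_on_def)
    thus "pdet (\<lambda>a b. A (g a) (g b)) {..<k} = 0"
      by (intro pdet_eq_0_repeated[where A = "\<lambda>i. A (g i)" and g = g and a = a and b = b]) auto
  qed (auto simp: pdet_reindex)
  also have "\<dots> = fact k * (\<Sum>\<^sub>\<infinity>I\<in>{I \<in> Fpow X. card I = k}. pdet A I)"
    by (rule infsum_injective_functions[OF s])
  finally show ?thesis .
qed

lemma infsum_Fpow_by_card:
  fixes f :: "'a set \<Rightarrow> complex"
  assumes "f summable_on Fpow X"
  shows "(\<Sum>\<^sub>\<infinity>I\<in>Fpow X. f I) = (\<Sum>\<^sub>\<infinity>k. \<Sum>\<^sub>\<infinity>I\<in>{I \<in> Fpow X. card I = k}. f I)"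
proof -
  have bij: "bij_betw snd (SIGMA k:UNIV. {I \<in> Fpow X. card I = k}) (Fpow X)"
    by (rule bij_betw_byWitness[where f' = "\<lambda>I. (card I, I)"]) auto
  have "(\<lambda>x. f (snd x)) summable_on (SIGMA k:UNIV. {I \<in> Fpow X. card I = k})"
    using assms summable_on_reindex_bij_betw[OF bij, of f] by simp
  hence "(\<lambda>(k,I). f I) summable_on (SIGMA k:UNIV. {I \<in> Fpow X. card I = k})"
    by (simp add: case_prod_unfold)
  from infsum_Sigma'_banach[OF this] show ?thesis
    using infsum_reindex_bij_betw[OF bij, of f] by (simp add: case_prod_unfold)
qed

lemma pdet_summable:
  fixes A :: "'a \<Rightarrow> 'a \<Rightarrow> complex"
  assumes row: "\<And>i. i \<in> X \<Longrightarrow> (\<lambda>j. norm (A i j)) summable_on X"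
    and tot: "(\<lambda>i. \<Sum>\<^sub>\<infinity>j\<in>X. norm (A i j)) summable_on X"
  shows "(\<lambda>I. norm (z ^ card I * pdet A I)) summable_on Fpow X"
proof -
  let ?r = "\<lambda>i. \<Sum>\<^sub>\<infinity>j\<in>X. norm (A i j)"
  have b: "norm (pdet A I) \<le> (\<Prod>i\<in>I. ?r i)" if "I \<in> Fpow X" for I
  proof (rule norm_pdet_le)
    show "(\<Sum>j\<in>I. norm (A i j)) \<le> ?r i" if "i \<in> I" for i
      using that \<open>I \<in> Fpow X\<close> by (intro finite_sum_le_infsum row) (auto simp: Fpow_def)
  qed (use that in \<open>auto simp: Fpow_def\<close>)
  have "(\<lambda>I. \<Prod>i\<in>I. norm z * ?r i) summable_on Fpow X"
    by (intro summable_prod_Fpow summable_on_cmult_right tot mult_nonneg_nonneg infsum_nonneg) auto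
  thus ?thesis
  proof (rule Infinite_Sum.abs_summable_on_comparison_test')
    fix I assume I: "I \<in> Fpow X"
    have "norm (z ^ card I * pdet A I) \<le> norm z ^ card I * (\<Prod>i\<in>I. ?r i)"
      using b[OF I] by (simp add: norm_mult norm_power mult_left_mono)
    thus "norm (z ^ card I * pdet A I) \<le> (\<Prod>i\<in>I. norm z * ?r i)"
      by (simp add: prod.distrib)
  qed
qed

context eigenbasis
begin

lemma column_bound:
  assumes "i \<in> J" "j \<in> J"
  shows "(\<lambda>n. cmod (v i n) * cmod (v j n)) summable_on UNIV"
    and "(\<Sum>\<^sub>\<infinity>n. cmod (v i n) * cmod (v j n)) \<le> 1"
proof -
  have one: "((\<lambda>n. (cmod (v i n))\<^sup>2) has_sum 1) UNIV" if i: "i \<in> J" for i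
  proof -
    have "sqn (v i) = 1" using ip_self[OF l2_v[OF i]] orth[OF i i] by simp
    thus ?thesis using l2_v[OF i] by (simp add: sqn_def l2_def has_sum_iff)
  qed
  have h: "((\<lambda>n. (1/2) * ((cmod (v i n))\<^sup>2 + (cmod (v j n))\<^sup>2)) has_sum (1/2) * (1 + 1)) UNIV"
    by (intro has_sum_cmult_right has_sum_add one assms)
  have le: "cmod (v i n) * cmod (v j n) \<le> (1/2) * ((cmod (v i n))\<^sup>2 + (cmod (v j n))\<^sup>2)" for n
    using sum_squares_bound[of "cmod (v i n)" "cmod (v j n)"] by (simp add: mult.assoc)
  show s: "(\<lambda>n. cmod (v i n) * cmod (v j n)) summable_on UNIV"
    by (rule summable_on_comparison_test[OF has_sum_imp_summable[OF h] le]) auto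
  have "(\<Sum>\<^sub>\<infinity>n. cmod (v i n) * cmod (v j n)) \<le> (1/2) * (1 + 1)"
    by (rule has_sum_mono[OF has_sum_infsum[OF s] h le])
  thus "(\<Sum>\<^sub>\<infinity>n. cmod (v i n) * cmod (v j n)) \<le> 1" by simp
qed

text \<open>Both sides expand into the same double series over \<open>g\<close> and \<open>h\<close>: summing first over \<open>h\<close> gives the
  entries of \<open>H\<close> by the spectral decomposition, summing first over \<open>g\<close> uses orthonormality.\<close>

lemma permutation_term_swap:
  fixes k :: nat
  assumes p: "\<pi> permutes {..<k}" and cnt: "countable J"
  shows "(\<Sum>\<^sub>\<infinity>g\<in>{..<k} \<rightarrow>\<^sub>E UNIV. \<Prod>a<k. H (g a) (g (\<pi> a))) =
         (\<Sum>\<^sub>\<infinity>h\<in>{..<k} \<rightarrow>\<^sub>E J. \<Prod>a<k. if h a = h (inv \<pi> a) then of_real (lam (h a)) else 0)"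
    and "(\<lambda>g. \<Prod>a<k. H (g a) (g (\<pi> a))) summable_on ({..<k} \<rightarrow>\<^sub>E UNIV)"
    and "(\<lambda>h. \<Prod>a<k. if h a = h (inv \<pi> a) then complex_of_real (lam (h a)) else 0) summable_on ({..<k} \<rightarrow>\<^sub>E J)"
proof -
  let ?K = "{..<k}"
  define T where "T = (\<lambda>g h. \<Prod>a<k. complex_of_real (lam (h a)) * v (h a) (g a) * cnj (v (h a) (g (\<pi> a))))"
  have pK: "\<pi> a \<in> ?K" "inv \<pi> a \<in> ?K" if "a \<in> ?K" for a
    using that permutes_in_image[OF p] permutes_in_image[OF permutes_inv[OF p]] by auto
  \<comment> \<open>Moving the conjugated factor from \<open>a\<close> to \<open>inv \<pi> a\<close>
    gathers everything that depends on \<open>g a\<close>, so the sum over \<open>g\<close>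
    factors.\<close>
  have T2: "T g h = (\<Prod>a<k. complex_of_real (lam (h a))) * (\<Prod>a<k. v (h a) (g a) * cnj (v (h (inv \<pi> a)) (g a)))" for g h
  proof -
    have "(\<Prod>a<k. cnj (v (h a) (g (\<pi> a)))) = (\<Prod>a<k. cnj (v (h (inv \<pi> (\<pi> a))) (g (\<pi> a))))"
      by (simp add: permutes_inverses[OF p])
    also have "\<dots> = (\<Prod>a<k. cnj (v (h (inv \<pi> a)) (g a)))"
      by (rule prod.reindex_bij_betw[OF permutes_imp_bij[OF p]])
    finally show ?thesis by (simp add: T_def prod.distrib mult_ac)
  qed
  have sum_h: "(\<Sum>\<^sub>\<infinity>h\<in>?K \<rightarrow>\<^sub>E J. T g h) = (\<Prod>a<k. H (g a) (g (\<pi> a)))" for g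
  proof -
    have "(\<lambda>j. norm (complex_of_real (lam j) * v j n * cnj (v j m))) summable_on J" for n m
    proof (rule Infinite_Sum.abs_summable_on_comparison_test'[OF lam_summable])
      fix j assume "j \<in> J"
      hence "cmod (v j n) * cmod (v j m) \<le> 1" using bessel_prod_finite[of "{j}" n m] by simp
      thus "norm (complex_of_real (lam j) * v j n * cnj (v j m)) \<le> \<bar>lam j\<bar>"
        by (simp add: norm_mult mult.assoc mult_left_le)
    qed
    hence "(\<Sum>\<^sub>\<infinity>h\<in>?K \<rightarrow>\<^sub>E J. T g h) =
       (\<Prod>a<k. \<Sum>\<^sub>\<infinity>j\<in>J. complex_of_real (lam j) * v j (g a) * cnj (v j (g (\<pi> a))))"
      unfolding T_def by (intro infsum_prod_PiE_abs) auto
    thus ?thesis by (simp add: spectral_decomposition[symmetric])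
  qed
  \<comment> \<open>Each factor of the sum of norms over \<open>g\<close> is at most 1 by
    \<open>column_bound\<close>, so joint summability reduces to that of products of
    eigenvalues.\<close>
  have sum_g: "(\<Sum>\<^sub>\<infinity>g\<in>?K \<rightarrow>\<^sub>E UNIV. T g h) = (\<Prod>a<k. if h a = h (inv \<pi> a) then of_real (lam (h a)) else 0)"
    and T_abs: "(\<lambda>g. norm (T g h)) summable_on (?K \<rightarrow>\<^sub>E UNIV)"
    and T_bd: "(\<Sum>\<^sub>\<infinity>g\<in>?K \<rightarrow>\<^sub>E UNIV. norm (T g h)) \<le> norm (\<Prod>a<k. complex_of_real (lam (h a)))"
    if h: "h \<in> ?K \<rightarrow>\<^sub>E J" for h
  proof -
    have hJ: "h a \<in> J" if "a \<in> ?K" for a using h that by auto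
    have ab: "(\<lambda>n. norm (v (h a) n * cnj (v (h (inv \<pi> a)) n))) summable_on UNIV" if "a \<in> ?K" for a
      using column_bound(1)[OF hJ hJ, OF that pK(2)[OF that]] by (simp add: norm_mult)
    have "(\<Sum>\<^sub>\<infinity>g\<in>?K \<rightarrow>\<^sub>E UNIV. \<Prod>a<k. v (h a) (g a) * cnj (v (h (inv \<pi> a)) (g a))) =
       (\<Prod>a<k. \<Sum>\<^sub>\<infinity>n. v (h a) n * cnj (v (h (inv \<pi> a)) n))"
      using ab by (intro infsum_prod_PiE_abs) auto
    also have "\<dots> = (\<Prod>a<k. if h a = h (inv \<pi> a) then 1 else 0)"
      using orth hJ pK by (intro prod.cong) (auto simp: ip_def[symmetric])
    finally have *: "(\<Sum>\<^sub>\<infinity>g\<in>?K \<rightarrow>\<^sub>E UNIV. \<Prod>a<k. v (h a) (g a) * cnj (v (h (inv \<pi> a)) (g a))) =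
       (\<Prod>a<k. if h a = h (inv \<pi> a) then 1 else 0)" .
    show "(\<Sum>\<^sub>\<infinity>g\<in>?K \<rightarrow>\<^sub>E UNIV. T g h) = (\<Prod>a<k. if h a = h (inv \<pi> a) then of_real (lam (h a)) else 0)"
      unfolding T2 infsum_cmult_right' *
      by (subst prod.distrib[symmetric], intro prod.cong) auto
    have s: "(\<lambda>g. norm (\<Prod>a<k. v (h a) (g a) * cnj (v (h (inv \<pi> a)) (g a)))) summable_on (?K \<rightarrow>\<^sub>E UNIV)"
      using ab by (intro abs_summable_prod_PiE) auto
    show "(\<lambda>g. norm (T g h)) summable_on (?K \<rightarrow>\<^sub>E UNIV)"
      unfolding T2 norm_mult[of "prod _ _"] by (intro summable_on_cmult_right s)
    have "(\<Sum>\<^sub>\<infinity>g\<in>?K \<rightarrow>\<^sub>E UNIV. norm (\<Prod>a<k. v (h a) (g a) * cnj (v (h (inv \<pi> a)) (g a)))) =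
          (\<Sum>\<^sub>\<infinity>g\<in>?K \<rightarrow>\<^sub>E UNIV. \<Prod>a<k. cmod (v (h a) (g a)) * cmod (v (h (inv \<pi> a)) (g a)))"
      by (simp add: prod_norm[symmetric] norm_mult)
    also have "\<dots> = (\<Prod>a<k. \<Sum>\<^sub>\<infinity>n. cmod (v (h a) n) * cmod (v (h (inv \<pi> a)) n))"
      using ab by (intro infsum_prod_PiE_abs) (auto simp: norm_mult)
    also have "\<dots> \<le> 1"
      using column_bound(2) hJ pK by (intro prod_le_1) (auto intro!: infsum_nonneg)
    finally show "(\<Sum>\<^sub>\<infinity>g\<in>?K \<rightarrow>\<^sub>E UNIV. norm (T g h)) \<le> norm (\<Prod>a<k. complex_of_real (lam (h a)))"
      unfolding T2 norm_mult[of "prod _ _"] infsum_cmult_right' by (intro mult_left_le) auto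
  qed
  have lam_s: "(\<lambda>h. norm (\<Prod>a<k. complex_of_real (lam (h a)))) summable_on (?K \<rightarrow>\<^sub>E J)"
    using lam_summable cnt by (intro abs_summable_prod_PiE) auto
  have abs: "(\<lambda>x. norm (case x of (h, g) \<Rightarrow> T g h)) summable_on ((?K \<rightarrow>\<^sub>E J) \<times> (?K \<rightarrow>\<^sub>E UNIV))"
  proof (subst Infinite_Sum.abs_summable_on_Sigma_iff, intro conjI ballI)
    show "(\<lambda>g. norm (case (h, g) of (h, g) \<Rightarrow> T g h)) summable_on (?K \<rightarrow>\<^sub>E UNIV)" if "h \<in> ?K \<rightarrow>\<^sub>E J" for h
      using T_abs[OF that] by simp
    show "(\<lambda>h. norm (\<Sum>\<^sub>\<infinity>g\<in>?K \<rightarrow>\<^sub>E UNIV. norm (case (h, g) of (h, g) \<Rightarrow> T g h))) summable_on (?K \<rightarrow>\<^sub>E J)"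
      by (rule Infinite_Sum.abs_summable_on_comparison_test'[OF lam_s])
         (use T_bd in \<open>simp add: infsum_nonneg\<close>)
  qed
  have sm: "(\<lambda>(h, g). T g h) summable_on ((?K \<rightarrow>\<^sub>E J) \<times> (?K \<rightarrow>\<^sub>E UNIV))"
    by (rule abs_summable_summable[OF abs])
  hence sm': "(\<lambda>(g, h). T g h) summable_on ((?K \<rightarrow>\<^sub>E UNIV) \<times> (?K \<rightarrow>\<^sub>E J))"
    by (subst summable_on_swap) simp
  have "(\<Sum>\<^sub>\<infinity>h\<in>?K \<rightarrow>\<^sub>E J. \<Sum>\<^sub>\<infinity>g\<in>?K \<rightarrow>\<^sub>E UNIV. T g h) = (\<Sum>\<^sub>\<infinity>g\<in>?K \<rightarrow>\<^sub>E UNIV. \<Sum>\<^sub>\<infinity>h\<in>?K \<rightarrow>\<^sub>E J. T g h)"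
    by (rule infsum_swap_banach[OF sm])
  moreover have "(\<Sum>\<^sub>\<infinity>h\<in>?K \<rightarrow>\<^sub>E J. \<Sum>\<^sub>\<infinity>g\<in>?K \<rightarrow>\<^sub>E UNIV. T g h) =
    (\<Sum>\<^sub>\<infinity>h\<in>?K \<rightarrow>\<^sub>E J. \<Prod>a<k. if h a = h (inv \<pi> a) then of_real (lam (h a)) else 0)"
    by (rule infsum_cong) (rule sum_g)
  ultimately show "(\<Sum>\<^sub>\<infinity>g\<in>?K \<rightarrow>\<^sub>E UNIV. \<Prod>a<k. H (g a) (g (\<pi> a))) =
         (\<Sum>\<^sub>\<infinity>h\<in>?K \<rightarrow>\<^sub>E J. \<Prod>a<k. if h a = h (inv \<pi> a) then of_real (lam (h a)) else 0)"
    by (simp add: sum_h)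
  show "(\<lambda>g. \<Prod>a<k. H (g a) (g (\<pi> a))) summable_on (?K \<rightarrow>\<^sub>E UNIV)"
    using summable_on_Sigma_banach[OF sm'] by (simp add: sum_h)
  show "(\<lambda>h. \<Prod>a<k. if h a = h (inv \<pi> a) then complex_of_real (lam (h a)) else 0) summable_on (?K \<rightarrow>\<^sub>E J)"
    using summable_on_Sigma_banach[OF sm]
    by (rule summable_on_cong[THEN iffD1, rotated]) (rule sum_g)
qed

lemma infsum_pdet_functions_eq:
  fixes k :: nat
  assumes cnt: "countable J"
  shows "(\<Sum>\<^sub>\<infinity>g\<in>{..<k} \<rightarrow>\<^sub>E UNIV. pdet (\<lambda>a b. H (g a) (g b)) {..<k}) =
         (\<Sum>\<^sub>\<infinity>h\<in>{..<k} \<rightarrow>\<^sub>E J. pdet (\<lambda>a b. if h a = h b then of_real (lam (h a)) else 0) {..<k})"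
proof -
  let ?K = "{..<k}"
  let ?P = "{\<pi>. \<pi> permutes ?K}"
  have fP: "finite ?P" by (simp add: finite_permutations)
  define s where "s = (\<lambda>\<pi>. \<Sum>\<^sub>\<infinity>g\<in>?K \<rightarrow>\<^sub>E UNIV. \<Prod>a<k. H (g a) (g (\<pi> a)))"
  have 1: "((\<lambda>g. pdet (\<lambda>a b. H (g a) (g b)) ?K) has_sum (\<Sum>\<pi>\<in>?P. of_int (sign \<pi>) * s \<pi>)) (?K \<rightarrow>\<^sub>E UNIV)"
    unfolding pdet_def
  proof (rule has_sum_finite_sum[OF fP])
    fix \<pi> assume "\<pi> \<in> ?P"
    hence "((\<lambda>g. \<Prod>a<k. H (g a) (g (\<pi> a))) has_sum s \<pi>) (?K \<rightarrow>\<^sub>E UNIV)"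
      unfolding s_def using permutation_term_swap(2)[OF _ cnt] by (intro has_sum_infsum) auto
    thus "((\<lambda>g. of_int (sign \<pi>) * (\<Prod>a<k. H (g a) (g (\<pi> a)))) has_sum of_int (sign \<pi>) * s \<pi>) (?K \<rightarrow>\<^sub>E UNIV)"
      by (rule has_sum_cmult_right)
  qed
  have 2: "((\<lambda>h. pdet (\<lambda>a b. if h a = h b then complex_of_real (lam (h a)) else 0) ?K) has_sum
      (\<Sum>\<pi>\<in>?P. of_int (sign \<pi>) * s (inv \<pi>))) (?K \<rightarrow>\<^sub>E J)"
    unfolding pdet_def
  proof (rule has_sum_finite_sum[OF fP])
    fix \<pi> assume "\<pi> \<in> ?P"
    hence p: "\<pi> permutes ?K" by simp
    hence ip: "inv \<pi> permutes ?K" by (rule permutes_inv)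
    have "((\<lambda>h. \<Prod>a<k. if h a = h (\<pi> a) then complex_of_real (lam (h a)) else 0) has_sum s (inv \<pi>)) (?K \<rightarrow>\<^sub>E J)"
      using permutation_term_swap(1,3)[OF ip cnt] unfolding permutes_inv_inv[OF p] s_def by (simp add: has_sum_iff)
    thus "((\<lambda>h. of_int (sign \<pi>) * (\<Prod>a<k. if h a = h (\<pi> a) then complex_of_real (lam (h a)) else 0)) has_sum
        of_int (sign \<pi>) * s (inv \<pi>)) (?K \<rightarrow>\<^sub>E J)"
      by (rule has_sum_cmult_right)
  qed
  have "(\<Sum>\<pi>\<in>?P. of_int (sign \<pi>) * s \<pi>) = (\<Sum>\<pi>\<in>?P. of_int (sign (inv \<pi>)) * s (inv \<pi>))"
    by (rule sum_permutations_inverse)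
  also have "\<dots> = (\<Sum>\<pi>\<in>?P. of_int (sign \<pi>) * s (inv \<pi>))"
  proof (intro sum.cong refl)
    fix \<pi> assume "\<pi> \<in> ?P"
    hence "permutation \<pi>" unfolding permutation_permutes by (intro exI[of _ ?K]) auto
    thus "of_int (sign (inv \<pi>)) * s (inv \<pi>) = of_int (sign \<pi>) * s (inv \<pi>)"
      by (simp add: sign_inverse)
  qed
  finally show ?thesis using infsumI[OF 1] infsumI[OF 2] by simp
qed

text \<open>For each \<open>k\<close> the sum of the principal minors of size \<open>k\<close>, the
  trace of the exterior power, agrees for \<open>H\<close> and for the diagonal matrix
  \<open>A\<close> of its eigenvalues. The minors of \<open>A\<close> are the products that occur in
  \<open>fpow_prod\<close>.\<close>

theorem fredholm_det_eq_prod: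
  assumes cnt: "countable J"
  shows "fredholm_det H z = fpow_prod (\<lambda>j. - (z * of_real (lam j))) J"
proof -
  define A where "A = (\<lambda>i j. if i = j then complex_of_real (lam i) else 0)"
  have sH: "(\<lambda>I. norm (z ^ card I * pdet H I)) summable_on Fpow UNIV" for z
    by (rule pdet_summable[OF row_summable(2)[OF l2_0]])
       (use summable_on_Sigma_banach[of "\<lambda>n m. cmod (H n m)" UNIV "\<lambda>_. UNIV"] sumH in simp)
  have rowA: "((\<lambda>j. norm (A i j)) has_sum \<bar>lam i\<bar>) J" if "i \<in> J" for i
    by (rule has_sum_finite_neutralI[of "{i}"]) (use that in \<open>auto simp: A_def\<close>)
  have sA: "(\<lambda>I. norm (z ^ card I * pdet A I)) summable_on Fpow J" for z
  proof (rule pdet_summable)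
    show "(\<lambda>j. norm (A i j)) summable_on J" if "i \<in> J" for i using rowA[OF that] by (rule has_sum_imp_summable)
    show "(\<lambda>i. \<Sum>\<^sub>\<infinity>j\<in>J. norm (A i j)) summable_on J"
      by (rule summable_on_cong[THEN iffD1, OF _ lam_summable]) (simp add: infsumI[OF rowA])
  qed
  have eq: "(\<Sum>\<^sub>\<infinity>I\<in>{I \<in> Fpow UNIV. card I = k}. pdet H I) = (\<Sum>\<^sub>\<infinity>I\<in>{I \<in> Fpow J. card I = k}. pdet A I)" for k
  proof -
    have "fact k * (\<Sum>\<^sub>\<infinity>I\<in>{I \<in> Fpow UNIV. card I = k}. pdet H I) =
      (\<Sum>\<^sub>\<infinity>g\<in>{..<k} \<rightarrow>\<^sub>E UNIV. pdet (\<lambda>a b. H (g a) (g b)) {..<k})"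
      by (rule infsum_pdet_functions[symmetric])
         (use summable_on_subset[OF sH[of 1], of "{I \<in> Fpow UNIV. card I = k}"] in auto)
    also have "\<dots> = (\<Sum>\<^sub>\<infinity>h\<in>{..<k} \<rightarrow>\<^sub>E J. pdet (\<lambda>a b. A (h a) (h b)) {..<k})"
      unfolding A_def by (rule infsum_pdet_functions_eq[OF cnt])
    also have "\<dots> = fact k * (\<Sum>\<^sub>\<infinity>I\<in>{I \<in> Fpow J. card I = k}. pdet A I)"
      by (rule infsum_pdet_functions)
         (use summable_on_subset[OF sA[of 1], of "{I \<in> Fpow J. card I = k}"] in auto)
    finally show ?thesis by simp
  qed
  have part: "(\<Sum>\<^sub>\<infinity>I\<in>{I \<in> Fpow Y. card I = k}. (- z) ^ card I * pdet B I) = (- z) ^ k * (\<Sum>\<^sub>\<infinity>I\<in>{I \<in> Fpow Y. card I = k}. pdet B I)"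
    for Y :: "'x set" and B k
    unfolding infsum_cmult_right'[symmetric] by (rule infsum_cong) auto
  have "{I :: int set. finite I} = Fpow UNIV" by (auto simp: Fpow_def)
  hence "fredholm_det H z = (\<Sum>\<^sub>\<infinity>I\<in>Fpow UNIV. (- z) ^ card I * pdet H I)"
    by (simp add: fredholm_det_def subdet_eq_pdet)
  also have "\<dots> = (\<Sum>\<^sub>\<infinity>k. (- z) ^ k * (\<Sum>\<^sub>\<infinity>I\<in>{I \<in> Fpow UNIV. card I = k}. pdet H I))"
    by (subst infsum_Fpow_by_card[OF abs_summable_summable[OF sH]]) (simp only: part)
  also have "\<dots> = (\<Sum>\<^sub>\<infinity>k. (- z) ^ k * (\<Sum>\<^sub>\<infinity>I\<in>{I \<in> Fpow J. card I = k}. pdet A I))"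
    by (simp only: eq)
  also have "\<dots> = (\<Sum>\<^sub>\<infinity>I\<in>Fpow J. (- z) ^ card I * pdet A I)"
    by (subst infsum_Fpow_by_card[OF abs_summable_summable[OF sA]]) (simp only: part)
  also have "\<dots> = fpow_prod (\<lambda>j. - (z * of_real (lam j))) J"
    unfolding fpow_prod_def
  proof (rule infsum_cong)
    fix I assume "I \<in> Fpow J"
    hence "finite I" by (simp add: Fpow_def)
    hence "pdet A I = (\<Prod>j\<in>I. complex_of_real (lam j))" unfolding A_def by (rule pdet_diag)
    thus "(- z) ^ card I * pdet A I = (\<Prod>j\<in>I. - (z * of_real (lam j)))"
      by (simp add: prod.distrib[of "\<lambda>_. - z", simplified])
  qed
  finally show ?thesis .
qed

end

section \<open>The matrices of the Hankel operator\<close>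

text \<open>The two arguments of \<open>Beta\<close> in \<open>Hmat\<close> add up to a quantity
  depending on \<open>n - m\<close> only. An entry is therefore a Toeplitz symbol between two
  diagonal Gamma factors.\<close>

definition symb :: "real \<Rightarrow> (real \<Rightarrow> real) \<Rightarrow> int \<Rightarrow> complex" where
  "symb T p l = fcoef T p l / Gamma (1 - \<i> * complex_of_real (omega T * of_int l))"

definition gam :: "real \<Rightarrow> complex \<Rightarrow> int \<Rightarrow> complex" where
  "gam T s n = Gamma (1/2 + \<i> * complex_of_real (omega T * of_int n) + \<i> * s)"

definition gam' :: "real \<Rightarrow> complex \<Rightarrow> int \<Rightarrow> complex" where
  "gam' T s n = Gamma (1/2 - \<i> * complex_of_real (omega T * of_int n) - \<i> * s)"

lemma Hmat_factor: "Hmat T p s n m = gam' T s n * gam T s m * symb T p (n - m)"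
proof -
  have "1/2 - \<i> * complex_of_real (omega T * of_int n) - \<i> * s + (1/2 + \<i> * complex_of_real (omega T * of_int m) + \<i> * s)
      = 1 - \<i> * complex_of_real (omega T * of_int (n - m))"
    by (simp add: algebra_simps)
  thus ?thesis unfolding Hmat_def Beta_def gam_def gam'_def symb_def by simp
qed

lemma gam_mult: "gam' T s n * gam T s n = sech_term (omega T) s n"
proof -
  define x where "x = complex_of_real (of_int n * omega T) + s"
  have "gam' T s n * gam T s n = Gamma (1/2 - \<i> * x) * Gamma (1 - (1/2 - \<i> * x))"
    by (simp add: gam_def gam'_def x_def algebra_simps)
  also have "\<dots> = of_real pi / sin (of_real pi * (1/2 - \<i> * x))"
    by (rule Gamma_reflection_complex)
  also have "of_real pi * (1/2 - \<i> * x) = of_real pi / 2 - \<i> * (of_real pi * x)"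
    by (simp add: algebra_simps)
  also have "sin (of_real pi / 2 - \<i> * (of_real pi * x)) = cosh (of_real pi * x)"
    by (simp add: sin_diff cosh_conv_cos)
  finally show ?thesis by (simp add: sech_term_def x_def)
qed

lemma Lam_eq: "Lam T = sech_poles (omega T) UNIV"
  by (simp add: Lam_def sech_poles_def)

lemma Pfun_eq: "Pfun T s = sech_sum (omega T) s"
  by (simp add: Pfun_def sech_sum_def sech_term_def)

lemma omega_pos: "T > 0 \<Longrightarrow> omega T > 0"
  by (simp add: omega_def)

lemma fredholm_HmatN:
  "fredholm_det (HmatN T p N s) z = sech_series (omega T)
     (\<lambda>I. (- z) ^ card I * pdet (\<lambda>n m. if \<bar>n - m\<bar> \<le> int N then symb T p (n - m) else 0) I) UNIV s"
proof -
  have "HmatN T p N s = (\<lambda>n m. gam' T s n * gam T s m * (if \<bar>n - m\<bar> \<le> int N then symb T p (n - m) else 0))"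
    by (auto simp: HmatN_def Hmat_factor fun_eq_iff)
  hence "pdet (HmatN T p N s) I = (\<Prod>n\<in>I. sech_term (omega T) s n) *
      pdet (\<lambda>n m. if \<bar>n - m\<bar> \<le> int N then symb T p (n - m) else 0) I" for I
    by (simp add: pdet_gauge gam_mult)
  moreover have "{I :: int set. finite I} = Fpow UNIV" by (auto simp: Fpow_def)
  ultimately show ?thesis
    unfolding fredholm_det_def sech_series_def subdet_eq_pdet by (simp add: mult_ac)
qed

text \<open>Truncation depends on \<open>n - m\<close> only, so the matrix stays Toeplitz and keeps
  the invariance of its minors; the finite band supplies the geometric rate
  \<open>norm z * Q\<close>.\<close>

lemma fredholm_HmatN_affine:
  assumes "T > 0"
  shows "\<exists>A B. \<forall>s. s \<notin> Lam T \<longrightarrow>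
     fredholm_det (HmatN T p N s) z = - A * Pfun T s + B \<and>
     fredholm_det (HmatN T p N s) (- z) = A * Pfun T s + B"
proof -
  define q where "q = (\<lambda>l. if \<bar>l\<bar> \<le> int N then symb T p l else 0)"
  define t where "t = (\<lambda>z I. (- z) ^ card I * pdet (\<lambda>n m. q (n - m)) I)"
  have F: "fredholm_det (HmatN T p N s) z = sech_series (omega T) (t z) UNIV s" for z s
    by (simp add: fredholm_HmatN t_def q_def)
  define Q where "Q = (\<Sum>l\<in>{- int N..int N}. norm (q l))"
  have Q0: "Q \<ge> 0" unfolding Q_def by (intro sum_nonneg) auto
  have "norm (t z I) \<le> 1 * (norm z * Q) ^ card I" if "finite I" for I
  proof -
    have "norm (pdet (\<lambda>n m. q (n - m)) I) \<le> Q ^ card I"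
      unfolding Q_def by (rule norm_pdet_band_toeplitz_le[OF _ _ that]) (auto simp: q_def)
    thus ?thesis by (simp add: t_def norm_mult norm_power power_mult_distrib mult_left_mono)
  qed
  moreover have "norm z * Q \<ge> 0" "(1::real) \<ge> 0" using Q0 by auto
  ultimately have gb: "geom_bounded (t z)" unfolding geom_bounded_def by blast
  have shift: "t z ((\<lambda>n. n + 1) ` I) = t z I" if "finite I" for I
    using pdet_shift_image[OF that, of q 1] by (simp add: t_def card_image)
  have refl: "t z (uminus ` I) = t z I" if "finite I" for I
    using pdet_uminus_image[OF that, of q] by (simp add: t_def card_image)
  have neg: "(\<lambda>I. (-1) ^ card I * t z I) = t (- z)"
    by (auto simp: t_def fun_eq_iff power_mult_distrib[symmetric] mult.assoc[symmetric])
  from sech_series_affine[OF omega_pos[OF assms] gb shift refl]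
  show ?thesis unfolding F Lam_eq Pfun_eq neg by simp
qed

section \<open>Hermitian symmetry and summability at real points\<close>

lemma fcoef_cnj: "cnj (fcoef T p l) = fcoef T p (- l)"
proof -
  have "cnj (exp (- \<i> * of_int l * complex_of_real (omega T * x)) * complex_of_real (p x)) =
     exp (- \<i> * of_int (- l) * complex_of_real (omega T * x)) * complex_of_real (p x)" for x
    by (simp add: exp_cnj)
  thus ?thesis unfolding fcoef_def
    by (simp only: complex_cnj_mult complex_cnj_divide complex_cnj_one complex_cnj_complex_of_real integral_cnj)
qed

lemma cnj_gam: "cnj (gam T (of_real k) n) = gam' T (of_real k) n"
  unfolding gam_def gam'_def by (simp add: cnj_Gamma algebra_simps)

lemma symb_cnj: "cnj (symb T p l) = symb T p (- l)"
  unfolding symb_def by (simp add: fcoef_cnj cnj_Gamma)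

lemma Hmat_hermitian: "Hmat T p (of_real k) m n = cnj (Hmat T p (of_real k) n m)"
proof -
  have "cnj (gam' T (of_real k) n) = gam T (of_real k) n"
    using cnj_gam[of T k n] by (metis complex_cnj_cnj)
  thus ?thesis unfolding Hmat_factor using cnj_gam[of T k m] symb_cnj[of T p "n - m"] by simp
qed

lemma norm_gam:
  "(norm (gam T (of_real k) n))\<^sup>2 = pi / cosh (pi * (of_int n * omega T + k))"
  "norm (gam' T (of_real k) n) = norm (gam T (of_real k) n)"
proof -
  have "complex_of_real ((norm (gam T (of_real k) n))\<^sup>2) = gam' T (of_real k) n * gam T (of_real k) n"
    unfolding complex_norm_square cnj_gam by (rule mult.commute)
  also have "\<dots> = complex_of_real (pi / cosh (pi * (of_int n * omega T + k)))"
    unfolding gam_mult sech_term_def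
    by (simp add: cosh_def scaleR_conv_of_real exp_of_real[symmetric] del: exp_of_real)
  finally show "(norm (gam T (of_real k) n))\<^sup>2 = pi / cosh (pi * (of_int n * omega T + k))"
    by (simp only: of_real_eq_iff)
  show "norm (gam' T (of_real k) n) = norm (gam T (of_real k) n)"
    unfolding cnj_gam[symmetric] by simp
qed

lemma norm_gam_le:
  assumes "T > 0"
  shows "norm (gam T (of_real k) n) \<le> sqrt (2 * pi * exp (pi * \<bar>k\<bar>)) * exp (- (pi * omega T / 2) * \<bar>of_int n\<bar>)"
proof (rule power2_le_imp_le)
  define x where "x = pi * (of_int n * omega T + k)"
  have "exp \<bar>x\<bar> / 2 \<le> cosh x" by (cases "x \<ge> 0") (auto simp: cosh_def)
  hence "pi / cosh x \<le> pi / (exp \<bar>x\<bar> / 2)" by (intro divide_left_mono) (auto intro!: mult_pos_pos)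
  also have "\<dots> = 2 * pi * exp (- \<bar>x\<bar>)" by (simp add: exp_minus field_simps)
  also have "\<dots> \<le> 2 * pi * exp (pi * \<bar>k\<bar> - pi * omega T * \<bar>of_int n\<bar>)"
  proof -
    have "pi * omega T * \<bar>of_int n\<bar> = \<bar>pi * (of_int n * omega T)\<bar>"
      using omega_pos[OF assms] by (simp add: abs_mult)
    also have "\<dots> \<le> \<bar>x\<bar> + pi * \<bar>k\<bar>"
      using abs_triangle_ineq[of x "- (pi * k)"] by (simp add: x_def abs_mult algebra_simps)
    finally show ?thesis by simp
  qed
  also have "\<dots> = (sqrt (2 * pi * exp (pi * \<bar>k\<bar>)) * exp (- (pi * omega T / 2) * \<bar>of_int n\<bar>))\<^sup>2"
    by (simp add: power_mult_distrib exp_diff exp_minus field_simps flip: exp_double)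
  finally show "(norm (gam T (of_real k) n))\<^sup>2 \<le> (sqrt (2 * pi * exp (pi * \<bar>k\<bar>)) * exp (- (pi * omega T / 2) * \<bar>of_int n\<bar>))\<^sup>2"
    unfolding norm_gam(1) x_def .
qed auto

text \<open>For imaginary \<open>z\<close> the conjugate of \<open>Gamma (1 - z)\<close> is
  \<open>Gamma (1 + z)\<close>, that is \<open>z * Gamma z\<close>; the reflection formula does the
  rest.\<close>

lemma norm_inverse_Gamma:
  fixes y :: real
  assumes "y \<noteq> 0"
  shows "(norm (1 / Gamma (1 - \<i> * of_real y)))\<^sup>2 = sinh (pi * y) / (pi * y)"
proof -
  define z where "z = \<i> * complex_of_real y"
  have z: "z \<noteq> 0" "z \<notin> \<int>\<^sub>\<le>\<^sub>0" using assms
    by (auto simp: z_def elim!: nonpos_Ints_cases dest: arg_cong[of _ _ Im])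
  have "cnj (Gamma (1 - z)) = Gamma (z + 1)" by (simp add: z_def cnj_Gamma add.commute)
  also have "\<dots> = z * Gamma z" using z by (simp add: Gamma_plus1)
  finally have "complex_of_real ((norm (Gamma (1 - z)))\<^sup>2) = z * (Gamma z * Gamma (1 - z))"
    unfolding complex_norm_square by simp
  also have "\<dots> = z * (of_real pi / sin (of_real pi * z))" by (simp only: Gamma_reflection_complex)
  also have "sin (of_real pi * z) = \<i> * of_real (sinh (pi * y))"
  proof -
    have "sinh (complex_of_real (pi * y)) = - \<i> * sin (\<i> * complex_of_real (pi * y))"
      by (rule sinh_conv_sin)
    moreover have "sinh (complex_of_real (pi * y)) = of_real (sinh (pi * y))"
      by (simp add: sinh_def scaleR_conv_of_real exp_of_real[symmetric] del: exp_of_real)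
    ultimately have "\<i> * of_real (sinh (pi * y)) = \<i> * (- \<i> * sin (\<i> * complex_of_real (pi * y)))" by (simp only:)
    also have "\<dots> = sin (\<i> * complex_of_real (pi * y))" by simp
    finally have "\<i> * of_real (sinh (pi * y)) = sin (\<i> * complex_of_real (pi * y))" .
    thus ?thesis by (simp add: z_def mult_ac)
  qed
  also have "z * (of_real pi / (\<i> * of_real (sinh (pi * y)))) = of_real (pi * y / sinh (pi * y))"
    by (simp add: z_def field_simps)
  finally have "(norm (Gamma (1 - z)))\<^sup>2 = pi * y / sinh (pi * y)" by (simp only: of_real_eq_iff)
  thus ?thesis by (simp add: z_def norm_divide power_divide)
qed

text \<open>In the constant, the summand 1 covers \<open>l = 0\<close>, where Gamma is 1, and
  \<open>1 / (pi * omega T)\<close> comes from the denominator \<open>pi * y\<close>. The power -1/4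
  is the square root of \<open>1 / \<bar>l\<bar>\<close> halved in the exponent of
  \<open>1 + l\<^sup>2\<close>, by
  \<open>sqrt (1 + l\<^sup>2) \<le> 2 * \<bar>l\<bar>\<close>.\<close>

lemma norm_inverse_Gamma_le:
  assumes "T > 0"
  shows "norm (1 / Gamma (1 - \<i> * complex_of_real (omega T * of_int l))) \<le>
    sqrt (1 + 1 / (pi * omega T)) * exp (pi * omega T / 2 * \<bar>of_int l\<bar>) * (1 + (real_of_int l)\<^sup>2) powr (-1/4)"
proof (rule power2_le_imp_le)
  let ?w = "omega T" let ?L = "1 + (real_of_int l)\<^sup>2"
  have w: "?w > 0" by (rule omega_pos[OF assms])
  have Lpos: "?L > 0" by (simp add: add_pos_nonneg)
  have rhs: "(sqrt (1 + 1 / (pi * ?w)) * exp (pi * ?w / 2 * \<bar>of_int l\<bar>) * ?L powr (-1/4))\<^sup>2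
      = (1 + 1 / (pi * ?w)) * exp (pi * ?w * \<bar>of_int l\<bar>) / sqrt ?L"
  proof -
    have "(?L powr (-1/4))\<^sup>2 = ?L powr (- (1/2))"
      using Lpos by (simp add: power2_eq_square powr_add[symmetric])
    also have "\<dots> = 1 / sqrt ?L" using Lpos by (simp add: powr_minus powr_half_sqrt field_simps)
    finally have 1: "(?L powr (-1/4))\<^sup>2 = 1 / sqrt ?L" .
    have 2: "(exp (pi * ?w / 2 * \<bar>of_int l\<bar>))\<^sup>2 = exp (pi * ?w * \<bar>of_int l\<bar>)"
      by (simp flip: exp_double)
    have 3: "(sqrt (1 + 1 / (pi * ?w)))\<^sup>2 = 1 + 1 / (pi * ?w)" using w by simp
    show ?thesis unfolding power_mult_distrib 1 2 3 by simp
  qed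
  show "(norm (1 / Gamma (1 - \<i> * complex_of_real (?w * of_int l))))\<^sup>2 \<le>
    (sqrt (1 + 1 / (pi * ?w)) * exp (pi * ?w / 2 * \<bar>of_int l\<bar>) * ?L powr (-1/4))\<^sup>2"
  proof (cases "l = 0")
    case True
    thus ?thesis using w by simp
  next
    case False
    define a where "a = \<bar>real_of_int l\<bar>"
    have a: "a \<ge> 1" using False by (simp add: a_def)
    define y where "y = ?w * of_int l"
    have "(norm (1 / Gamma (1 - \<i> * complex_of_real y)))\<^sup>2 = sinh (pi * y) / (pi * y)"
      by (rule norm_inverse_Gamma) (use False w in \<open>simp add: y_def\<close>)
    also have "\<dots> = sinh (pi * ?w * a) / (pi * ?w * a)"
      by (cases "l \<ge> 0") (auto simp: y_def a_def mult_ac)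
    also have "\<dots> \<le> (exp (pi * ?w * a) / 2) / (pi * ?w * a)"
      using a w by (intro divide_right_mono) (auto simp: sinh_def)
    also have "\<dots> = (exp (pi * ?w * a) / (pi * ?w)) * (1 / (2 * a))" by simp
    also have "\<dots> \<le> (exp (pi * ?w * a) / (pi * ?w)) * (1 / sqrt ?L)"
    proof (intro mult_left_mono divide_left_mono)
      have "sqrt ?L \<le> sqrt ((2 * a)\<^sup>2)"
      proof (rule real_sqrt_le_mono)
        have "1 * 1 \<le> a * a" using a by (intro mult_mono) auto
        thus "?L \<le> (2 * a)\<^sup>2" by (simp add: a_def power2_eq_square flip: abs_mult)
      qed
      also have "sqrt ((2 * a)\<^sup>2) = 2 * a" using a by (subst real_sqrt_abs) simp
      finally show "sqrt ?L \<le> 2 * a" .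
    qed (use w a Lpos in auto)
    also have "\<dots> = 1 / (pi * ?w) * exp (pi * ?w * a) / sqrt ?L" by simp
    also have "\<dots> \<le> (1 + 1 / (pi * ?w)) * exp (pi * ?w * a) / sqrt ?L"
      by (intro divide_right_mono mult_right_mono) auto
    finally show ?thesis unfolding rhs by (simp add: y_def a_def)
  qed
qed (use omega_pos[OF assms] in \<open>auto intro!: mult_nonneg_nonneg add_nonneg_nonneg\<close>)

text \<open>The Gamma factors decay and the symbol grows at the same exponential rate. The combined
  exponent vanishes exactly when \<open>n\<close> and \<open>m\<close> do not have the same strict
  sign; on those entries only the power of \<open>n - m\<close> helps.\<close>

lemma norm_Hmat_le:
  assumes "T > 0"
  shows "\<exists>C\<ge>0. \<forall>n m. norm (Hmat T p (of_real k) n m) \<le>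
     C * norm (fcoef T p (n - m)) * (1 + (real_of_int (n - m))\<^sup>2) powr (-1/4) *
     exp (- (pi * omega T / 2) * (\<bar>of_int n\<bar> + \<bar>of_int m\<bar> - \<bar>of_int (n - m)\<bar>))"
proof -
  define d where "d = pi * omega T / 2"
  define c1 where "c1 = sqrt (2 * pi * exp (pi * \<bar>k\<bar>))"
  define c2 where "c2 = sqrt (1 + 1 / (pi * omega T))"
  have c: "c1 \<ge> 0" "c2 \<ge> 0" using omega_pos[OF assms] by (auto simp: c1_def c2_def intro!: add_nonneg_nonneg)
  have "norm (Hmat T p (of_real k) n m) \<le> (c1 * c1 * c2) * norm (fcoef T p (n - m)) *
     (1 + (real_of_int (n - m))\<^sup>2) powr (-1/4) * exp (- d * (\<bar>of_int n\<bar> + \<bar>of_int m\<bar> - \<bar>of_int (n - m)\<bar>))" for n m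
  proof -
    let ?G = "norm (1 / Gamma (1 - \<i> * complex_of_real (omega T * of_int (n - m))))"
    let ?L = "(1 + (real_of_int (n - m))\<^sup>2) powr (-1/4)"
    have "norm (Hmat T p (of_real k) n m) = norm (gam T (of_real k) n) * norm (gam T (of_real k) m) * (norm (fcoef T p (n - m)) * ?G)"
      by (simp add: Hmat_factor norm_mult norm_divide norm_gam(2) symb_def)
    also have "\<dots> \<le> (c1 * exp (- d * \<bar>of_int n\<bar>)) * (c1 * exp (- d * \<bar>of_int m\<bar>)) *
        (norm (fcoef T p (n - m)) * (c2 * exp (d * \<bar>of_int (n - m)\<bar>) * ?L))"
      using norm_gam_le[OF assms, of k n] norm_gam_le[OF assms, of k m] norm_inverse_Gamma_le[OF assms, of "n - m"] c
      unfolding c1_def[symmetric] c2_def[symmetric] d_def[symmetric]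
      by (intro mult_mono mult_left_mono mult_nonneg_nonneg) auto
    also have "\<dots> = (c1 * c1 * c2) * norm (fcoef T p (n - m)) * ?L *
        (exp (- d * \<bar>of_int n\<bar>) * exp (- d * \<bar>of_int m\<bar>) * exp (d * \<bar>of_int (n - m)\<bar>))"
      by (simp only: mult_ac)
    also have "exp (- d * \<bar>of_int n\<bar>) * exp (- d * \<bar>of_int m\<bar>) * exp (d * \<bar>of_int (n - m)\<bar>)
        = exp (- d * (\<bar>of_int n\<bar> + \<bar>of_int m\<bar> - \<bar>of_int (n - m)\<bar>))"
      unfolding exp_add[symmetric] by (rule arg_cong[of _ _ exp]) (simp add: algebra_simps)
    finally show ?thesis .
  qed
  thus ?thesis using c unfolding d_def by (intro exI[of _ "c1 * c1 * c2"]) auto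
qed

text \<open>For \<open>n\<close> between 0 and \<open>l\<close> there is no decay; beyond either end
  the exponent is twice the distance to that end.\<close>

lemma exp_dist_le:
  fixes n l :: int and d :: real
  assumes "d > 0"
  shows "exp (- d * (\<bar>of_int n\<bar> + \<bar>of_int (n - l)\<bar> - \<bar>of_int l\<bar>)) \<le>
     (if n \<in> {min 0 l..max 0 l} then 1 else 0) + (exp (- (2 * d) * \<bar>of_int n\<bar>) + exp (- (2 * d) * \<bar>of_int (n - l)\<bar>))"
proof -
  define A where "A = \<bar>n\<bar> + \<bar>n - l\<bar> - \<bar>l\<bar>"
  have A: "\<bar>real_of_int n\<bar> + \<bar>of_int (n - l)\<bar> - \<bar>of_int l\<bar> = real_of_int A" by (simp add: A_def)
  consider "n \<in> {min 0 l..max 0 l}" | "A = 2 * \<bar>n\<bar>" | "A = 2 * \<bar>n - l\<bar>"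
    unfolding A_def by (cases "l \<ge> 0"; cases "n \<ge> 0"; cases "n \<ge> l") auto
  thus ?thesis
  proof cases
    case 1
    have "A \<ge> 0" unfolding A_def by linarith
    hence "exp (- d * real_of_int A) \<le> 1"
      using assms by (simp add: mult_nonneg_nonneg)
    thus ?thesis using 1 unfolding A by (simp add: add_increasing2)
  next
    case 2
    hence eq: "exp (- d * real_of_int A) = exp (- (2 * d) * \<bar>of_int n\<bar>)" by simp
    show ?thesis unfolding A eq by (simp add: add_nonneg_nonneg)
  next
    case 3
    hence eq: "exp (- d * real_of_int A) = exp (- (2 * d) * \<bar>of_int (n - l)\<bar>)" by simp
    show ?thesis unfolding A eq by (simp add: add_nonneg_nonneg)
  qed
qed

text \<open>The diagonal \<open>n - m = l\<close> has \<open>\<bar>l\<bar> + 1\<close> undamped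
  entries and two geometric tails, a total of order \<open>sqrt (1 + l\<^sup>2)\<close>. With the
  power -1/4 from the symbol this gives the power 1/4 in the hypothesis on the Fourier
  coefficients.\<close>

lemma Hmat_summable:
  assumes T: "T > 0"
    and sm: "(\<lambda>l::int. cmod (fcoef T p l) * (1 + (real_of_int l)\<^sup>2) powr (1/4)) summable_on UNIV"
  shows "(\<lambda>(n,m). cmod (Hmat T p (of_real k) n m)) summable_on UNIV"
proof -
  define d where "d = pi * omega T / 2"
  have d: "d > 0" using omega_pos[OF T] by (simp add: d_def)
  obtain C where C: "C \<ge> 0" "\<And>n m. norm (Hmat T p (of_real k) n m) \<le>
     C * norm (fcoef T p (n - m)) * (1 + (real_of_int (n - m))\<^sup>2) powr (-1/4) *
     exp (- d * (\<bar>of_int n\<bar> + \<bar>of_int m\<bar> - \<bar>of_int (n - m)\<bar>))"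
    using norm_Hmat_le[OF T, of p k] unfolding d_def by blast
  define u where "u = (\<lambda>l. C * norm (fcoef T p l) * (1 + (real_of_int l)\<^sup>2) powr (-1/4))"
  have u0: "u l \<ge> 0" for l using C(1) by (simp add: u_def)
  define e where "e = (\<lambda>n::int. exp (- (2 * d) * \<bar>real_of_int n\<bar>))"
  define G where "G = infsum e UNIV"
  have e: "(e has_sum G) UNIV"
    unfolding G_def e_def using d by (intro has_sum_infsum summable_exp_neg_abs_int) simp
  have G0: "G \<ge> 0" unfolding G_def e_def by (intro infsum_nonneg) auto
  have e': "((\<lambda>n. e (n - l)) has_sum G) UNIV" for l
    by (subst has_sum_reindex_bij_witness[of _ "\<lambda>n. n + l" "\<lambda>n. n - l" UNIV e _ G]) (use e in auto)
  define f where "f = (\<lambda>(l,n). u l * ((if n \<in> {min 0 l..max 0 l} then 1 else 0) + (e n + e (n - l))))"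
  have inner: "((\<lambda>n. f (l, n)) has_sum u l * (real_of_int (\<bar>l\<bar> + 1) + (G + G))) UNIV" for l
  proof -
    have "((\<lambda>n. if n \<in> {min 0 l..max 0 l} then 1 else 0 :: real) has_sum real_of_int (\<bar>l\<bar> + 1)) UNIV"
      by (rule has_sum_finite_neutralI[of "{min 0 l..max 0 l}"]) auto
    thus ?thesis unfolding f_def prod.case by (intro has_sum_cmult_right has_sum_add e e')
  qed
  have outer: "(\<lambda>l. u l * (real_of_int (\<bar>l\<bar> + 1) + (G + G))) summable_on UNIV"
  proof (rule summable_on_comparison_test)
    \<comment> \<open>The constant comes from \<open>\<bar>l\<bar> + 1 \<le> 2 * sqrt L\<close> and
      \<open>G + G \<le> 2 * G * sqrt L\<close>.\<close>
    show "(\<lambda>l. (C * (2 + 2 * G)) * (cmod (fcoef T p l) * (1 + (real_of_int l)\<^sup>2) powr (1/4))) summable_on UNIV"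
      by (intro summable_on_cmult_right sm)
    fix l :: int
    define L where "L = 1 + (real_of_int l)\<^sup>2"
    have L: "L \<ge> 1" by (simp add: L_def)
    have "\<bar>real_of_int l\<bar> \<le> sqrt L" by (rule real_le_rsqrt) (simp add: L_def)
    moreover have "1 \<le> sqrt L" using L by simp
    moreover have "G * 1 \<le> G * sqrt L" using G0 L by (intro mult_left_mono) auto
    moreover have "(2 + 2 * G) * sqrt L = 2 * sqrt L + 2 * (G * sqrt L)" by (simp add: algebra_simps)
    ultimately have "real_of_int (\<bar>l\<bar> + 1) + (G + G) \<le> (2 + 2 * G) * sqrt L"
      unfolding of_int_add of_int_abs of_int_1 by linarith
    hence "u l * (real_of_int (\<bar>l\<bar> + 1) + (G + G)) \<le> u l * ((2 + 2 * G) * sqrt L)"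
      by (intro mult_left_mono u0)
    also have "\<dots> = (C * (2 + 2 * G)) * (cmod (fcoef T p l) * (L powr (-1/4) * sqrt L))"
      by (simp add: u_def L_def)
    also have "L powr (-1/4) * sqrt L = L powr (1/4)"
      using L by (simp add: powr_half_sqrt[symmetric] powr_add[symmetric])
    finally show "u l * (real_of_int (\<bar>l\<bar> + 1) + (G + G)) \<le> (C * (2 + 2 * G)) * (cmod (fcoef T p l) * (1 + (real_of_int l)\<^sup>2) powr (1/4))"
      by (simp add: L_def)
    show "0 \<le> u l * (real_of_int (\<bar>l\<bar> + 1) + (G + G))" using u0 G0 by simp
  qed
  have "f summable_on (UNIV \<times> UNIV)"
    by (rule summable_on_SigmaI[OF inner outer]) (auto simp: f_def u0 e_def intro!: mult_nonneg_nonneg)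
  hence "f summable_on UNIV" by simp
  moreover have "(\<lambda>x. norm (case x of (l,n) \<Rightarrow> Hmat T p (of_real k) n (n - l))) \<le> f"
  proof (rule le_funI)
    fix x :: "int \<times> int"
    obtain l n where x: "x = (l, n)" by fastforce
    have "norm (Hmat T p (of_real k) n (n - l)) \<le> u l * exp (- d * (\<bar>of_int n\<bar> + \<bar>of_int (n - l)\<bar> - \<bar>of_int l\<bar>))"
      using C(2)[of n "n - l"] by (simp add: u_def)
    also have "\<dots> \<le> f (l, n)"
      unfolding f_def prod.case e_def by (intro mult_left_mono u0 exp_dist_le[OF d])
    finally show "norm (case x of (l,n) \<Rightarrow> Hmat T p (of_real k) n (n - l)) \<le> f x" by (simp add: x)
  qed
  ultimately have "(\<lambda>x. norm (case x of (l,n) \<Rightarrow> Hmat T p (of_real k) n (n - l))) summable_on UNIV"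
    by (intro Infinite_Sum.abs_summable_on_comparison_test'[of f]) (auto simp: le_fun_def)
  thus ?thesis
    by (subst summable_on_reindex_bij_witness[of _ "\<lambda>(l,n). (n, n - l)" "\<lambda>(n,m). (n - m, n)" UNIV
          "\<lambda>x. norm (case x of (l,n) \<Rightarrow> Hmat T p (of_real k) n (n - l))"]) auto
qed

lemma fredholm_HmatN_tendsto:
  assumes T: "T > 0"
    and sm: "(\<lambda>l::int. cmod (fcoef T p l) * (1 + (real_of_int l)\<^sup>2) powr (1/4)) summable_on UNIV"
  shows "(\<lambda>N. fredholm_det (HmatN T p N (of_real k)) z) \<longlonglongrightarrow> fredholm_det (Hmat T p (of_real k)) z"
proof -
  let ?H = "Hmat T p (of_real k)" let ?N = "\<lambda>N. HmatN T p N (of_real k)"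
  have S: "(\<lambda>(n,m). cmod (?H n m)) summable_on UNIV" by (rule Hmat_summable[OF T sm])
  have row: "(\<lambda>m. cmod (?H n m)) summable_on UNIV" for n
    using summable_on_SigmaD1[of "\<lambda>n m. cmod (?H n m)" UNIV "\<lambda>_. UNIV" n] S by simp
  define r where "r = (\<lambda>n. \<Sum>\<^sub>\<infinity>m. cmod (?H n m))"
  have r: "r summable_on UNIV" unfolding r_def
    using summable_on_Sigma_banach[of "\<lambda>n m. cmod (?H n m)" UNIV "\<lambda>_. UNIV"] S by simp
  have fin: "{I :: int set. finite I} = Fpow UNIV" by (auto simp: Fpow_def)
  show ?thesis
    unfolding fredholm_det_def fin subdet_eq_pdet
  proof (rule infsum_dominated_convergence[where M = "\<lambda>I. \<Prod>i\<in>I. norm z * r i"])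
    show "(\<lambda>I. \<Prod>i\<in>I. norm z * r i) summable_on Fpow UNIV"
      by (intro summable_prod_Fpow summable_on_cmult_right r mult_nonneg_nonneg) (auto simp: r_def infsum_nonneg)
    fix I :: "int set" assume "I \<in> Fpow UNIV"
    hence I: "finite I" by (simp add: Fpow_def)
    have "norm (pdet (?N N) I) \<le> (\<Prod>i\<in>I. r i)" for N
    proof (rule norm_pdet_le[OF I])
      fix i
      have "(\<Sum>j\<in>I. norm (?N N i j)) \<le> (\<Sum>j\<in>I. norm (?H i j))"
        by (intro sum_mono) (auto simp: HmatN_def)
      also have "\<dots> \<le> r i" unfolding r_def by (intro finite_sum_le_infsum row I) auto
      finally show "(\<Sum>j\<in>I. norm (?N N i j)) \<le> r i" .
    qed
    thus "norm ((- z) ^ card I * pdet (?N N) I) \<le> (\<Prod>i\<in>I. norm z * r i)" for N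
      by (simp add: norm_mult norm_power prod.distrib mult_left_mono)
    \<comment> \<open>This bounds every \<open>\<bar>i - j\<bar>\<close> with \<open>i\<close> and
      \<open>j\<close> in \<open>I\<close>, so from \<open>N0\<close> on the truncation leaves the
      minor unchanged.\<close>
    define N0 where "N0 = (\<Sum>i\<in>I. nat \<bar>i\<bar>) + (\<Sum>i\<in>I. nat \<bar>i\<bar>)"
    have "pdet (?N N) I = pdet ?H I" if N: "N \<ge> N0" for N
    proof (rule pdet_cong)
      fix i j assume ij: "i \<in> I" "j \<in> I"
      have "nat \<bar>i\<bar> \<le> (\<Sum>i\<in>I. nat \<bar>i\<bar>)" "nat \<bar>j\<bar> \<le> (\<Sum>i\<in>I. nat \<bar>i\<bar>)"
        using ij I by (auto intro!: member_le_sum)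
      hence "\<bar>i - j\<bar> \<le> int N" using N unfolding N0_def by linarith
      thus "?N N i j = ?H i j" by (simp add: HmatN_def)
    qed
    hence "\<forall>\<^sub>F N in sequentially. (- z) ^ card I * pdet (?N N) I = (- z) ^ card I * pdet ?H I"
      by (intro eventually_sequentiallyI[of N0]) simp
    thus "(\<lambda>N. (- z) ^ card I * pdet (?N N) I) \<longlonglongrightarrow> (- z) ^ card I * pdet ?H I"
      by (rule tendsto_eventually)
  qed
qed

lemma fredholm_Hmat_eq_prod:
  assumes T: "T > 0"
    and sm: "(\<lambda>l::int. cmod (fcoef T p l) * (1 + (real_of_int l)\<^sup>2) powr (1/4)) summable_on UNIV"
    and bands: "band_functions T p J E"
  shows "(\<lambda>j. \<bar>E j k\<bar>) summable_on J"
    and "fredholm_det (Hmat T p (of_real k)) z = fpow_prod (\<lambda>j. - (z * of_real (E j k))) J"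
proof -
  interpret summable_hermitian "Hmat T p (of_real k)"
    by standard (rule Hmat_summable[OF T sm], rule Hmat_hermitian)
  obtain v where "eigenbasis (Hmat T p (of_real k)) J v (\<lambda>j. E j k)"
    using ex_eigenbasis[of J "\<lambda>j. E j k"] bands unfolding band_functions_def by blast
  then interpret eigenbasis "Hmat T p (of_real k)" J v "\<lambda>j. E j k" .
  show "(\<lambda>j. \<bar>E j k\<bar>) summable_on J" by (rule lam_summable)
  show "fredholm_det (Hmat T p (of_real k)) z = fpow_prod (\<lambda>j. - (z * of_real (E j k))) J"
    by (rule fredholm_det_eq_prod) auto
qed

section \<open>Band functions and the residual determinant\<close>

text \<open>By its power series, a point of the level set is isolated in it or interior to it. The
  interior is then closed as well as open, hence empty for a non-constant function, and a closed set
  of isolated points is countable.\<close>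

lemma real_analytic_level_set_countable:
  assumes f: "real_analytic f" and nc: "\<not> flat f"
  shows "countable {x. f x = c}"
proof -
  define Z where "Z = {x. f x = c}"
  have ser: "\<exists>r>0. \<exists>a. \<forall>y. norm (y - x) < r \<longrightarrow> (\<lambda>n. a n * (y - x) ^ n) sums (f y - c)" for x
  proof -
    obtain r a where r: "r > 0" "\<And>y. \<bar>y - x\<bar> < r \<Longrightarrow> (\<lambda>n. a n * (y - x) ^ n) sums f y"
      using f unfolding real_analytic_def by blast
    have "(\<lambda>n. (a n - (if n = 0 then c else 0)) * (y - x) ^ n) sums (f y - c)" if "\<bar>y - x\<bar> < r" for y
    proof -
      have "(\<lambda>n. (if n = 0 then c else 0) * (y - x) ^ n) sums ((if (0::nat) = 0 then c else 0) * (y - x) ^ 0)"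
        using sums_single[of 0 "\<lambda>n. (if n = 0 then c else 0) * (y - x) ^ n"]
        by (rule sums_cong[THEN iffD1, rotated]) auto
      from sums_diff[OF r(2)[OF that] this] show ?thesis by (simp add: left_diff_distrib)
    qed
    thus ?thesis using r(1) by (intro exI[of _ r] conjI exI[of _ "\<lambda>n. a n - (if n = 0 then c else 0)"]) auto
  qed
  have cont: "isCont f x" for x
  proof -
    obtain r a where r: "r > 0" "\<And>y. norm (y - x) < r \<Longrightarrow> (\<lambda>n. a n * (y - x) ^ n) sums (f y - c)"
      using ser by blast
    have s: "(\<lambda>n. a n * h ^ n) sums (f (x + h) - c)" if "norm h < r" for h
      using r(2)[of "x + h"] that by simp
    have "(\<lambda>h. f (x + h) - c) \<midarrow>0\<rightarrow> a 0"
      by (rule powser_limit_0[OF r(1)]) (use s in auto)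
    moreover have "a 0 = f x - c"
    proof -
      have "(\<lambda>n. a n * 0 ^ n) sums a 0"
        using powser_sums_zero[of a] by simp
      thus ?thesis using s[of 0] r(1) sums_unique2 by fastforce
    qed
    ultimately have "(\<lambda>h. f (x + h) - c + c) \<midarrow>0\<rightarrow> f x - c + c"
      by (intro tendsto_add) auto
    thus ?thesis by (simp add: isCont_iff)
  qed
  have iso: "x \<in> interior Z \<or> (\<exists>s>0. \<forall>y. y \<noteq> x \<and> dist y x \<le> s \<longrightarrow> y \<notin> Z)" if x: "x \<in> Z" for x
  proof -
    obtain r a where r: "r > 0" "\<And>y. norm (y - x) < r \<Longrightarrow> (\<lambda>n. a n * (y - x) ^ n) sums (f y - c)"
      using ser by blast
    show ?thesis
    proof (cases "\<exists>m>0. a m \<noteq> 0")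
      case True
      then obtain m where m: "m > 0" "a m \<noteq> 0" by blast
      have fx: "f x - c = 0" using x by (simp add: Z_def)
      obtain s where "0 < s" "\<And>z. z \<in> cball x s - {x} \<Longrightarrow> f z - c \<noteq> 0"
        using powser_0_nonzero[where f = "\<lambda>y. f y - c", OF r(1) r(2) fx m(2,1)] by blast
      thus ?thesis by (intro disjI2 exI[of _ s]) (auto simp: Z_def dist_commute)
    next
      case False
      have "f y = c" if y: "norm (y - x) < r" for y
      proof -
        have a0: "(\<lambda>n. a n * (z - x) ^ n) sums a 0" for z
        proof -
          have "(\<lambda>n. a n * (z - x) ^ n) = (\<lambda>n. if n = 0 then a 0 else 0)"
          proof (rule ext)
            fix n
            have "a n = 0" if "n > 0" using False that by blast
            thus "a n * (z - x) ^ n = (if n = 0 then a 0 else 0)" by (cases "n = 0") auto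
          qed
          thus ?thesis using sums_single[of 0 "\<lambda>_. a 0"] by simp
        qed
        have "f y - c = a 0" using sums_unique2[OF r(2)[OF y] a0] .
        moreover have "f x - c = a 0" using sums_unique2[OF r(2)[of x] a0] r(1) by simp
        ultimately show ?thesis using x by (simp add: Z_def)
      qed
      hence "ball x r \<subseteq> Z" by (auto simp: Z_def dist_norm norm_minus_commute)
      thus ?thesis using r(1) by (intro disjI1) (meson centre_in_ball interior_maximal open_ball subsetD)
    qed
  qed
  have "closed Z" unfolding Z_def using cont
    by (intro closed_Collect_eq continuous_at_imp_continuous_on ballI) auto
  have "closed (interior Z)"
  proof -
    have "x \<in> interior Z" if x: "x \<in> closure (interior Z)" for x
    proof (rule ccontr)
      assume n: "x \<notin> interior Z"
      have "x \<in> Z" using x \<open>closed Z\<close> closure_mono[OF interior_subset[of Z]] by auto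
      then obtain s where s: "s > 0" "\<And>y. y \<noteq> x \<Longrightarrow> dist y x \<le> s \<Longrightarrow> y \<notin> Z" using iso n by blast
      obtain y where "y \<in> interior Z" "dist y x < s" using x s(1) closure_approachable by blast
      thus False using s(2)[of y] n interior_subset[of Z] by (cases "y = x") auto
    qed
    thus ?thesis by (metis closure_subset closure_eq subset_antisym subsetI)
  qed
  hence "interior Z = {} \<or> interior Z = UNIV" using connected_UNIV[where 'a = real] unfolding connected_clopen by simp
  moreover have "interior Z \<noteq> UNIV"
  proof
    assume "interior Z = UNIV"
    hence "Z = UNIV" using interior_subset by blast
    hence "\<forall>k. f k = c" by (auto simp: Z_def)
    thus False using nc unfolding flat_def by blast
  qed
  ultimately have "interior Z = {}" by blast
  hence isol: "\<exists>s>0. \<forall>y. y \<noteq> x \<and> dist y x \<le> s \<longrightarrow> y \<notin> Z" if "x \<in> Z" for x using iso[OF that] by blast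
  have "\<not> x islimpt Z" for x
  proof
    assume x: "x islimpt Z"
    hence "x \<in> Z" using \<open>closed Z\<close> closed_limpt by blast
    thus False using isol[of x] x unfolding islimpt_approachable by (meson less_imp_le)
  qed
  hence "Z sparse_in UNIV" unfolding sparse_in_def by blast
  hence "countable (UNIV \<inter> Z)" by (intro sparse_imp_countable open_UNIV)
  thus ?thesis by (simp add: Z_def)
qed

text \<open>The complement of a countable set is dense in the plane. This is how factors with
  countably many zeros, such as \<phi>, are cancelled.\<close>

lemma continuous_eq_off_countable:
  fixes f g :: "complex \<Rightarrow> complex"
  assumes "continuous_on UNIV f" "continuous_on UNIV g" "countable S" "\<And>z. z \<notin> S \<Longrightarrow> f z = g z"
  shows "f z = g z"
proof -
  have "closed {z. f z = g z}" using assms(1,2) by (rule closed_Collect_eq)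
  moreover have "- S \<subseteq> {z. f z = g z}" using assms(4) by auto
  ultimately have "closure (- S) \<subseteq> {z. f z = g z}" by (intro closure_minimal)
  moreover have "interior S = {}"
  proof (rule ccontr)
    assume "interior S \<noteq> {}"
    then obtain x e where "e > 0" "ball x e \<subseteq> S" by (auto simp: mem_interior)
    thus False using assms(3) uncountable_ball countable_subset by blast
  qed
  ultimately show ?thesis by (auto simp: closure_complement)
qed

section \<open>Separation of the flat bands\<close>

locale smooth_hankel =
  fixes T :: real and p :: "real \<Rightarrow> real" and J :: "nat set" and E :: "nat \<Rightarrow> real \<Rightarrow> real"
  assumes T_pos: "T > 0"
    and p_smooth: "(\<lambda>l::int. cmod (fcoef T p l) * (1 + (real_of_int l)\<^sup>2) powr (1/4)) summable_on UNIV"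
    and bands: "band_functions T p J E"
begin

lemma E_summable: "(\<lambda>j. norm (complex_of_real (E j k))) summable_on X" if "X \<subseteq> J"
  using summable_on_subset[OF fredholm_Hmat_eq_prod(1)[OF T_pos p_smooth bands, of k] that] by simp

lemma zE_summable: "(\<lambda>j. norm (- (z * complex_of_real (E j k)))) summable_on X" if "X \<subseteq> J"
  using summable_on_cmult_right[OF E_summable[OF that, of k], of "norm z"] by (simp add: norm_mult)

definition full_prod :: "real \<Rightarrow> complex \<Rightarrow> complex" where
  "full_prod k z = fpow_prod (\<lambda>j. - (z * complex_of_real (E j k))) J"

lemma of_real_not_Lam: "complex_of_real k \<notin> Lam T"
  unfolding Lam_eq by (rule real_not_pole)

lemma fredholm_tendsto:
  "(\<lambda>N. fredholm_det (HmatN T p N (of_real k)) z) \<longlonglongrightarrow> full_prod k z"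
  using fredholm_HmatN_tendsto[OF T_pos p_smooth, of k z]
  unfolding full_prod_def fredholm_Hmat_eq_prod(2)[OF T_pos p_smooth bands] .

lemma ex_two_points: "\<exists>k1 k2 :: real. Pfun T (of_real k1) \<noteq> Pfun T (of_real k2)"
  unfolding Pfun_eq by (rule sech_sum_nonconstant_on_reals[OF omega_pos[OF T_pos]])

text \<open>The coefficients of a truncated determinant are the same expressions in its values at
  \<open>k1\<close> and \<open>k2\<close> as \<open>al\<close> and \<open>be\<close> are in
  \<open>full_prod\<close>. Convergence at these two points therefore yields convergence for every
  \<open>s\<close> outside \<open>Lam T\<close>.\<close>

lemma Delta_affine:
  obtains al be where
    "\<And>s lam. s \<notin> Lam T \<Longrightarrow> Delta T p s lam = - al (1 / lam) * Pfun T s + be (1 / lam)"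
    "\<And>z. al (- z) = - al z" "\<And>z. be (- z) = be z"
    "\<And>k z. full_prod k z = - al z * Pfun T (of_real k) + be z"
proof -
  obtain k1 k2 :: real where k12: "Pfun T (of_real k1) \<noteq> Pfun T (of_real k2)" using ex_two_points by blast
  let ?P = "\<lambda>k. Pfun T (complex_of_real k)"
  define al where "al = (\<lambda>z. (full_prod k2 z - full_prod k1 z) / (?P k1 - ?P k2))"
  define be where "be = (\<lambda>z. full_prod k1 z + al z * ?P k1)"
  have main: "(\<lambda>N. fredholm_det (HmatN T p N s) z) \<longlonglongrightarrow> - al z * Pfun T s + be z"
    "(\<lambda>N. fredholm_det (HmatN T p N s) (- z)) \<longlonglongrightarrow> al z * Pfun T s + be z"
    if s: "s \<notin> Lam T" for s z
  proof -
    have "\<forall>N. \<exists>A B. \<forall>s. s \<notin> Lam T \<longrightarrow>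
       fredholm_det (HmatN T p N s) z = - A * Pfun T s + B \<and> fredholm_det (HmatN T p N s) (- z) = A * Pfun T s + B"
      using fredholm_HmatN_affine[OF T_pos] by blast
    then obtain A B where AB: "\<And>N s. s \<notin> Lam T \<Longrightarrow>
       fredholm_det (HmatN T p N s) z = - A N * Pfun T s + B N \<and> fredholm_det (HmatN T p N s) (- z) = A N * Pfun T s + B N"
      by metis
    have AN: "A N = (fredholm_det (HmatN T p N (of_real k2)) z - fredholm_det (HmatN T p N (of_real k1)) z) / (?P k1 - ?P k2)" for N
    proof -
      have "fredholm_det (HmatN T p N (of_real k2)) z - fredholm_det (HmatN T p N (of_real k1)) z = A N * (?P k1 - ?P k2)"
        using AB[OF of_real_not_Lam, of N k1] AB[OF of_real_not_Lam, of N k2] by (simp add: algebra_simps)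
      thus ?thesis using k12 by simp
    qed
    have A: "A \<longlonglongrightarrow> al z"
      unfolding AN[abs_def] al_def using k12 by (intro tendsto_intros fredholm_tendsto) auto
    have BN: "B N = fredholm_det (HmatN T p N (of_real k1)) z + A N * ?P k1" for N
      using AB[OF of_real_not_Lam, of N k1] by (simp add: algebra_simps)
    have B: "B \<longlonglongrightarrow> be z"
      unfolding BN[abs_def] be_def by (intro tendsto_intros fredholm_tendsto A)
    show "(\<lambda>N. fredholm_det (HmatN T p N s) z) \<longlonglongrightarrow> - al z * Pfun T s + be z"
      using AB[OF s] by (simp only:) (intro tendsto_intros A B)
    show "(\<lambda>N. fredholm_det (HmatN T p N s) (- z)) \<longlonglongrightarrow> al z * Pfun T s + be z"
      using AB[OF s] by (simp only:) (intro tendsto_intros A B)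
  qed
  have full: "full_prod k z = - al z * ?P k + be z" for k z
    by (rule LIMSEQ_unique[OF fredholm_tendsto main(1)[OF of_real_not_Lam]])
  have fullm: "full_prod k (- z) = al z * ?P k + be z" for k z
    by (rule LIMSEQ_unique[OF fredholm_tendsto main(2)[OF of_real_not_Lam]])
  have odd: "al (- z) = - al z" for z
  proof -
    have "al (- z) = al z * (?P k2 - ?P k1) / (?P k1 - ?P k2)"
      unfolding al_def[THEN fun_cong, of "- z"] fullm by (simp add: algebra_simps)
    also have "\<dots> = - al z" using k12 by (simp add: field_simps)
    finally show ?thesis .
  qed
  have even: "be (- z) = be z" for z
    using full[of k1 "- z"] fullm[of k1 z] odd[of z] by simp
  have "Delta T p s lam = - al (1 / lam) * Pfun T s + be (1 / lam)" if "s \<notin> Lam T" for s lam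
    unfolding Delta_def by (rule limI[OF main(1)[OF that]])
  thus ?thesis using odd even full by (rule that)
qed

definition Jf :: "nat set" where "Jf = {j \<in> J. flat (E j)}"
definition Jn :: "nat set" where "Jn = {j \<in> J. \<not> flat (E j)}"

definition \<phi> :: "complex \<Rightarrow> complex" where
  "\<phi> z = fpow_prod (\<lambda>j. - (z * complex_of_real (E j 0))) Jf"

definition \<psi> :: "real \<Rightarrow> complex \<Rightarrow> complex" where
  "\<psi> k z = fpow_prod (\<lambda>j. - (z * complex_of_real (E j k))) Jn"

lemma Jf_sub: "Jf \<subseteq> J" and Jn_sub: "Jn \<subseteq> J" by (auto simp: Jf_def Jn_def)

lemma E_nz: "j \<in> J \<Longrightarrow> E j k \<noteq> 0"
  using bands by (auto simp: band_functions_def)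

lemma full_prod_split: "full_prod k z = \<phi> z * \<psi> k z"
proof -
  have J: "J = Jf \<union> Jn" "Jf \<inter> Jn = {}" by (auto simp: Jf_def Jn_def)
  have "full_prod k z = fpow_prod (\<lambda>j. - (z * complex_of_real (E j k))) (Jf \<union> Jn)"
    by (simp add: full_prod_def J(1)[symmetric])
  also have "\<dots> = fpow_prod (\<lambda>j. - (z * complex_of_real (E j k))) Jf * \<psi> k z"
    unfolding \<psi>_def by (rule fpow_prod_Un[OF _ J(2)]) (use zE_summable[of J z k] J(1) in simp)
  also have "fpow_prod (\<lambda>j. - (z * complex_of_real (E j k))) Jf = \<phi> z"
    unfolding \<phi>_def by (rule fpow_prod_cong) (auto simp: Jf_def flat_def)
  finally show ?thesis .
qed

lemma \<psi>_holo: "\<psi> k holomorphic_on UNIV"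
  unfolding \<psi>_def[abs_def] by (rule holomorphic_fpow_prod[OF E_summable[OF Jn_sub]])

lemma Delta_flat_eq: "Delta_flat J E lam = \<phi> (1 / lam)"
proof -
  have "(if j \<in> J \<and> flat (E j) then 1 - complex_of_real (E j 0) / lam else 1) =
        (if j \<in> Jf then 1 + - (1 / lam * complex_of_real (E j 0)) else 1)" for j
    by (simp add: Jf_def)
  thus ?thesis
    unfolding Delta_flat_def \<phi>_def fpow_prod_eq_prodinf(1)[OF zE_summable[OF Jf_sub]] by presburger
qed

lemma \<phi>_zeros_countable: "countable {z. \<phi> z = 0}"
proof (rule countable_subset)
  show "{z. \<phi> z = 0} \<subseteq> (\<lambda>j. 1 / complex_of_real (E j 0)) ` J"
  proof
    fix z assume "z \<in> {z. \<phi> z = 0}"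
    hence "\<not> (\<forall>j\<in>Jf. - (z * complex_of_real (E j 0)) \<noteq> - 1)"
      using fpow_prod_eq_prodinf(3)[OF zE_summable[OF Jf_sub, of z 0]] by (auto simp: \<phi>_def)
    then obtain j where "j \<in> Jf" "z * complex_of_real (E j 0) = 1" by auto
    thus "z \<in> (\<lambda>j. 1 / complex_of_real (E j 0)) ` J"
      using Jf_sub by (intro image_eqI[of _ _ j]) (auto simp: eq_divide_eq)
  qed
qed auto

text \<open>Otherwise every real \<open>k\<close> would lie in the level set of some non-flat band
  at the value \<open>1 / z\<close>, and countably many countable sets would cover the
  reals.\<close>

lemma \<psi>_not_all_zero: "\<exists>k. \<psi> k z \<noteq> 0"
proof (rule ccontr)
  assume "\<not> (\<exists>k. \<psi> k z \<noteq> 0)"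
  hence z: "\<psi> k z = 0" for k by blast
  have "\<exists>j\<in>Jn. z * complex_of_real (E j k) = 1" for k
    using z[of k] fpow_prod_eq_prodinf(3)[OF zE_summable[OF Jn_sub, of z k]] by (auto simp: \<psi>_def)
  hence "\<exists>j\<in>Jn. E j k = Re (1 / z)" for k
    by (metis Re_complex_of_real divide_self_if mult_eq_0_iff nonzero_mult_div_cancel_left zero_neq_one)
  hence "(UNIV :: real set) \<subseteq> (\<Union>j\<in>Jn. {k. E j k = Re (1 / z)})" by blast
  moreover have "countable (\<Union>j\<in>Jn. {k. E j k = Re (1 / z)})"
    using bands by (intro countable_UN real_analytic_level_set_countable)
      (auto simp: Jn_def band_functions_def)
  ultimately show False using uncountable_UNIV_real countable_subset by blast
qed

lemma \<psi>_eq_0: "j \<in> Jn \<Longrightarrow> \<psi> k (1 / complex_of_real (E j k)) = 0"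
  unfolding \<psi>_def using E_nz[of j k] Jn_sub
  by (intro fpow_prod_eq_prodinf(2)[OF zE_summable[OF Jn_sub]]) auto

lemma cnj_\<psi>: "cnj (\<psi> k z) = \<psi> k (cnj z)"
  unfolding \<psi>_def fpow_prod_def by (simp flip: infsum_cnj)

text \<open>The zero of \<open>\<phi>\<close> at \<open>1/e\<close> has order \<open>card {j \<in> Jf. E j 0 = e}\<close>. Since \<open>\<phi> a\<close> is odd and \<open>\<phi> b\<close> is even,
  and \<open>a\<close>, \<open>b\<close> have no common zero, the orders at \<open>1/e\<close> and \<open>- 1/e\<close> agree.\<close>

lemma \<phi>_factor:
  assumes e: "e \<noteq> 0"
  obtains \<rho> where "continuous_on UNIV \<rho>" "\<rho> (1 / complex_of_real e) \<noteq> 0"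
    "\<And>z. \<phi> z = (1 - z * of_real e) ^ card {j\<in>Jf. E j 0 = e} * \<rho> z"
proof -
  define X where "X = {j\<in>Jf. E j 0 = e}"
  define Y where "Y = {j\<in>Jf. E j 0 \<noteq> e}"
  have XY: "Jf = X \<union> Y" "X \<inter> Y = {}" by (auto simp: X_def Y_def)
  have Y: "Y \<subseteq> J" using Jf_sub by (auto simp: Y_def)
  have "finite {j\<in>J. complex_of_real (E j 0) = complex_of_real e}"
    using bands e unfolding band_functions_def by (metis of_real_eq_0_iff)
  hence X: "finite X" by (rule finite_subset[rotated]) (auto simp: X_def Jf_def)
  define \<rho> where "\<rho> = (\<lambda>z. fpow_prod (\<lambda>j. - (z * complex_of_real (E j 0))) Y)"
  have "continuous_on UNIV \<rho>" unfolding \<rho>_def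
    by (intro holomorphic_on_imp_continuous_on holomorphic_fpow_prod E_summable Y)
  moreover have "\<rho> (1 / complex_of_real e) \<noteq> 0" unfolding \<rho>_def
    by (rule fpow_prod_eq_prodinf(3)[OF zE_summable[OF Y]]) (use e in \<open>auto simp: Y_def divide_eq_eq\<close>)
  moreover have "\<phi> z = (1 - z * of_real e) ^ card {j\<in>Jf. E j 0 = e} * \<rho> z" for z
  proof -
    have "\<phi> z = fpow_prod (\<lambda>j. - (z * complex_of_real (E j 0))) (X \<union> Y)"
      unfolding \<phi>_def by (simp only: XY(1))
    also have "\<dots> = fpow_prod (\<lambda>j. - (z * complex_of_real (E j 0))) X * \<rho> z"
      unfolding \<rho>_def using zE_summable[OF Jf_sub, of z 0] XY(1) by (intro fpow_prod_Un XY(2)) simp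
    also have "fpow_prod (\<lambda>j. - (z * complex_of_real (E j 0))) X = (\<Prod>j\<in>X. 1 - z * of_real e)"
      unfolding fpow_prod_finite[OF X] by (intro prod.cong) (auto simp: X_def)
    finally show ?thesis by (simp add: X_def)
  qed
  ultimately show ?thesis by (rule that)
qed

text \<open>Suppose the order of \<phi> at \<open>u = 1 / e\<close> exceeds that at
  \<open>- u\<close>. Cancelling the common power of \<open>1 - z * e\<close> in either symmetry
  relation leaves a zero at \<open>u\<close> on one side only, which forces
  \<open>c (- u) = 0\<close> for both \<open>c = a\<close> and \<open>c = b\<close>.\<close>

lemma flat_multiplicity_le:
  assumes a: "continuous_on UNIV a" "\<And>z. \<phi> (- z) * a (- z) = - (\<phi> z * a z)"
    and b: "continuous_on UNIV b" "\<And>z. \<phi> (- z) * b (- z) = \<phi> z * b z"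
    and nz: "\<And>z. a z \<noteq> 0 \<or> b z \<noteq> 0" and e: "e \<noteq> 0"
  shows "card {j\<in>Jf. E j 0 = e} \<le> card {j\<in>Jf. E j 0 = - e}"
proof (rule ccontr)
  define m where "m = card {j\<in>Jf. E j 0 = e}"
  define m' where "m' = card {j\<in>Jf. E j 0 = - e}"
  assume "\<not> ?thesis"
  hence mm: "m = m' + (m - m')" "m - m' > 0" by (auto simp: m_def m'_def)
  obtain \<rho> where \<rho>: "continuous_on UNIV \<rho>" "\<And>z. \<phi> z = (1 - z * of_real e) ^ m * \<rho> z"
    using \<phi>_factor[OF e] unfolding m_def by blast
  have ne: "- e \<noteq> 0" using e by simp
  obtain \<rho>' where \<rho>': "continuous_on UNIV \<rho>'" "\<rho>' (1 / complex_of_real (- e)) \<noteq> 0"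
      "\<And>z. \<phi> z = (1 - z * of_real (- e)) ^ m' * \<rho>' z"
    using \<phi>_factor[OF ne] unfolding m'_def by blast
  have cm: "continuous_on UNIV (\<lambda>z. f (- z))" if "continuous_on UNIV f" for f :: "complex \<Rightarrow> complex"
    by (rule continuous_on_compose2[OF that]) (auto intro!: continuous_intros)
  have key: "c (- 1 / complex_of_real e) = 0"
    if c: "continuous_on UNIV c" "\<And>z. \<phi> (- z) * c (- z) = \<epsilon> * (\<phi> z * c z)" for c \<epsilon>
  proof -
    define u where "u = 1 / complex_of_real e"
    have "\<rho>' (- u) * c (- u) = \<epsilon> * ((1 - u * of_real e) ^ (m - m') * \<rho> u * c u)"
    proof (rule continuous_eq_off_countable[of "\<lambda>z. \<rho>' (- z) * c (- z)"
              "\<lambda>z. \<epsilon> * ((1 - z * of_real e) ^ (m - m') * \<rho> z * c z)" "{u}"])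
      show "continuous_on UNIV (\<lambda>z. \<rho>' (- z) * c (- z))"
        by (intro continuous_on_mult cm \<rho>' c)
      show "continuous_on UNIV (\<lambda>z. \<epsilon> * ((1 - z * of_real e) ^ (m - m') * \<rho> z * c z))"
        by (intro continuous_intros \<rho> c)
      fix z assume "z \<notin> {u}"
      hence z: "1 - z * of_real e \<noteq> 0" using e by (auto simp: u_def eq_divide_eq)
      have "(1 - z * of_real e) ^ m = (1 - z * of_real e) ^ m' * (1 - z * of_real e) ^ (m - m')"
        by (subst mm(1)) (rule power_add)
      moreover have "\<phi> (- z) = (1 - z * of_real e) ^ m' * \<rho>' (- z)" using \<rho>'(3)[of "- z"] by simp
      ultimately have "(1 - z * of_real e) ^ m' * (\<rho>' (- z) * c (- z)) =
          (1 - z * of_real e) ^ m' * (\<epsilon> * ((1 - z * of_real e) ^ (m - m') * \<rho> z * c z))"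
        using c(2)[of z] \<rho>(2)[of z] by (simp add: mult_ac)
      thus "\<rho>' (- z) * c (- z) = \<epsilon> * ((1 - z * of_real e) ^ (m - m') * \<rho> z * c z)"
        using z by simp
    qed auto
    also have "1 - u * of_real e = 0" using e by (simp add: u_def)
    finally have "\<rho>' (- u) * c (- u) = 0" by (simp only: zero_power[OF mm(2)]) simp
    thus ?thesis using \<rho>'(2) by (simp add: u_def)
  qed
  have "a (- 1 / complex_of_real e) = 0" by (rule key[of a "- 1"]) (use a in auto)
  moreover have "b (- 1 / complex_of_real e) = 0" by (rule key[of b 1]) (use b in auto)
  ultimately show False using nz by blast
qed

text \<open>The inequality for \<open>e\<close> and for \<open>- e\<close> gives equal numbers of
  flat bands with these values, hence a permutation \<sigma> of \<open>Jf\<close> that negates the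
  value of each band.\<close>

lemma \<phi>_even:
  assumes "\<And>e. e \<noteq> 0 \<Longrightarrow> card {j\<in>Jf. E j 0 = e} \<le> card {j\<in>Jf. E j 0 = - e}"
  shows "\<phi> (- z) = \<phi> z"
proof -
  define S where "S = (\<lambda>e. {j\<in>Jf. E j 0 = e})"
  have fin: "finite (S e)" if "e \<noteq> 0" for e
  proof -
    have "finite {j\<in>J. complex_of_real (E j 0) = complex_of_real e}"
      using bands that unfolding band_functions_def by (metis of_real_eq_0_iff)
    thus ?thesis by (rule finite_subset[rotated]) (auto simp: S_def Jf_def)
  qed
  have card: "card (S e) = card (S (- e))" if "e \<noteq> 0" for e
    using assms[OF that] assms[of "- e"] that by (simp add: S_def)
  have "\<exists>h. bij_betw h (S e) (S (- e))" if "e \<noteq> 0" for e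
    by (rule finite_same_card_bij[OF fin[OF that] fin card[OF that]]) (use that in simp)
  then obtain h where h: "\<And>e. e \<noteq> 0 \<Longrightarrow> bij_betw (h e) (S e) (S (- e))" by metis
  define \<sigma> where "\<sigma> = (\<lambda>j. h (E j 0) j)"
  have nzf: "E j 0 \<noteq> 0" if "j \<in> Jf" for j using E_nz that Jf_sub by blast
  have \<sigma>S: "\<sigma> j \<in> S (- E j 0)" if "j \<in> Jf" for j
    using bij_betwE[OF h[OF nzf[OF that]]] that by (auto simp: S_def \<sigma>_def)
  have bij: "bij_betw \<sigma> Jf Jf"
    unfolding bij_betw_def
  proof
    show "inj_on \<sigma> Jf"
    proof (rule inj_onI)
      fix i j assume ij: "i \<in> Jf" "j \<in> Jf" "\<sigma> i = \<sigma> j"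
      hence eq: "E i 0 = E j 0" using \<sigma>S[OF ij(1)] \<sigma>S[OF ij(2)] by (auto simp: S_def)
      hence "h (E j 0) i = h (E j 0) j" using ij(3) by (simp add: \<sigma>_def)
      thus "i = j" using bij_betw_imp_inj_on[OF h[OF nzf[OF ij(2)]]] ij eq by (auto simp: inj_on_def S_def)
    qed
    show "\<sigma> ` Jf = Jf"
    proof (intro equalityI subsetI)
      fix j assume j: "j \<in> Jf"
      have "h (- E j 0) ` S (- E j 0) = S (E j 0)"
        using bij_betw_imp_surj_on[OF h[of "- E j 0"]] nzf[OF j] by simp
      moreover have "j \<in> S (E j 0)" using j by (simp add: S_def)
      ultimately have "j \<in> h (- E j 0) ` S (- E j 0)" by (simp only:)
      then obtain i where i: "i \<in> S (- E j 0)" "h (- E j 0) i = j" by (elim imageE) (simp only:)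
      have iJ: "i \<in> Jf" "E i 0 = - E j 0" using i(1) by (simp_all add: S_def)
      have "\<sigma> i = j" unfolding \<sigma>_def iJ(2) by (rule i(2))
      thus "j \<in> \<sigma> ` Jf" using imageI[OF iJ(1), of \<sigma>] by (simp only:)
    qed (use \<sigma>S in \<open>auto simp: S_def\<close>)
  qed
  have "\<phi> (- z) = fpow_prod (\<lambda>j. - (z * complex_of_real (E (\<sigma> j) 0))) Jf"
    unfolding \<phi>_def by (rule fpow_prod_cong) (use \<sigma>S in \<open>auto simp: S_def\<close>)
  also have "\<dots> = \<phi> z" unfolding \<phi>_def by (rule fpow_prod_bij[OF bij])
  finally show ?thesis .
qed

text \<open>Solving for \<open>a\<close> and \<open>b\<close> from \<psi> at two real points makes
  them entire at once. That \<open>al\<close> and \<open>be\<close> are \<phi> times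
  \<open>a\<close> and \<open>b\<close> follows afterwards, and parity passes to \<open>a\<close>
  and \<open>b\<close> once \<phi> is known to be even.\<close>

lemma residual_coefficients:
  obtains a b where "a holomorphic_on UNIV" "b holomorphic_on UNIV"
    "\<And>z. a (- z) = - a z" "\<And>z. b (- z) = b z"
    "\<And>z. cnj (a z) = a (cnj z)" "\<And>z. cnj (b z) = b (cnj z)"
    "\<And>j k. j \<in> Jn \<Longrightarrow> a (1 / of_real (E j k)) \<noteq> 0"
    "\<And>s lam. s \<notin> Lam T \<Longrightarrow> Delta T p s lam = \<phi> (1 / lam) * (- a (1 / lam) * Pfun T s + b (1 / lam))"
proof -
  obtain al be where albe:
    "\<And>s lam. s \<notin> Lam T \<Longrightarrow> Delta T p s lam = - al (1 / lam) * Pfun T s + be (1 / lam)"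
    "\<And>z. al (- z) = - al z" "\<And>z. be (- z) = be z"
    "\<And>k z. full_prod k z = - al z * Pfun T (of_real k) + be z"
    using Delta_affine by blast
  obtain k1 k2 :: real where k12: "Pfun T (of_real k1) \<noteq> Pfun T (of_real k2)" using ex_two_points by blast
  let ?P = "\<lambda>k. Pfun T (complex_of_real k)"
  have P_real: "cnj (?P k) = ?P k" for k unfolding Pfun_eq by (rule cnj_sech_sum_of_real)
  define a where "a = (\<lambda>z. (\<psi> k2 z - \<psi> k1 z) / (?P k1 - ?P k2))"
  define b where "b = (\<lambda>z. \<psi> k1 z + a z * ?P k1)"
  have hola: "a holomorphic_on UNIV"
    unfolding a_def using k12 by (intro holomorphic_intros \<psi>_holo) auto
  have holb: "b holomorphic_on UNIV"
    unfolding b_def by (intro holomorphic_intros \<psi>_holo hola)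
  have conta: "continuous_on UNIV a" and contb: "continuous_on UNIV b"
    using hola holb by (auto intro: holomorphic_on_imp_continuous_on)
  have al: "al z = \<phi> z * a z" for z
  proof -
    have "al z * (?P k1 - ?P k2) = full_prod k2 z - full_prod k1 z"
      unfolding albe(4) by (simp add: algebra_simps)
    also have "\<dots> = \<phi> z * (\<psi> k2 z - \<psi> k1 z)" by (simp add: full_prod_split right_diff_distrib)
    also have "\<psi> k2 z - \<psi> k1 z = a z * (?P k1 - ?P k2)" using k12 by (simp add: a_def)
    finally show ?thesis using k12 by simp
  qed
  have be: "be z = \<phi> z * b z" for z
  proof -
    have "be z = full_prod k1 z + al z * ?P k1" unfolding albe(4) by simp
    thus ?thesis by (simp add: full_prod_split al b_def algebra_simps)
  qed
  have \<psi>_eq: "\<psi> k z = - a z * ?P k + b z" for k z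
  proof (rule continuous_eq_off_countable[of "\<psi> k" "\<lambda>z. - a z * ?P k + b z", OF _ _ \<phi>_zeros_countable])
    show "continuous_on UNIV (\<psi> k)" by (rule holomorphic_on_imp_continuous_on[OF \<psi>_holo])
    show "continuous_on UNIV (\<lambda>z. - a z * ?P k + b z)" by (intro continuous_intros conta contb)
    fix z assume "z \<notin> {z. \<phi> z = 0}"
    moreover have "\<phi> z * \<psi> k z = \<phi> z * (- a z * ?P k + b z)"
      using albe(4)[of k z] unfolding full_prod_split al be by (simp add: algebra_simps)
    ultimately show "\<psi> k z = - a z * ?P k + b z" by simp
  qed
  have nz: "a z \<noteq> 0 \<or> b z \<noteq> 0" for z
    using \<psi>_not_all_zero[of z] unfolding \<psi>_eq by auto
  have \<phi>a: "\<phi> (- z) * a (- z) = - (\<phi> z * a z)" and \<phi>b: "\<phi> (- z) * b (- z) = \<phi> z * b z" for z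
    using albe(2,3)[of z] unfolding al be by auto
  have even: "\<phi> (- z) = \<phi> z" for z
    by (rule \<phi>_even) (rule flat_multiplicity_le[OF conta \<phi>a contb \<phi>b nz])
  have cm: "continuous_on UNIV (\<lambda>z. f (- z))" if "continuous_on UNIV f" for f :: "complex \<Rightarrow> complex"
    by (rule continuous_on_compose2[OF that]) (auto intro!: continuous_intros)
  have a_odd: "a (- z) = - a z" for z
  proof (rule continuous_eq_off_countable[of "\<lambda>z. a (- z)" "\<lambda>z. - a z", OF cm[OF conta] _ \<phi>_zeros_countable])
    show "continuous_on UNIV (\<lambda>z. - a z)" by (intro continuous_on_minus conta)
    fix z assume "z \<notin> {z. \<phi> z = 0}"
    hence z: "\<phi> z \<noteq> 0" by simp
    have "\<phi> z * a (- z) = \<phi> z * - a z" using \<phi>a[of z] unfolding even by simp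
    thus "a (- z) = - a z" by (rule mult_left_cancel[OF z, THEN iffD1])
  qed
  have b_even: "b (- z) = b z" for z
  proof (rule continuous_eq_off_countable[of "\<lambda>z. b (- z)" b, OF cm[OF contb] contb \<phi>_zeros_countable])
    fix z assume "z \<notin> {z. \<phi> z = 0}"
    hence z: "\<phi> z \<noteq> 0" by simp
    have "\<phi> z * b (- z) = \<phi> z * b z" using \<phi>b[of z] unfolding even .
    thus "b (- z) = b z" by (rule mult_left_cancel[OF z, THEN iffD1])
  qed
  have a_cnj: "cnj (a z) = a (cnj z)" for z by (simp add: a_def cnj_\<psi> P_real)
  have b_cnj: "cnj (b z) = b (cnj z)" for z by (simp add: b_def cnj_\<psi> P_real a_cnj)
  have a_nz: "a (1 / of_real (E j k)) \<noteq> 0" if "j \<in> Jn" for j k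
  proof
    assume a0: "a (1 / of_real (E j k)) = 0"
    hence "b (1 / of_real (E j k)) = 0" using \<psi>_eq_0[OF that, of k] unfolding \<psi>_eq by simp
    thus False using a0 nz by blast
  qed
  have "Delta T p s lam = \<phi> (1 / lam) * (- a (1 / lam) * Pfun T s + b (1 / lam))" if "s \<notin> Lam T" for s lam
    unfolding albe(1)[OF that] al be by (simp add: algebra_simps)
  with hola holb a_odd b_even a_cnj b_cnj a_nz show ?thesis by (rule that)
qed

end

lemma half_periods_not_Lam:
  assumes "T > 0"
  shows "(complex_of_real (omega T) + \<i>) / 2 \<notin> Lam T"
proof
  assume "(complex_of_real (omega T) + \<i>) / 2 \<in> Lam T"
  then obtain n m :: int where "(complex_of_real (omega T) + \<i>) / 2 = complex_of_real (omega T * of_int n) + \<i> * (of_int m + 1/2)"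
    unfolding Lam_def by blast
  from arg_cong[OF this, of Re] have "omega T * (2 * real_of_int n - 1) = 0" by (simp add: algebra_simps)
  hence "2 * real_of_int n - 1 = 0" using omega_pos[OF assms] by simp
  hence "real_of_int (2 * n - 1) = 0" by simp
  hence "2 * n - 1 = 0" by (simp only: of_int_eq_0_iff)
  thus False by presburger
qed

theorem theorem7p5:
  fixes T :: real and p :: "real \<Rightarrow> real"
    and J :: "nat set" and E :: "nat \<Rightarrow> real \<Rightarrow> real"
    and D :: "complex \<Rightarrow> complex \<Rightarrow> complex"
  assumes T_pos: "T > 0"
    and p_periodic: "\<forall>x. p (x + T) = p x"
    and p_int: "p absolutely_integrable_on {0..T}"
    and p_smooth: "(\<lambda>l::int. cmod (fcoef T p l) * (1 + (real_of_int l)\<^sup>2) powr (1/4)) summable_on UNIV"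
    and bands: "band_functions T p J E"
    and resid: "residual_det T p J E D"
  shows "(\<forall>s lam. s \<notin> Lam T \<and> lam \<noteq> 0 \<longrightarrow>
            D s lam = - alpha D lam * Pfun T s + beta T D lam)
       \<and> entire_in_inverse (alpha D) \<and> entire_in_inverse (beta T D)
       \<and> (\<forall>lam. lam \<noteq> 0 \<longrightarrow> cnj (alpha D lam) = alpha D (cnj lam) \<and> cnj (beta T D lam) = beta T D (cnj lam))
       \<and> (\<forall>lam. lam \<noteq> 0 \<longrightarrow> alpha D (- lam) = - alpha D lam \<and> beta T D (- lam) = beta T D lam)
       \<and> (\<forall>j\<in>J. \<not> flat (E j) \<longrightarrow> (\<forall>k. alpha D (complex_of_real (E j k)) \<noteq> 0))"
proof -
  interpret smooth_hankel T p J E by standard (rule T_pos p_smooth bands)+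
  obtain a b where ab: "a holomorphic_on UNIV" "b holomorphic_on UNIV"
    "\<And>z. a (- z) = - a z" "\<And>z. b (- z) = b z"
    "\<And>z. cnj (a z) = a (cnj z)" "\<And>z. cnj (b z) = b (cnj z)"
    "\<And>j k. j \<in> Jn \<Longrightarrow> a (1 / of_real (E j k)) \<noteq> 0"
    "\<And>s lam. s \<notin> Lam T \<Longrightarrow> Delta T p s lam = \<phi> (1 / lam) * (- a (1 / lam) * Pfun T s + b (1 / lam))"
    using residual_coefficients by blast
  have cont: "continuous_on UNIV a" "continuous_on UNIV b"
    using ab(1,2) by (auto intro: holomorphic_on_imp_continuous_on)
  have D: "D s lam = - a (1 / lam) * Pfun T s + b (1 / lam)" if s: "s \<notin> Lam T" and lam: "lam \<noteq> 0" for s lam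
  proof -
    obtain g where g: "g holomorphic_on UNIV" "\<And>lam. lam \<noteq> 0 \<Longrightarrow> D s lam = g (1 / lam)"
        "\<And>lam. lam \<noteq> 0 \<Longrightarrow> Delta T p s lam = D s lam * Delta_flat J E lam"
      using resid s unfolding residual_det_def by blast
    \<comment> \<open>The hypothesis on \<open>D\<close> fixes only its product with
      \<open>Delta_flat\<close>. At zeros of that factor, and at \<open>z = 0\<close>, the value is
      recovered from the continuity of \<open>g\<close>.\<close>
    have "g z = - a z * Pfun T s + b z" for z
    proof (rule continuous_eq_off_countable[of g "\<lambda>z. - a z * Pfun T s + b z" "{z. \<phi> z = 0} \<union> {0}"])
      show "continuous_on UNIV g" by (rule holomorphic_on_imp_continuous_on[OF g(1)])
      show "continuous_on UNIV (\<lambda>z. - a z * Pfun T s + b z)" by (intro continuous_intros cont)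
      fix z assume "z \<notin> {z. \<phi> z = 0} \<union> {0}"
      hence z: "\<phi> z \<noteq> 0" "1 / z \<noteq> 0" by auto
      have "Delta T p s (1 / z) = \<phi> z * g z"
        using g(2,3)[OF z(2)] by (simp add: Delta_flat_eq)
      moreover have "Delta T p s (1 / z) = \<phi> z * (- a z * Pfun T s + b z)"
        using ab(8)[OF s, of "1 / z"] by simp
      ultimately have "\<phi> z * g z = \<phi> z * (- a z * Pfun T s + b z)" by (rule trans[OF sym])
      thus "g z = - a z * Pfun T s + b z" by (rule mult_left_cancel[OF z(1), THEN iffD1])
    qed (use \<phi>_zeros_countable in auto)
    thus ?thesis using g(2)[OF lam] by simp
  qed
  have alpha: "alpha D lam = a (1 / lam)" if "lam \<noteq> 0" for lam
  proof -
    have "residue (\<lambda>s. D s lam) (\<i> / 2) = \<i> * a (1 / lam)"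
      by (rule residue_affine_sech_sum[OF omega_pos[OF T_pos]])
         (use D[OF _ that] in \<open>simp add: Lam_eq Pfun_eq\<close>)
    thus ?thesis by (simp add: alpha_def)
  qed
  have beta: "beta T D lam = b (1 / lam)" if "lam \<noteq> 0" for lam
    unfolding beta_def D[OF half_periods_not_Lam[OF T_pos] that] Pfun_eq sech_sum_half_periods by simp
  show ?thesis
  proof (intro conjI allI impI ballI)
    show "D s lam = - alpha D lam * Pfun T s + beta T D lam" if "s \<notin> Lam T \<and> lam \<noteq> 0" for s lam
      using that D alpha beta by simp
    show "entire_in_inverse (alpha D)" unfolding entire_in_inverse_def using ab(1) alpha by blast
    show "entire_in_inverse (beta T D)" unfolding entire_in_inverse_def using ab(2) beta by blast
    show "cnj (alpha D lam) = alpha D (cnj lam)" "cnj (beta T D lam) = beta T D (cnj lam)" if "lam \<noteq> 0" for lam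
      using that by (simp_all add: alpha beta ab)
    show "alpha D (- lam) = - alpha D lam" "beta T D (- lam) = beta T D lam" if "lam \<noteq> 0" for lam
      using that ab(3,4)[of "1 / lam"] by (simp_all add: alpha beta)
    show "alpha D (complex_of_real (E j k)) \<noteq> 0" if "j \<in> J" "\<not> flat (E j)" for j k
      using ab(7)[of j k] E_nz[OF that(1)] that by (simp add: alpha Jn_def)
  qed
qed

end
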